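(* Let $n\ge 2$ be an integer and let $\xi\in\mathbb{R}$ with $[\mathbb{Q}(\xi):\mathbb{Q}]>n$. Then \[ \widehat{\lambda}_n(\xi)\le \frac{1}{n/2+a\sqrt{n}+1/3},\qquad a=\frac{1-\log(2)}{2}. \]
   Context: For $\xi\in\mathbb{R}$ and an integer $n\ge1$, $\widehat{\lambda}_n(\xi)$ denotes the supremum of all $\lambda\ge0$ such that, for every sufficiently large real $X$, the conditions $|x_0|\le X$ and $\max_{1\le k\le n}|x_0\xi^k-x_k|\le X^{-\lambda}$ admit a non-zero solution $(x_0,\dots,x_n)\in\mathbb{Z}^{n+1}$. *)

theory Defs
  imports
    "HOL-Analysis.Analysis"
    "HOL-Algebra.Algebraic_Closure_Type"
    "HOL-Algebra.Generated_Fields"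
    "HOL-Library.Extended_Nat"
begin

abbreviation real_ring :: "real ring" where
  "real_ring \<equiv> ring_of_type_algebra"

definition rat_adjoin :: "real \<Rightarrow> real set" where
  "rat_adjoin \<xi> = generate_field real_ring (insert \<xi> \<rat>)"

text \<open>\<^const>\<open>ring.dim\<close> is only meaningful for finite-dimensional spaces, so infinite degree is
  split off explicitly.\<close>

definition extension_degree :: "('a, 'b) ring_scheme \<Rightarrow> 'a set \<Rightarrow> 'a set \<Rightarrow> enat" where
  "extension_degree R K L =
     (if ring.finite_dimension R K L then enat (ring.dim R K L) else \<infinity>)"

definition admissible_exponent :: "nat \<Rightarrow> real \<Rightarrow> real \<Rightarrow> bool" where
  "admissible_exponent n \<xi> lam \<longleftrightarrow>
     (\<forall>\<^sub>F T in at_top. \<exists>x :: nat \<Rightarrow> int.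
        (\<exists>k\<in>{0..n}. x k \<noteq> 0) \<and>
        \<bar>real_of_int (x 0)\<bar> \<le> T \<and>
        (MAX k\<in>{1..n}. \<bar>real_of_int (x 0) * \<xi> ^ k - real_of_int (x k)\<bar>) \<le> T powr (- lam))"

text \<open>The supremum is taken in the extended reals because it is infinite for rational \<open>\<xi>\<close>.\<close>

definition uniform_exponent :: "nat \<Rightarrow> real \<Rightarrow> ereal" where
  "uniform_exponent n \<xi> = Sup (ereal ` {lam. 0 \<le> lam \<and> admissible_exponent n \<xi> lam})"

end

theory Submission
  imports Defs "Jordan_Normal_Form.Determinant" "HOL-Computational_Algebra.Computational_Algebra"
begin

text \<open>
  Let \<open>N\<close> be the claimed denominator and suppose that some \<open>lam > 1 / N\<close> is admissible. Let \<open>z T\<close> be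
  the best integer approximation to \<open>(1, \<xi>, \<dots>, \<xi>\<^sup>n)\<close> of height at most \<open>T\<close>. The integer polynomials of degree
  at most \<open>l\<close> that annihilate all windows of \<open>l + 1\<close> consecutive coordinates of given points \<open>z T\<close> form a
  module which, if the rank of the windows is smaller than for points in general position,
  consists of multiples of a single polynomial.

  For a run of points starting at \<open>I\<close> let \<open>E r\<close> be the logarithm of the last height up to which the run
  spans only \<open>r\<close> dimensions. A Siegel lemma in the annihilator of a suitable segment provides a small
  polynomial that does not annihilate the point before the segment; its value there cannot be too
  small, which bounds a sum of the \<open>E t\<close> from above in terms of one of them (\<open>main_inequality\<close>). On
  the other hand, nonzero minors of the windows of a single point bound its error from below, and with
  a pigeonhole substitute for Minkowski's theorem this shows that consecutive \<open>E t\<close> are close to each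
  other (\<open>growth_inequality\<close>). Comparing the two along a geometric progression is a contradiction for
  suitable parameters, which are tabulated for \<open>n < 7400\<close> and chosen uniformly for larger \<open>n\<close>.
\<close>

section \<open>Saturated modules of integer polynomials\<close>

text \<open>The obstacle is degeneracy: the product bounds need every subsegment to have the window
  rank of general position, and nothing guarantees this. The remedy is extremal. Among the ranks of
  segments with a single generator that recur arbitrarily late, the least is taken; inside such a
  segment a rank is generic or has already reached that value, and its polynomial is followed
  downwards to the first point it does not annihilate.

  The size of the bound comes from a heuristic. Put \<open>N = n/2 + t\<close>,
  \<open>n = 2k + j\<close>, \<open>x = h j\<close> and u = 1 - exp (-x). If consecutive
  \<open>E t\<close> have ratio \<open>1 - h\<close>, a contradiction needs \<open>N\<close> \<le>
  \<open>k + (1 - (1 - h)^j) / h\<close>, to leading order t \<le> j (u/x - 1/2). Forcing that ratio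
  then requires about j u/x \<le> x n/(2j). Together this allows t up to (u - x/2) / sqrt (2u) times
  sqrt n. At x = ln 2 the factor is (1 - ln 2)/2; at x = 1/2 it is about 0.1617, and this surplus
  lets crude rational estimates suffice for large n.\<close>

hide_const (open) Polynomials.degree Polynomials.lead_coeff up_ring.coeff up_ring.monom module.smult

text \<open>A saturated module is determined by the degrees occurring in it, and their number is the
  dimension of its rational span.\<close>

definition dm :: "int poly set \<Rightarrow> nat" where
  "dm V = card (degree ` (V - {0}))"

text \<open>The last clause makes \<open>V\<close> the set of all integer polynomials in its
  rational span: leading terms can be cancelled by cross-multiplication and the factor divided out
  afterwards.\<close>

definition saturated :: "nat \<Rightarrow> int poly set \<Rightarrow> bool" where
  "saturated l V \<longleftrightarrow> 0 \<in> V \<and> (\<forall>P\<in>V. degree P \<le> l) \<and> (\<forall>P\<in>V. \<forall>Q\<in>V. P + Q \<in> V) \<and>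
     (\<forall>P c. c \<noteq> 0 \<longrightarrow> (smult c P \<in> V \<longleftrightarrow> P \<in> V))"

lemma saturated_zero: "saturated l V \<Longrightarrow> 0 \<in> V"
  and saturated_degree: "saturated l V \<Longrightarrow> P \<in> V \<Longrightarrow> degree P \<le> l"
  and saturated_add: "saturated l V \<Longrightarrow> P \<in> V \<Longrightarrow> Q \<in> V \<Longrightarrow> P + Q \<in> V"
  and saturated_cancel: "saturated l V \<Longrightarrow> smult c P \<in> V \<Longrightarrow> c \<noteq> 0 \<Longrightarrow> P \<in> V"
  by (simp_all add: saturated_def)

lemma saturated_smult: "saturated l V \<Longrightarrow> P \<in> V \<Longrightarrow> smult c P \<in> V"
  by (cases "c = 0") (simp_all add: saturated_def)

lemma saturated_diff: "saturated l V \<Longrightarrow> P \<in> V \<Longrightarrow> Q \<in> V \<Longrightarrow> P - Q \<in> V"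
  using saturated_add[of l V P "smult (-1) Q"] saturated_smult[of l V Q "-1"] by simp

lemma finite_degrees: "saturated l V \<Longrightarrow> finite (degree ` (V - {0}))"
  by (rule finite_subset[of _ "{..l}"]) (auto dest: saturated_degree)

lemma degree_reduce:
  fixes P Q :: "int poly"
  assumes "degree P = degree Q" "P \<noteq> 0" "Q \<noteq> 0"
  defines "R \<equiv> smult (lead_coeff Q) P - smult (lead_coeff P) Q"
  shows "R = 0 \<or> degree R < degree P"
proof (cases "degree P = 0")
  case True
  then obtain a b where "P = [:a:]" "Q = [:b:]"
    using assms by (metis degree_eq_zeroE)
  then show ?thesis using assms by simp
next
  case False
  have "degree R \<le> degree P"
    unfolding R_def using assms by (intro degree_diff_le) (auto simp: degree_smult_le)
  moreover have "coeff R (degree P) = 0"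
    unfolding R_def using assms by simp
  ultimately show ?thesis
    using False by (metis leading_coeff_0_iff le_neq_implies_less)
qed

text \<open>Induction on the degree: a polynomial of \<open>V'\<close> has the degree of some
  \<open>Q\<close> in \<open>V\<close>, and cross-multiplied cancellation lowers it. Through
  \<open>dm_eqD\<close> this becomes "equal dimension implies equality".\<close>

lemma saturated_reduce:
  assumes "saturated l V" "saturated l' V'" "V \<subseteq> V'" "degree ` (V' - {0}) \<subseteq> degree ` (V - {0})"
  shows "V' = V"
proof -
  have "P \<in> V' \<longrightarrow> P \<in> V" for P
  proof (induction "degree P" arbitrary: P rule: less_induct)
    case less
    show ?case
    proof
      assume P: "P \<in> V'"
      show "P \<in> V"
      proof (cases "P = 0")
        case True
        then show ?thesis using assms(1) by (simp add: saturated_zero)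
      next
        case False
        with P assms(4) obtain Q where Q: "Q \<in> V" "Q \<noteq> 0" "degree P = degree Q" by blast
        define R where "R = smult (lead_coeff Q) P - smult (lead_coeff P) Q"
        have RV': "R \<in> V'"
          unfolding R_def using P Q assms by (auto intro!: saturated_diff saturated_smult)
        have "R \<in> V"
          using degree_reduce[OF Q(3) False Q(2)] less RV' saturated_zero[OF assms(1)]
          unfolding R_def[symmetric] by auto
        then have "R + smult (lead_coeff P) Q \<in> V"
          using Q(1) assms(1) by (intro saturated_add saturated_smult)
        then have "smult (lead_coeff Q) P \<in> V" by (simp add: R_def)
        then show ?thesis using Q(2) saturated_cancel[OF assms(1)] by simp
      qed
    qed
  qed
  then show ?thesis using assms(3) by blast
qed

lemma dm_mono: "saturated l' V' \<Longrightarrow> V \<subseteq> V' \<Longrightarrow> dm V \<le> dm V'"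
  unfolding dm_def by (intro card_mono finite_degrees) auto

lemma dm_eqD:
  assumes "saturated l V" "saturated l' V'" "V \<subseteq> V'" "dm V' \<le> dm V"
  shows "V' = V"
proof (rule saturated_reduce[OF assms(1-3)])
  have "degree ` (V - {0}) = degree ` (V' - {0})"
    using assms unfolding dm_def
    by (intro card_seteq finite_degrees[OF assms(2)]) auto
  then show "degree ` (V' - {0}) \<subseteq> degree ` (V - {0})" by simp
qed

lemma dm_pos:
  assumes "saturated l V" "V \<noteq> {0}"
  shows "dm V > 0"
  using assms finite_degrees[OF assms(1)] saturated_zero[OF assms(1)]
  unfolding dm_def by (auto simp: card_gt_0_iff)

section \<open>Integer polynomials as linear forms on integer vectors\<close>

definition pr :: "int poly \<Rightarrow> (nat \<Rightarrow> int) \<Rightarrow> int" where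
  "pr P u = (\<Sum>a\<le>degree P. coeff P a * u a)"

lemma pr_bound: "degree P \<le> l \<Longrightarrow> pr P u = (\<Sum>a\<le>l. coeff P a * u a)"
  unfolding pr_def by (rule sum.mono_neutral_left) (auto simp: coeff_eq_0)

lemma pr_0 [simp]: "pr 0 u = 0"
  by (simp add: pr_def)

lemma pr_add: "pr (P + Q) u = pr P u + pr Q u"
proof -
  let ?l = "max (degree P) (degree Q)"
  have "degree (P + Q) \<le> ?l" by (rule degree_add_le_max)
  then show ?thesis
    by (simp add: pr_bound[of _ ?l] sum.distrib algebra_simps)
qed

lemma pr_smult: "pr (smult c P) u = c * pr P u"
proof -
  have "degree (smult c P) \<le> degree P" by simp
  then show ?thesis
    by (simp add: pr_bound[of _ "degree P"] sum_distrib_left mult.assoc)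
qed

lemma pr_diff: "pr (P - Q) u = pr P u - pr Q u"
proof -
  have "pr P u = pr (P - Q) u + pr Q u"
    by (subst pr_add[symmetric]) simp
  then show ?thesis by simp
qed

lemma pr_sum: "pr (\<Sum>i\<in>A. f i) u = (\<Sum>i\<in>A. pr (f i) u)"
  by (induction A rule: infinite_finite_induct) (auto simp: pr_add)

lemma pr_monom: "pr (monom c a) u = c * u a"
  by (cases "c = 0") (simp_all add: pr_def degree_monom_eq coeff_monom if_distrib[of "\<lambda>x. x * _"] sum.delta' cong: if_cong)

definition win :: "(nat \<Rightarrow> int) \<Rightarrow> nat \<Rightarrow> nat \<Rightarrow> int" where
  "win x b = (\<lambda>a. x (a + b))"

lemma win_win: "win (win x b) c = win x (b + c)"
  by (auto simp: win_def fun_eq_iff add_ac)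

lemma win_0 [simp]: "win x 0 = x"
  by (simp add: win_def)

text \<open>Multiplication by the variable is adjoint to shifting the window. This identity links
  the annihilators of windows of different lengths.\<close>

lemma pr_pCons: "pr (pCons 0 P) u = pr P (win u 1)"
proof -
  have "degree (pCons 0 P) \<le> Suc (degree P)" by (rule degree_pCons_le)
  then have "pr (pCons 0 P) u = (\<Sum>a\<le>Suc (degree P). coeff (pCons 0 P) a * u a)"
    by (rule pr_bound)
  also have "\<dots> = pr P (win u 1)"
    by (subst sum.atMost_Suc_shift) (simp add: pr_def win_def)
  finally show ?thesis .
qed

lemma pr_monom_mult: "pr (monom 1 t * P) u = pr P (win u t)"
proof (induction t arbitrary: u)
  case (Suc t)
  have "monom 1 (Suc t) * P = pCons 0 (monom 1 t * P)"
    by (simp add: monom_Suc)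
  then show ?case using Suc by (simp add: pr_pCons win_win)
qed simp

definition annih :: "nat \<Rightarrow> (nat \<Rightarrow> int) set \<Rightarrow> int poly set" where
  "annih l F = {P. degree P \<le> l \<and> (\<forall>u\<in>F. pr P u = 0)}"

lemma saturated_annih: "saturated l (annih l F)"
  unfolding saturated_def annih_def
  by (simp add: pr_add pr_smult degree_add_le)

lemma annih_Un: "annih l (F \<union> F') = annih l F \<inter> annih l F'"
  unfolding annih_def by auto

lemma annih_anti: "F \<subseteq> F' \<Longrightarrow> annih l F' \<subseteq> annih l F"
  unfolding annih_def by auto

lemma dm_annih_empty: "dm (annih l {}) = Suc l"
proof -
  have "degree ` (annih l {} - {0}) = {..l}"
  proof
    show "{..l} \<subseteq> degree ` (annih l {} - {0})"
    proof
      fix d assume "d \<in> {..l}"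
      then have "monom 1 d \<in> annih l {} - {0}" "degree (monom (1::int) d) = d"
        by (auto simp: annih_def degree_monom_eq)
      then show "d \<in> degree ` (annih l {} - {0})" by (metis image_eqI)
    qed
  qed (auto simp: annih_def)
  then show ?thesis by (simp add: dm_def)
qed

text \<open>Take \<open>P0\<close> of least degree with \<open>pr P0 u\<close> nonzero. Every other
  violating polynomial of larger degree is corrected by a multiple of \<open>P0\<close> without
  changing its degree, so only the degree of \<open>P0\<close> can get lost.\<close>

lemma dm_annih_insert: "dm (annih l F) \<le> Suc (dm (annih l (insert u F)))"
proof (cases "annih l F = annih l (insert u F)")
  case False
  let ?V = "annih l F" and ?V' = "annih l (insert u F)"
  have sub: "?V' \<subseteq> ?V" by (rule annih_anti) auto
  with False have ne: "\<exists>P. P \<in> ?V \<and> pr P u \<noteq> 0" by (auto simp: annih_def)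
  define P0 where "P0 = arg_min degree (\<lambda>P. P \<in> ?V \<and> pr P u \<noteq> 0)"
  have P0: "P0 \<in> ?V" "pr P0 u \<noteq> 0" and min: "\<And>P. P \<in> ?V \<Longrightarrow> pr P u \<noteq> 0 \<Longrightarrow> degree P0 \<le> degree P"
    using arg_min_nat_lemma[of "\<lambda>P. P \<in> ?V \<and> pr P u \<noteq> 0" _ degree] ne
    unfolding P0_def by blast+
  have "degree ` (?V - {0}) \<subseteq> insert (degree P0) (degree ` (?V' - {0}))"
  proof
    fix d assume "d \<in> degree ` (?V - {0})"
    then obtain P where P: "P \<in> ?V" "P \<noteq> 0" "d = degree P" by auto
    show "d \<in> insert (degree P0) (degree ` (?V' - {0}))"
    proof (cases "pr P u = 0 \<or> d = degree P0")
      case True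
      with P show ?thesis by (auto simp: annih_def)
    next
      case False
      with min P have lt: "degree P0 < degree P" by fastforce
      define R where "R = smult (pr P0 u) P - smult (pr P u) P0"
      have "R \<in> ?V" unfolding R_def using P P0 saturated_annih by (intro saturated_diff saturated_smult)
      moreover have "pr R u = 0" by (simp add: R_def pr_diff pr_smult)
      ultimately have "R \<in> ?V'" by (auto simp: annih_def)
      moreover have "degree R = degree P"
        unfolding R_def using lt P0 False
        by (subst diff_conv_add_uminus, subst degree_add_eq_left) (auto simp: le_less_trans[OF degree_smult_le])
      ultimately show ?thesis using P lt by (auto intro!: image_eqI[of _ _ R])
    qed
  qed
  then have "dm ?V \<le> card (insert (degree P0) (degree ` (?V' - {0})))"
    unfolding dm_def by (intro card_mono finite.insertI finite_degrees[OF saturated_annih])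
  also have "\<dots> \<le> Suc (dm ?V')"
    unfolding dm_def by (simp add: card_insert_if finite_degrees[OF saturated_annih])
  finally show ?thesis .
next
  case True
  from arg_cong[OF this, of dm] show ?thesis by linarith
qed

text \<open>Gauss's lemma: the content is multiplicative, so \<open>c\<close> divides the content of
  the cofactor of \<open>G\<close>.\<close>

lemma dvd_smult_primitive:
  fixes G P :: "int poly"
  assumes "content G = 1" "G dvd smult c P" "c \<noteq> 0"
  shows "G dvd P"
proof -
  obtain Q where Q: "smult c P = G * Q" using assms(2) by (rule dvdE)
  have "[:c:] dvd smult c P" using dvd_triv_left[of "[:c:]" P] by simp
  then have "c dvd content (smult c P)" by (rule const_poly_dvd_iff_dvd_content[THEN iffD1])
  also have "content (smult c P) = content G * content Q" unfolding Q by (rule content_mult)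
  also have "\<dots> = content Q" unfolding assms(1) by (rule mult_1)
  finally have "[:c:] dvd Q" by (rule const_poly_dvd_iff_dvd_content[THEN iffD2])
  then obtain Q' where "Q = [:c:] * Q'" by (rule dvdE)
  then have "Q = smult c Q'" by simp
  with Q have "smult c P = smult c (G * Q')" by simp
  with assms have "P = G * Q'" by (simp only: smult_cancel)
  then show ?thesis by simp
qed

text \<open>If passing from \<open>V\<close> to the polynomials that may still be shifted loses only one dimension, then \<open>V\<close>
  is spanned by the shifts of a single primitive polynomial.\<close>

locale structured =
  fixes V V' :: "int poly set" and l :: nat
  assumes satV: "saturated l V"
    and V': "V' = {P \<in> V. pCons 0 P \<in> V}"
    and ne: "V' \<noteq> {0}"
    and dim: "dm V \<le> Suc (dm V')"
begin

lemma satV': "saturated l V'"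
proof -
  have "P + Q \<in> V'" if "P \<in> V'" "Q \<in> V'" for P Q
    using that saturated_add[OF satV, of P Q] saturated_add[OF satV, of "pCons 0 P" "pCons 0 Q"]
    by (simp add: V')
  moreover have "smult c P \<in> V' \<longleftrightarrow> P \<in> V'" if "c \<noteq> 0" for c P
  proof -
    have "smult c R \<in> V \<longleftrightarrow> R \<in> V" for R using satV that unfolding saturated_def by blast
    from this[of P] this[of "pCons 0 P"] show ?thesis by (simp add: V')
  qed
  ultimately show ?thesis
    using saturated_zero[OF satV] saturated_degree[OF satV] unfolding saturated_def by (simp add: V')
qed

text \<open>The degrees of \<open>V\<close> include those of \<open>V'\<close> and their successors,
  and only one extra degree is allowed. So the degrees of \<open>V'\<close> form an interval, those
  of \<open>V\<close> the same interval with one point on top, and the primitive part of an element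
  of least degree generates everything.\<close>

lemma exists_generator:
  obtains G where "G \<noteq> 0" "content G = 1" "\<And>t. t < dm V' \<Longrightarrow> monom 1 t * G \<in> V'"
    "dm V = Suc (dm V')"
    "\<And>P. P \<in> V \<Longrightarrow> G dvd P" "\<And>P. P \<in> V \<Longrightarrow> P \<noteq> 0 \<Longrightarrow> degree P \<le> degree G + dm V'"
    "degree G + dm V' \<le> l"
proof -
  let ?E = "degree ` (V - {0})" and ?E' = "degree ` (V' - {0})"
  have fin: "finite ?E" "finite ?E'" using finite_degrees[OF satV] finite_degrees[OF satV'] by auto
  have E'ne: "?E' \<noteq> {}" using ne saturated_zero[OF satV'] by auto
  have sub: "?E' \<union> Suc ` ?E' \<subseteq> ?E"
  proof -
    have "Suc d \<in> ?E" if "d \<in> ?E'" for d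
    proof -
      from that obtain P where P: "P \<in> V'" "P \<noteq> 0" "d = degree P" by auto
      then have "pCons 0 P \<in> V - {0}" "degree (pCons 0 P) = Suc d" by (auto simp: V')
      then show ?thesis by (metis image_eqI)
    qed
    moreover have "?E' \<subseteq> ?E" by (auto simp: V')
    ultimately show ?thesis by auto
  qed
  define M where "M = Max ?E'"
  define e where "e = Min ?E'"
  have M: "M \<in> ?E'" "\<And>d. d \<in> ?E' \<Longrightarrow> d \<le> M" unfolding M_def using fin E'ne by auto
  have e: "e \<in> ?E'" "\<And>d. d \<in> ?E' \<Longrightarrow> e \<le> d" unfolding e_def using fin E'ne by auto
  have cE: "card ?E \<le> Suc (card ?E')" using dim by (simp add: dm_def)
  have insub: "insert (Suc M) ?E' \<subseteq> ?E" using sub M by blast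
  have "Suc M \<notin> ?E'" using M(2) by fastforce
  then have "card (insert (Suc M) ?E') = Suc (card ?E')" using fin by simp
  with cE insub fin have Eeq: "?E = insert (Suc M) ?E'"
    by (metis card_seteq)
  have cont: "Suc d \<in> ?E'" if "d \<in> ?E'" "d < M" for d
  proof -
    have "Suc d \<in> ?E" using sub that(1) by blast
    then have "Suc d = Suc M \<or> Suc d \<in> ?E'" unfolding Eeq by (rule insertE) auto
    then show ?thesis using that(2) by simp
  qed
  have int: "e + i \<in> ?E'" if "e + i \<le> M" for i
    using that by (induction i) (use e cont in auto)
  have E'eq: "?E' = {e..M}"
  proof
    show "{e..M} \<subseteq> ?E'" using int by (metis atLeastAtMost_iff le_add_diff_inverse subsetI)
    show "?E' \<subseteq> {e..M}" using e(2) M(2) by (intro subsetI) (simp only: atLeastAtMost_iff)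
  qed
  have eM: "e \<le> M" using e M by auto
  have w: "dm V' = Suc M - e" unfolding dm_def E'eq by simp
  have E: "?E = {e..Suc M}" using Eeq E'eq eM by auto
  have dmV: "dm V = Suc (dm V')" using E eM unfolding w by (simp add: dm_def)
  from e(1) obtain P0 where P0: "P0 \<in> V'" "P0 \<noteq> 0" "degree P0 = e" by auto
  define G where "G = primitive_part P0"
  have P0G: "P0 = smult (content P0) G" by (simp add: G_def)
  have G0: "G \<noteq> 0" and cG: "content G = 1" using P0 by (auto simp: G_def)
  have dG: "degree G = e" using P0 by (simp add: G_def)
  have GV': "G \<in> V'"
  proof (rule saturated_cancel[OF satV'])
    show "smult (content P0) G \<in> V'" using P0G P0(1) by simp
  qed (use P0 in simp)
  have nzm: "monom 1 t * G \<noteq> 0" for t using G0 by simp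
  have degm: "degree (monom 1 t * G) = t + e" for t
    using G0 dG by (simp add: degree_mult_eq degree_monom_eq)
  have that0: "\<exists>i\<le>t. d = i + e" if "d \<in> ?E" "d \<le> e + t" for d t
    using that unfolding E by (intro exI[of _ "d - e"]) auto
  have that0': "\<exists>i\<le>dm V'. d = i + e" if "d \<in> ?E" for d
    using that eM unfolding E w by (intro exI[of _ "d - e"]) auto
  \<comment> \<open>The shifts of \<open>G\<close> by at most \<open>t\<close> realise every degree
    up to \<open>e + t\<close> that occurs in \<open>V\<close>, so \<open>P\<close> reduces to zero
    modulo them.\<close>
  have low: "P \<in> V'" if "\<And>i. i \<le> t \<Longrightarrow> monom 1 i * G \<in> V'" "P \<in> V" "P = 0 \<or> degree P \<le> e + t" for P t
    using that(2,3)
  proof (induction "degree P" arbitrary: P rule: less_induct)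
    case less
    show ?case
    proof (cases "P = 0")
      case False
      with less.prems have "degree P \<in> ?E" "degree P \<le> e + t" by auto
      then obtain i where i: "degree P = i + e" "i \<le> t"
        using that0[of "degree P"] by blast
      let ?Q = "monom 1 i * G"
      define R where "R = smult (lead_coeff ?Q) P - smult (lead_coeff P) ?Q"
      have QV': "?Q \<in> V'" using that(1) i by simp
      have "R \<in> V" unfolding R_def
        using QV' less.prems satV V' by (auto intro!: saturated_diff saturated_smult)
      moreover have "R = 0 \<or> degree R < degree P" unfolding R_def
        by (rule degree_reduce) (use i degm False nzm in auto)
      ultimately have "R \<in> V'" using less saturated_zero[OF satV'] by (cases "R = 0") auto
      then have "R + smult (lead_coeff P) ?Q \<in> V'"
        using QV' satV' by (intro saturated_add saturated_smult)
      then have "smult (lead_coeff ?Q) P \<in> V'" by (simp add: R_def)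
      then show ?thesis using nzm[of i] saturated_cancel[OF satV'] by (metis leading_coeff_0_iff)
    qed (use saturated_zero[OF satV'] in simp)
  qed
  \<comment> \<open>A shift lies in \<open>V\<close> because its predecessor lies in
    \<open>V'\<close>. To see it in \<open>V'\<close> again, compare it with an \<open>R\<close> in
    \<open>V'\<close> of the same degree; \<open>low\<close> takes care of the difference.\<close>
  have mon: "\<forall>i\<le>t. monom 1 i * G \<in> V'" if "t < dm V'" for t
    using that
  proof (induction t)
    case (Suc t)
    then have IH: "\<forall>i\<le>t. monom 1 i * G \<in> V'" by simp
    let ?Q = "monom 1 (Suc t) * G"
    have Qx: "?Q = pCons 0 (monom 1 t * G)" by (simp add: monom_Suc)
    have QV: "?Q \<in> V" using IH by (auto simp: Qx V')
    have "Suc t + e \<in> ?E'" using Suc.prems by (auto simp: E'eq w)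
    then obtain R where R: "R \<in> V'" "R \<noteq> 0" "degree ?Q = degree R" using degm[of "Suc t"] by (smt (verit) DiffE imageE singletonI)
    define S where "S = smult (lead_coeff R) ?Q - smult (lead_coeff ?Q) R"
    have "S \<in> V" unfolding S_def using QV R satV V' by (auto intro!: saturated_diff saturated_smult)
    moreover have "S = 0 \<or> degree S < degree ?Q"
      unfolding S_def by (rule degree_reduce) (use R nzm in auto)
    ultimately have "S \<in> V'" using low[of t S] IH degm[of "Suc t"] by auto
    then have "S + smult (lead_coeff ?Q) R \<in> V'"
      using R satV' by (intro saturated_add saturated_smult)
    then have "smult (lead_coeff R) ?Q \<in> V'" by (simp add: S_def)
    then have "?Q \<in> V'" using R saturated_cancel[OF satV'] by (metis leading_coeff_0_iff)
    with IH show ?case by (metis le_Suc_eq)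
  qed (use GV' in simp)
  have monV: "monom 1 i * G \<in> V" if "i \<le> dm V'" for i
  proof (cases i)
    case 0
    then show ?thesis using GV' by (simp add: V')
  next
    case (Suc t)
    then have "monom 1 t * G \<in> V'" using mon[of t] that by auto
    then show ?thesis by (simp add: Suc monom_Suc V')
  qed
  have dvd: "G dvd P" if "P \<in> V" for P
    using that
  proof (induction "degree P" arbitrary: P rule: less_induct)
    case less
    show ?case
    proof (cases "P = 0")
      case False
      with less.prems have "degree P \<in> ?E" by auto
      then obtain i where i: "degree P = i + e" "i \<le> dm V'"
        using that0'[of "degree P"] by blast
      let ?Q = "monom 1 i * G"
      define R where "R = smult (lead_coeff ?Q) P - smult (lead_coeff P) ?Q"
      have "R \<in> V" unfolding R_def
        using monV[OF i(2)] less.prems satV by (auto intro!: saturated_diff saturated_smult)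
      moreover have "R = 0 \<or> degree R < degree P" unfolding R_def
        by (rule degree_reduce) (use i degm False nzm in auto)
      ultimately have "G dvd R" using less by (cases "R = 0") auto
      then have "G dvd R + smult (lead_coeff P) ?Q"
        by (intro dvd_add dvd_smult dvd_triv_right)
      then have "G dvd smult (lead_coeff ?Q) P" by (simp add: R_def)
      then show ?thesis using nzm[of i] dvd_smult_primitive[OF cG] by (metis leading_coeff_0_iff)
    qed simp
  qed
  have "Suc M \<in> ?E" using E eM by auto
  then have "Suc M \<le> l" using saturated_degree[OF satV] by auto
  then have "degree G + dm V' \<le> l" using w eM dG by simp
  moreover have "degree P \<le> degree G + dm V'" if "P \<in> V" "P \<noteq> 0" for P
  proof -
    have "degree P \<in> ?E" using that by auto
    then show ?thesis unfolding E using w eM dG by simp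
  qed
  ultimately show ?thesis using that[of G] G0 cG mon dmV dvd by blast
qed

end

section \<open>Windows\<close>

text \<open>\<open>W n l S\<close> is the kernel and \<open>rk n l S\<close> the rank of the Hankel matrix whose rows are the windows
  \<open>x b, \<dots>, x (b + l)\<close> of the points \<open>x \<in> S\<close>.\<close>

definition wins :: "nat \<Rightarrow> (nat \<Rightarrow> int) set \<Rightarrow> (nat \<Rightarrow> int) set" where
  "wins m S = {win x b |x b. x \<in> S \<and> b \<le> m}"

definition W :: "nat \<Rightarrow> nat \<Rightarrow> (nat \<Rightarrow> int) set \<Rightarrow> int poly set" where
  "W n l S = annih l (wins (n - l) S)"

definition rk :: "nat \<Rightarrow> nat \<Rightarrow> (nat \<Rightarrow> int) set \<Rightarrow> nat" where
  "rk n l S = Suc l - dm (W n l S)"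

lemma W_iff: "P \<in> W n l S \<longleftrightarrow> degree P \<le> l \<and> (\<forall>x\<in>S. \<forall>b\<le>n - l. pr P (win x b) = 0)"
  unfolding W_def annih_def wins_def by blast

lemma saturated_W: "saturated l (W n l S)"
  unfolding W_def by (rule saturated_annih)

lemma W_zero: "0 \<in> W n l S"
  by (simp add: W_iff)

lemma dm_W_le: "dm (W n l S) \<le> Suc l"
proof -
  have "W n l S \<subseteq> annih l {}" unfolding W_def by (rule annih_anti) simp
  from dm_mono[OF saturated_annih this] show ?thesis by (simp only: dm_annih_empty)
qed

lemma dm_W: "dm (W n l S) + rk n l S = Suc l"
  using dm_W_le[of n l S] by (simp add: rk_def)

lemma W_anti: "S \<subseteq> S' \<Longrightarrow> W n l S' \<subseteq> W n l S"
  unfolding W_iff subset_iff by blast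

lemma rk_mono: "S \<subseteq> S' \<Longrightarrow> rk n l S \<le> rk n l S'"
  using dm_mono[OF saturated_W W_anti, of S S' n l] by (simp add: rk_def)

lemma W_eqI: "S \<subseteq> S' \<Longrightarrow> rk n l S' \<le> rk n l S \<Longrightarrow> W n l S = W n l S'"
  using dm_eqD[OF saturated_W saturated_W W_anti, of S S' n l] dm_W[of n l S] dm_W[of n l S'] by linarith

lemma W_level: "l \<le> l' \<Longrightarrow> W n l S \<subseteq> W n l' S"
  by (auto simp: W_iff)

text \<open>Every window is an initial or a final part of a window one longer. This puts two
  neighbouring levels into the form required by \<open>structured\<close>.\<close>

lemma W_Suc:
  assumes "Suc l \<le> n"
  shows "W n l S = {P \<in> W n (Suc l) S. pCons 0 P \<in> W n (Suc l) S}"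
proof (intro Set.set_eqI iffI)
  fix P assume P: "P \<in> W n l S"
  have "P \<in> W n (Suc l) S" using P W_level[of l "Suc l" n S] by auto
  moreover have "pCons 0 P \<in> W n (Suc l) S"
    using P assms unfolding W_iff by (auto simp: pr_pCons win_win degree_pCons_eq_if)
  ultimately show "P \<in> {P \<in> W n (Suc l) S. pCons 0 P \<in> W n (Suc l) S}" by simp
next
  fix P assume "P \<in> {P \<in> W n (Suc l) S. pCons 0 P \<in> W n (Suc l) S}"
  then have P: "P \<in> W n (Suc l) S" "pCons 0 P \<in> W n (Suc l) S" by simp_all
  have "degree P \<le> l" using P(2) by (cases "P = 0") (simp_all add: W_iff)
  moreover have "pr P (win x b) = 0" if "x \<in> S" "b \<le> n - l" for x b
  proof (cases "b \<le> n - Suc l")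
    case True
    then show ?thesis using P(1) that by (simp add: W_iff)
  next
    case False
    define c where "c = n - Suc l"
    have "b = c + 1" using False that assms by (simp add: c_def)
    moreover have "pr (pCons 0 P) (win x c) = 0" using P(2) that(1) by (simp add: W_iff c_def)
    ultimately show ?thesis by (simp add: pr_pCons win_win)
  qed
  ultimately show "P \<in> W n l S" by (simp add: W_iff)
qed

lemma W_shift:
  assumes "l \<le> l'" "l' \<le> n" "P \<in> W n l S"
  shows "monom 1 (l' - l) * P \<in> W n l' S"
proof (cases "P = 0")
  case False
  then have "degree (monom 1 (l' - l) * P) = l' - l + degree P"
    by (simp add: degree_mult_eq degree_monom_eq)
  then show ?thesis using assms by (auto simp: W_iff pr_monom_mult win_win)
qed (simp add: W_zero)

text \<open>At level \<open>n\<close> the windows are the points themselves, and annihilating the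
  windows at level \<open>l\<close> means that all shifts up to level \<open>n\<close> annihilate
  the points. So the ranks at all levels depend on the rational span of the points only.\<close>

lemma W_top_determines:
  assumes "l \<le> n" "W n n S = W n n S'"
  shows "W n l S = W n l S'"
proof -
  have "P \<in> W n l T \<longleftrightarrow> degree P \<le> l \<and> (\<forall>b\<le>n - l. monom 1 b * P \<in> W n n T)" for P T
  proof -
    have "degree (monom 1 b * P) \<le> n" if "degree P \<le> l" "b \<le> n - l" for b
      using that assms(1) degree_mult_le[of "monom 1 b" P] degree_monom_le[of "1::int" b] by linarith
    then show ?thesis by (auto simp: W_iff pr_monom_mult)
  qed
  then show ?thesis using assms(2) by (intro Set.set_eqI) simp
qed

lemma rk_top_determines: "l \<le> n \<Longrightarrow> W n n S = W n n S' \<Longrightarrow> rk n l S = rk n l S'"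
  using W_top_determines[of l n S S'] by (simp add: rk_def)

text \<open>\<open>G\<close> lives at level \<open>rk n l S\<close>, possibly far below
  \<open>l\<close>: it annihilates all windows of that shorter length, so its shifts alone account
  for the whole dimension of \<open>W n l S\<close>.\<close>

definition gen :: "nat \<Rightarrow> nat \<Rightarrow> (nat \<Rightarrow> int) set \<Rightarrow> int poly \<Rightarrow> bool" where
  "gen n l S G \<longleftrightarrow> G \<noteq> 0 \<and> content G = 1 \<and> rk n l S \<le> l \<and> G \<in> W n (rk n l S) S \<and> (\<forall>P\<in>W n l S. G dvd P)"

lemma W_multiples:
  assumes "G \<in> W n g S" "g + t \<le> l" "l \<le> n"
  shows "monom 1 t * G \<in> W n l S"
proof -
  have "monom 1 t * G \<in> W n (g + t) S" using W_shift[of g "g + t" n G S] assms by simp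
  then show ?thesis using W_level assms by blast
qed

lemma rk_le_of_killed:
  assumes "G \<in> W n g S" "G \<noteq> 0" "g \<le> l" "l \<le> n"
  shows "rk n l S \<le> g"
proof -
  have "(\<lambda>t. t + degree G) ` {..l - g} \<subseteq> degree ` (W n l S - {0})"
  proof
    fix d assume "d \<in> (\<lambda>t. t + degree G) ` {..l - g}"
    then obtain t where t: "t \<le> l - g" "d = t + degree G" by blast
    then have "monom 1 t * G \<in> W n l S - {0}" "degree (monom 1 t * G) = d"
      using W_multiples[of G n g S t l] assms by (simp_all add: degree_mult_eq degree_monom_eq)
    then show "d \<in> degree ` (W n l S - {0})" by (metis image_eqI)
  qed
  then have "card ((\<lambda>t. t + degree G) ` {..l - g}) \<le> dm (W n l S)"
    unfolding dm_def by (intro card_mono finite_degrees[OF saturated_W])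
  moreover have "card ((\<lambda>t. t + degree G) ` {..l - g}) = Suc (l - g)"
    by (subst card_image) (auto simp: inj_on_def)
  ultimately show ?thesis using assms(3) dm_W[of n l S] by linarith
qed

lemma structured_W:
  assumes "Suc l \<le> n" "W n l S \<noteq> {0}" "rk n l S \<le> rk n (Suc l) S"
  shows "structured (W n (Suc l) S) (W n l S) (Suc l)"
proof
  show "saturated (Suc l) (W n (Suc l) S)" by (rule saturated_W)
  show "W n l S = {P \<in> W n (Suc l) S. pCons 0 P \<in> W n (Suc l) S}" by (rule W_Suc[OF assms(1)])
  show "W n l S \<noteq> {0}" by fact
  show "dm (W n (Suc l) S) \<le> Suc (dm (W n l S))"
    using assms(3) dm_W[of n l S] dm_W[of n "Suc l" S] by linarith
qed

lemma rk_antimono: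
  assumes "Suc l \<le> n" "W n l S \<noteq> {0}"
  shows "rk n (Suc l) S \<le> rk n l S"
proof (rule ccontr)
  assume *: "\<not> ?thesis"
  then have "rk n l S \<le> rk n (Suc l) S" by linarith
  then interpret structured "W n (Suc l) S" "W n l S" "Suc l" using assms by (intro structured_W)
  obtain G where "dm (W n (Suc l) S) = Suc (dm (W n l S))" using exists_generator by blast
  then show False using * dm_W[of n l S] dm_W[of n "Suc l" S] by linarith
qed

text \<open>A rank that does not drop from one level to the next makes \<open>structured\<close>
  applicable. The generator serves all lower levels with nonzero annihilator as well, because
  shifting such an annihilator up to level \<open>Suc l'\<close> leaves it a multiple of
  \<open>G\<close> of controlled degree.\<close>

lemma structured_gen:
  assumes "Suc l' \<le> n" "W n l' S \<noteq> {0}" "rk n l' S \<le> rk n (Suc l') S"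
  obtains G where "\<And>l. l \<le> Suc l' \<Longrightarrow> W n l S \<noteq> {0} \<Longrightarrow> gen n l S G"
    "\<And>l. l \<le> Suc l' \<Longrightarrow> W n l S \<noteq> {0} \<Longrightarrow> rk n l S = rk n (Suc l') S"
proof -
  interpret structured "W n (Suc l') S" "W n l' S" "Suc l'" using assms by (intro structured_W)
  define w where "w = dm (W n l' S)"
  obtain G where G: "G \<noteq> 0" "content G = 1" "\<And>t. t < w \<Longrightarrow> monom 1 t * G \<in> W n l' S"
    "dm (W n (Suc l') S) = Suc w"
    "\<And>P. P \<in> W n (Suc l') S \<Longrightarrow> G dvd P"
    "\<And>P. P \<in> W n (Suc l') S \<Longrightarrow> P \<noteq> 0 \<Longrightarrow> degree P \<le> degree G + w"
    "degree G + w \<le> Suc l'"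
    by (rule exists_generator[folded w_def]) (rule that, assumption+)
  define g where "g = Suc l' - w"
  have w0: "w > 0" unfolding w_def using assms(2) dm_pos[OF saturated_W] by blast
  have wl: "w \<le> Suc l'" using G(7) by linarith
  have rg: "rk n (Suc l') S = g" using G(4) by (simp add: rk_def g_def)
  have Gg: "G \<in> W n g S"
  proof -
    have "pr G (win x b) = 0" if "x \<in> S" "b \<le> n - g" for x b
    proof -
      \<comment> \<open>The position \<open>b\<close> is split into a shift \<open>t < w\<close>,
        absorbed by the polynomial, and a remainder of at most \<open>n - l'\<close>, where level
        \<open>l'\<close> applies.\<close>
      define t where "t = min b (w - 1)"
      have t: "t < w" "b - t \<le> n - l'" "t \<le> b" using that(2) w0 wl assms(1) by (auto simp: t_def g_def)
      then have "pr (monom 1 t * G) (win x (b - t)) = 0" using G(3)[OF t(1)] that(1) by (simp add: W_iff)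
      then show ?thesis using t by (simp add: pr_monom_mult win_win)
    qed
    moreover have "degree G \<le> g" using G(7) by (simp add: g_def)
    ultimately show ?thesis by (simp add: W_iff)
  qed
  have main: "rk n l S = g \<and> g \<le> l" if l: "l \<le> Suc l'" "W n l S \<noteq> {0}" for l
  proof -
    have up: "degree P + Suc l' \<le> degree G + w + l \<and> degree G \<le> degree P" if P: "P \<in> W n l S" "P \<noteq> 0" for P
    proof -
      have "monom 1 (Suc l' - l) * P \<in> W n (Suc l') S" using W_shift l(1) assms(1) P(1) by blast
      then have "degree (monom 1 (Suc l' - l) * P) \<le> degree G + w" using G(6) P(2) by simp
      moreover have "degree (monom 1 (Suc l' - l) * P) = Suc l' - l + degree P"
        using P(2) by (simp add: degree_mult_eq degree_monom_eq)
      moreover have "P \<in> W n (Suc l') S" using W_level l(1) P(1) by blast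
      then have "degree G \<le> degree P" using G(5) P(2) dvd_imp_degree_le by blast
      ultimately show ?thesis using l(1) by linarith
    qed
    from l(2) W_zero obtain P where "P \<in> W n l S" "P \<noteq> 0" by blast
    from up[OF this] have gl: "g \<le> l" unfolding g_def by linarith
    have "degree ` (W n l S - {0}) \<subseteq> (\<lambda>t. t + degree G) ` {..l - g}"
    proof
      fix d assume "d \<in> degree ` (W n l S - {0})"
      then obtain P where P: "P \<in> W n l S" "P \<noteq> 0" "d = degree P" by blast
      have "d - degree G \<le> l - g" "d = d - degree G + degree G"
        using up[OF P(1,2)] P(3) gl wl unfolding g_def by linarith+
      then show "d \<in> (\<lambda>t. t + degree G) ` {..l - g}" by blast
    qed
    then have "dm (W n l S) \<le> card ((\<lambda>t. t + degree G) ` {..l - g})"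
      unfolding dm_def by (intro card_mono) auto
    also have "\<dots> = Suc (l - g)" by (subst card_image) (auto simp: inj_on_def)
    finally have "g \<le> rk n l S" using dm_W[of n l S] gl by linarith
    moreover have "rk n l S \<le> g" using rk_le_of_killed[OF Gg G(1) gl] l(1) assms(1) by linarith
    ultimately show ?thesis using gl by linarith
  qed
  show ?thesis
  proof (rule that[of G])
    fix l assume l: "l \<le> Suc l'" "W n l S \<noteq> {0}"
    show "rk n l S = rk n (Suc l') S" using main[OF l] rg by simp
    have "G dvd P" if "P \<in> W n l S" for P using that W_level l(1) G(5) by blast
    then show "gen n l S G" unfolding gen_def using main[OF l] Gg G(1,2) by simp
  qed
qed

text \<open>If the rank dropped strictly at each of the \<open>n - l\<close> steps up to level
  \<open>n\<close>, it would be at least \<open>n - l + rk n n S\<close> at the start. So some step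
  does not drop, and \<open>structured_gen\<close> applies there.\<close>

lemma deficient_gen:
  assumes "l \<le> n" "W n l S \<noteq> {0}" "rk n l S < n - l + rk n n S"
  obtains G where "gen n l S G"
proof -
  have "\<exists>l'. l \<le> l' \<and> Suc l' \<le> n \<and> rk n l' S \<le> rk n (Suc l') S"
  proof (rule ccontr)
    assume neg: "\<not> ?thesis"
    have "l + d \<le> n \<Longrightarrow> d + rk n (l + d) S \<le> rk n l S" for d
    proof (induction d)
      case (Suc d)
      then have "\<not> rk n (l + d) S \<le> rk n (Suc (l + d)) S" using neg by auto
      then show ?case using Suc by simp
    qed simp
    from this[of "n - l"] show False using assms by simp
  qed
  then obtain l' where l': "l \<le> l'" "Suc l' \<le> n" "rk n l' S \<le> rk n (Suc l') S" by blast
  have ne: "W n l' S \<noteq> {0}"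
    using assms(2) W_level[OF l'(1), of n S] W_zero[of n l S] by blast
  obtain G where G: "\<And>l. l \<le> Suc l' \<Longrightarrow> W n l S \<noteq> {0} \<Longrightarrow> gen n l S G"
    by (rule structured_gen[OF l'(2) _ l'(3)]) (rule ne, rule that, assumption+)
  show ?thesis by (rule that[OF G[OF _ assms(2)]]) (use l'(1) in simp)
qed

section \<open>Greedy bases of windows\<close>

definition indep :: "nat \<Rightarrow> (nat \<Rightarrow> int) list \<Rightarrow> bool" where
  "indep l us \<longleftrightarrow> dm (annih l (set us)) + length us = Suc l"

lemma indep_Nil: "indep l []"
  by (simp add: indep_def dm_annih_empty)

lemma extend_basis:
  assumes "finite F" "indep l us"
  shows "\<exists>vs. set vs \<subseteq> F \<and> indep l (us @ vs) \<and> annih l (set us \<union> F) = annih l (set us \<union> set vs)"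
  using assms(1)
proof (induction F)
  case empty
  show ?case by (rule exI[of _ "[]"]) (simp add: assms(2))
next
  case (insert u F)
  then obtain vs where vs: "set vs \<subseteq> F" "indep l (us @ vs)" "annih l (set us \<union> F) = annih l (set us \<union> set vs)"
    by blast
  let ?K = "annih l (set (us @ vs))" and ?K' = "annih l (insert u (set (us @ vs)))"
  have "annih l (set us \<union> insert u F) = annih l {u} \<inter> annih l (set us \<union> F)"
    by (subst annih_Un[symmetric]) simp
  also have "\<dots> = annih l {u} \<inter> annih l (set us \<union> set vs)" by (simp only: vs(3))
  also have "\<dots> = ?K'" by (subst annih_Un[symmetric]) simp
  finally have K': "annih l (set us \<union> insert u F) = ?K'" .
  show ?case
  proof (cases "?K' = ?K")
    case True
    have "annih l (set us \<union> insert u F) = annih l (set us \<union> set vs)" unfolding K' True by simp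
    then show ?thesis using vs(1,2) by (intro exI[of _ vs]) auto
  next
    case False
    have sub: "?K' \<subseteq> ?K" by (rule annih_anti) auto
    have "\<not> dm ?K \<le> dm ?K'"
      using dm_eqD[OF saturated_annih saturated_annih sub] False by metis
    then have "dm ?K = Suc (dm ?K')" using dm_annih_insert[of l "set (us @ vs)" u] by linarith
    then have "indep l (us @ (vs @ [u]))" using vs(2) unfolding indep_def by simp
    moreover have "annih l (set us \<union> insert u F) = annih l (set us \<union> set (vs @ [u]))"
      unfolding K' by simp
    ultimately show ?thesis using vs(1) by (intro exI[of _ "vs @ [u]"]) auto
  qed
qed

text \<open>The basis is built from the last point \<open>p\<close> downwards, each earlier point
  only appending to the list. Hence as many initial members as the rank of the part from
  \<open>T\<close> on have index at least \<open>T\<close>; later this turns ranks of final segments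
  into bounds for errors.\<close>

lemma tagged_basis:
  fixes z :: "nat \<Rightarrow> nat \<Rightarrow> int" and I p l n :: nat
  assumes "I \<le> p" "l \<le> n"
  shows "\<exists>ts. indep l (map (\<lambda>(T, b). win (z T) b) ts) \<and>
     annih l ((\<lambda>(T, b). win (z T) b) ` set ts) = W n l (z ` {I..p}) \<and>
     set ts \<subseteq> {I..p} \<times> {..n - l} \<and> length ts = rk n l (z ` {I..p}) \<and>
     (\<forall>T\<in>{I..p}. \<forall>v<rk n l (z ` {T..p}). T \<le> fst (ts ! v))"
  using assms(1)
proof (induction "p - I" arbitrary: I)
  case 0
  then have I: "I = p" by simp
  let ?f = "\<lambda>(T, b). win (z T) b"
  have F: "wins (n - l) (z ` {p..p}) = ?f ` ({p} \<times> {..n - l})"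
    unfolding wins_def by auto
  obtain vs where vs: "set vs \<subseteq> ?f ` ({p} \<times> {..n - l})" "indep l vs"
    "annih l (?f ` ({p} \<times> {..n - l})) = annih l (set vs)"
    using extend_basis[OF _ indep_Nil, of "?f ` ({p} \<times> {..n - l})" l] by auto
  from vs(1) have "vs \<in> lists (?f ` ({p} \<times> {..n - l}))" by (simp add: in_lists_conv_set subset_iff)
  then obtain ts where ts: "vs = map ?f ts" "set ts \<subseteq> {p} \<times> {..n - l}"
    unfolding lists_image by (auto simp: in_lists_conv_set)
  have K: "annih l (?f ` set ts) = W n l (z ` {p..p})"
    using vs(3) ts(1) unfolding W_def F by simp
  have len: "length ts = rk n l (z ` {p..p})"
    using vs(2) ts(1) K dm_W[of n l "z ` {p..p}"] unfolding indep_def by simp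
  have "\<forall>T\<in>{p..p}. \<forall>v<rk n l (z ` {T..p}). T \<le> fst (ts ! v)"
  proof (intro ballI allI impI)
    fix T v assume "T \<in> {p..p}" "v < rk n l (z ` {T..p})"
    then have "ts ! v \<in> {p} \<times> {..n - l}" using ts(2) len by (auto intro: subsetD[OF ts(2)] nth_mem)
    then show "T \<le> fst (ts ! v)" using \<open>T \<in> {p..p}\<close> by auto
  qed
  then show ?case unfolding I using vs(2) ts K len by (intro exI[of _ ts]) auto
next
  case (Suc d)
  let ?f = "\<lambda>(T, b). win (z T) b"
  have "d = p - Suc I" "Suc I \<le> p" using Suc by simp_all
  from Suc(1)[OF this] obtain us where us: "indep l (map ?f us)"
    "annih l (?f ` set us) = W n l (z ` {Suc I..p})" "set us \<subseteq> {Suc I..p} \<times> {..n - l}"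
    "length us = rk n l (z ` {Suc I..p})"
    "\<And>T v. T \<in> {Suc I..p} \<Longrightarrow> v < rk n l (z ` {T..p}) \<Longrightarrow> T \<le> fst (us ! v)"
    by blast
  let ?F = "?f ` ({I} \<times> {..n - l})"
  obtain vs where vs: "set vs \<subseteq> ?F" "indep l (map ?f us @ vs)"
    "annih l (set (map ?f us) \<union> ?F) = annih l (set (map ?f us) \<union> set vs)"
    using extend_basis[OF _ us(1), of ?F] by auto
  from vs(1) have "vs \<in> lists ?F" by (simp add: in_lists_conv_set subset_iff)
  then obtain ts where ts: "vs = map ?f ts" "set ts \<subseteq> {I} \<times> {..n - l}"
    unfolding lists_image by (auto simp: in_lists_conv_set)
  have Ip: "{I..p} = insert I {Suc I..p}" using Suc by auto
  have "annih l (?f ` set (us @ ts)) = annih l (set (map ?f us) \<union> ?F)"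
    unfolding vs(3) ts(1) by (simp add: image_Un)
  also have "\<dots> = W n l (z ` {Suc I..p}) \<inter> annih l ?F" by (simp only: annih_Un us(2) set_map)
  also have "\<dots> = W n l (z ` {I..p})"
    unfolding Ip W_def by (subst annih_Un[symmetric], rule arg_cong[of _ _ "annih l"]) (auto simp: wins_def)
  finally have K: "annih l (?f ` set (us @ ts)) = W n l (z ` {I..p})" .
  have ind: "indep l (map ?f (us @ ts))" using vs(2) ts(1) by simp
  have len: "length (us @ ts) = rk n l (z ` {I..p})"
    using ind K dm_W[of n l "z ` {I..p}"] unfolding indep_def by (simp add: image_Un)
  have sub: "set (us @ ts) \<subseteq> {I..p} \<times> {..n - l}"
  proof -
    have "set us \<subseteq> {I..p} \<times> {..n - l}" using us(3) by (rule order_trans) auto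
    moreover have "set ts \<subseteq> {I..p} \<times> {..n - l}" using ts(2) by (rule order_trans) (use Suc.prems in auto)
    ultimately show ?thesis by simp
  qed
  have "\<forall>T\<in>{I..p}. \<forall>v<rk n l (z ` {T..p}). T \<le> fst ((us @ ts) ! v)"
  proof (intro ballI allI impI)
    fix T v assume T: "T \<in> {I..p}" and v: "v < rk n l (z ` {T..p})"
    show "T \<le> fst ((us @ ts) ! v)"
    proof (cases "T = I")
      case True
      then have "v < length (us @ ts)" using v len by simp
      then have "(us @ ts) ! v \<in> {I..p} \<times> {..n - l}" using sub nth_mem by blast
      then show ?thesis using True by auto
    next
      case False
      then have T': "T \<in> {Suc I..p}" using T by auto
      have "rk n l (z ` {T..p}) \<le> length us" unfolding us(4) using T' by (intro rk_mono) auto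
      then show ?thesis using us(5)[OF T' v] v by (simp add: nth_append)
    qed
  qed
  then show ?case using ind K len sub by (intro exI[of _ "us @ ts"]) blast
qed

section \<open>Minors and Siegel's lemma\<close>

definition minor_mat :: "(nat \<Rightarrow> int) list \<Rightarrow> nat list \<Rightarrow> int mat" where
  "minor_mat us js = mat (length us) (length us) (\<lambda>(r, c). (us ! r) (js ! c))"

lemma minor_mat_carrier [simp]: "minor_mat us js \<in> carrier_mat (length us) (length us)"
  by (simp add: minor_mat_def)

lemma mult_mat_vec_index:
  assumes "A \<in> carrier_mat g g" "v \<in> carrier_vec g" "r < g"
  shows "(A *\<^sub>v v) $ r = (\<Sum>c<g. A $$ (r, c) * v $ c)"
  using assms by (auto simp: scalar_prod_def lessThan_atLeast0 intro!: sum.cong)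

text \<open>The columns are the degrees missing from the annihilator. If the minor vanished, a
  kernel vector would be an annihilating polynomial supported on these columns, so its degree would
  be a missing one.\<close>

lemma minor_exists:
  assumes "indep l us"
  obtains js where "length js = length us" "set js \<subseteq> {..l}" "det (minor_mat us js) \<noteq> 0"
    "js = sorted_list_of_set ({..l} - degree ` (annih l (set us) - {0}))"
proof -
  let ?E = "degree ` (annih l (set us) - {0})" and ?g = "length us"
  define js where "js = sorted_list_of_set ({..l} - ?E)"
  have set: "set js = {..l} - ?E" and dist: "distinct js" by (simp_all add: js_def)
  have E: "?E \<subseteq> {..l}" using saturated_degree[OF saturated_annih] by blast
  have "length js = card ({..l} - ?E)" by (simp add: js_def)
  also have "\<dots> = Suc l - card ?E" using E by (subst card_Diff_subset) (auto intro: finite_subset)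
  also have "\<dots> = ?g" using assms by (simp add: indep_def dm_def)
  finally have len: "length js = ?g" .
  have "det (minor_mat us js) \<noteq> 0"
  proof
    assume "det (minor_mat us js) = 0"
    then obtain v where v: "v \<in> carrier_vec ?g" "v \<noteq> 0\<^sub>v ?g" "minor_mat us js *\<^sub>v v = 0\<^sub>v ?g"
      using det_0_iff_vec_prod_zero[OF minor_mat_carrier] by blast
    define P where "P = (\<Sum>c<?g. monom (v $ c) (js ! c))"
    have cP: "coeff P a = (\<Sum>c<?g. if js ! c = a then v $ c else 0)" for a
      by (simp add: P_def coeff_sum)
    have "coeff P (js ! c) = v $ c" if "c < ?g" for c
    proof -
      have "coeff P (js ! c) = (\<Sum>c'<?g. if c' = c then v $ c' else 0)"
        unfolding cP using that len dist by (intro sum.cong) (auto simp: nth_eq_iff_index_eq)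
      then show ?thesis using that by simp
    qed
    moreover obtain c where "c < ?g" "v $ c \<noteq> 0" using v(1,2) by (metis carrier_vecD eq_vecI index_zero_vec)
    ultimately have P0: "P \<noteq> 0" by (metis coeff_0)
    have sup: "a \<in> set js" if "coeff P a \<noteq> 0" for a
    proof (rule ccontr)
      assume "a \<notin> set js"
      then have "coeff P a = 0" unfolding cP using len by (intro sum.neutral) (auto simp: in_set_conv_nth)
      then show False using that by simp
    qed
    have dP: "degree P \<in> set js" using sup[of "degree P"] P0 by simp
    have "pr P u = 0" if "u \<in> set us" for u
    proof -
      from that obtain r where r: "r < ?g" "u = us ! r" by (metis in_set_conv_nth)
      have "pr P u = (\<Sum>c<?g. minor_mat us js $$ (r, c) * v $ c)"
        unfolding P_def pr_sum pr_monom using r len by (intro sum.cong) (auto simp: minor_mat_def)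
      also have "\<dots> = (minor_mat us js *\<^sub>v v) $ r"
        using mult_mat_vec_index[OF minor_mat_carrier v(1) r(1)] by simp
      also have "\<dots> = 0" using v(3) r(1) by simp
      finally show ?thesis .
    qed
    then have "P \<in> annih l (set us) - {0}" using dP set P0 by (auto simp: annih_def)
    then have "degree P \<in> ?E" by blast
    then show False using dP set by blast
  qed
  then show ?thesis using that[OF len _ _ js_def] set by blast
qed

lemma det_scale_col:
  fixes A :: "int mat"
  assumes "A \<in> carrier_mat g g" "k < g" "y \<in> carrier_vec g"
  shows "det (replace_col A (d \<cdot>\<^sub>v y) k) = d * det (replace_col A y k)"
proof -
  have c: "replace_col A y k \<in> carrier_mat g g" for y using assms by (simp add: replace_col_def)
  have "transpose_mat (replace_col A (d \<cdot>\<^sub>v y) k) = multrow k d (transpose_mat (replace_col A y k))"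
    using assms by (intro eq_matI) (auto simp: replace_col_def mat_multrow_def)
  then have "det (transpose_mat (replace_col A (d \<cdot>\<^sub>v y) k)) = d * det (transpose_mat (replace_col A y k))"
    using det_multrow[OF assms(2), of "transpose_mat (replace_col A y k)" d] c[of y] by simp
  then show ?thesis by (simp only: det_transpose[OF c])
qed

text \<open>Cramer's rule read as a polynomial: the minor times column \<open>a\<close> is the
  combination of the chosen columns whose coefficients are the minors with one column
  replaced.\<close>

lemma cramer_poly:
  assumes "length js = length us" "set js \<subseteq> {..l}" "a \<le> l" "det (minor_mat us js) \<noteq> 0"
  defines "x \<equiv> \<lambda>i. det (minor_mat us (js[i := a]))"
  shows "monom (det (minor_mat us js)) a - (\<Sum>i<length us. monom (x i) (js ! i)) \<in> annih l (set us)"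
proof -
  let ?g = "length us" and ?B = "minor_mat us js"
  let ?d = "det ?B"
  define y where "y = vec ?g (\<lambda>r. (us ! r) a)"
  have yc: "y \<in> carrier_vec ?g" by (simp add: y_def)
  define t where "t = adj_mat ?B *\<^sub>v y"
  have adj: "adj_mat ?B \<in> carrier_mat ?g ?g" "?B * adj_mat ?B = ?d \<cdot>\<^sub>m 1\<^sub>m ?g"
    using adj_mat[OF minor_mat_carrier] by auto
  have tc: "t \<in> carrier_vec ?g" using adj(1) yc by (simp add: t_def)
  have Bt: "?B *\<^sub>v t = ?d \<cdot>\<^sub>v y"
  proof -
    have "?B *\<^sub>v t = (?B * adj_mat ?B) *\<^sub>v y"
      unfolding t_def using adj(1) yc by (simp add: assoc_mult_mat_vec[OF minor_mat_carrier adj(1) yc])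
    also have "\<dots> = ?d \<cdot>\<^sub>v y" unfolding adj(2) using yc by (intro eq_vecI) auto
    finally show ?thesis .
  qed
  have tx: "t $ i = x i" if "i < ?g" for i
  proof -
    have "t $ i * ?d = det (replace_col ?B (?d \<cdot>\<^sub>v y) i)"
      using cramer_lemma_mat[OF minor_mat_carrier[of us js] tc that] Bt by simp
    also have "\<dots> = ?d * det (replace_col ?B y i)" by (rule det_scale_col[OF minor_mat_carrier that yc])
    also have "replace_col ?B y i = minor_mat us (js[i := a])"
      using that assms(1) by (intro eq_matI) (auto simp: replace_col_def minor_mat_def y_def nth_list_update)
    finally show ?thesis using assms(4) by (simp add: x_def)
  qed
  let ?P = "monom ?d a - (\<Sum>i<?g. monom (x i) (js ! i))"
  have "pr ?P u = 0" if "u \<in> set us" for u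
  proof -
    from that obtain r where r: "r < ?g" "u = us ! r" by (metis in_set_conv_nth)
    have "(\<Sum>i<?g. x i * u (js ! i)) = (\<Sum>i<?g. ?B $$ (r, i) * t $ i)"
      using r tx by (intro sum.cong) (auto simp: minor_mat_def)
    also have "\<dots> = ?d * u a"
      using mult_mat_vec_index[OF minor_mat_carrier[of us js] tc r(1)] Bt r by (simp add: y_def)
    finally show ?thesis by (simp add: pr_diff pr_sum pr_monom)
  qed
  moreover have "degree ?P \<le> l"
  proof (rule degree_diff_le)
    show "degree (monom ?d a) \<le> l" using assms(3) degree_monom_le le_trans by blast
    have "js ! i \<le> l" if "i < ?g" for i using assms(1,2) that by (metis nth_mem atMost_iff subsetD)
    then show "degree (\<Sum>i<?g. monom (x i) (js ! i)) \<le> l"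
      by (intro degree_sum_le) (auto intro: le_trans[OF degree_monom_le])
  qed
  ultimately show ?thesis by (simp add: annih_def)
qed

text \<open>Maximality bounds the Cramer coefficients by the minor itself, as long as replacing the
  column respects \<open>Q\<close>.\<close>

lemma max_minor:
  assumes "length js0 = length us" "set js0 \<subseteq> {..l}" "det (minor_mat us js0) \<noteq> 0" "Q js0"
  obtains js where "length js = length us" "set js \<subseteq> {..l}" "det (minor_mat us js) \<noteq> 0" "Q js"
    "\<And>js'. length js' = length us \<Longrightarrow> set js' \<subseteq> {..l} \<Longrightarrow> Q js' \<Longrightarrow>
       \<bar>det (minor_mat us js')\<bar> \<le> \<bar>det (minor_mat us js)\<bar>"
proof -
  let ?A = "{js. set js \<subseteq> {..l} \<and> length js = length us \<and> Q js}"
  let ?f = "\<lambda>js. \<bar>det (minor_mat us js)\<bar>"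
  have fin: "finite ?A"
    by (rule finite_subset[OF _ finite_lists_length_eq[of "{..l}" "length us"]]) auto
  have ne: "js0 \<in> ?A" using assms by simp
  have "Max (?f ` ?A) \<in> ?f ` ?A" using fin ne by (intro Max_in) auto
  then obtain js where js: "js \<in> ?A" "Max (?f ` ?A) = ?f js" by blast
  have max: "?f js' \<le> ?f js" if "js' \<in> ?A" for js'
    using fin that js(2) by (metis (no_types, lifting) Max_ge finite_imageI image_eqI)
  show ?thesis
  proof (rule that[of js])
    show "det (minor_mat us js) \<noteq> 0" using max[OF ne] assms(3) by auto
  qed (use js max in auto)
qed

text \<open>All rows are close to multiples of one vector \<open>y\<close>. Subtracting multiples of
  row 0 leaves the other rows of the size of their errors, so only one row contributes its full
  height. \<open>K\<close> bounds the multipliers, and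
  \<open>\<epsilon> 0 \<le> \<epsilon> r\<close> keeps the error of row 0 from dominating.\<close>

lemma det_bound:
  fixes A :: "real mat"
  assumes A: "A \<in> carrier_mat g g" and g: "g > 0"
    and \<alpha>0: "\<alpha> 0 \<noteq> 0" and \<alpha>: "\<And>r. r < g \<Longrightarrow> \<bar>\<alpha> r\<bar> \<le> K * \<bar>\<alpha> 0\<bar>"
    and row0: "\<And>c. c < g \<Longrightarrow> \<bar>A $$ (0, c)\<bar> \<le> Bd"
    and approx: "\<And>r c. r < g \<Longrightarrow> c < g \<Longrightarrow> \<bar>A $$ (r, c) - \<alpha> r * y c\<bar> \<le> \<epsilon> r"
    and \<epsilon>: "\<And>r. r < g \<Longrightarrow> \<epsilon> 0 \<le> \<epsilon> r"
  shows "\<bar>det A\<bar> \<le> fact g * (Bd * (\<Prod>r=1..<g. (1 + K) * \<epsilon> r))"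
proof -
  define L where "L = mat g g (\<lambda>(r, c). if r = c then 1 else if c = 0 then - (\<alpha> r / \<alpha> 0) else 0)"
  have L: "L \<in> carrier_mat g g" by (simp add: L_def)
  have "det L = prod_list (diag_mat L)"
    by (rule det_lower_triangular[OF _ L]) (auto simp: L_def)
  also have "diag_mat L = replicate g 1"
    unfolding diag_mat_def by (rule nth_equalityI) (auto simp: L_def)
  finally have detL: "det L = 1" by simp
  define B where "B = L * A"
  have B: "B \<in> carrier_mat g g" using L A by (simp add: B_def)
  have "det B = det A" unfolding B_def using det_mult[OF L A] detL by simp
  have Bix: "B $$ (r, c) = (if r = 0 then A $$ (0, c) else A $$ (r, c) - (\<alpha> r / \<alpha> 0) * A $$ (0, c))"
    if rc: "r < g" "c < g" for r c
  proof -
    have "B $$ (r, c) = (\<Sum>k<g. L $$ (r, k) * A $$ (k, c))"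
      unfolding B_def using rc L A by (auto simp: scalar_prod_def lessThan_atLeast0 intro!: sum.cong)
    also have "\<dots> = (\<Sum>k\<in>{0, r}. L $$ (r, k) * A $$ (k, c))"
      using rc g by (intro sum.mono_neutral_right) (auto simp: L_def)
    also have "\<dots> = (if r = 0 then A $$ (0, c) else A $$ (r, c) - (\<alpha> r / \<alpha> 0) * A $$ (0, c))"
      using rc g by (auto simp: L_def)
    finally show ?thesis .
  qed
  have B0: "\<bar>B $$ (0, c)\<bar> \<le> Bd" if "c < g" for c using Bix[OF g that] row0[OF that] by simp
  have Br: "\<bar>B $$ (r, c)\<bar> \<le> (1 + K) * \<epsilon> r" if rc: "r < g" "r > 0" "c < g" for r c
  proof -
    have K: "\<bar>\<alpha> r / \<alpha> 0\<bar> \<le> K" using \<alpha>[OF rc(1)] \<alpha>0 by (simp add: abs_divide pos_divide_le_eq)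
    then have K0: "0 \<le> K" by (meson abs_ge_zero order_trans)
    have e0: "0 \<le> \<epsilon> 0" using approx[OF g rc(3)] by linarith
    have "B $$ (r, c) = (A $$ (r, c) - \<alpha> r * y c) - (\<alpha> r / \<alpha> 0) * (A $$ (0, c) - \<alpha> 0 * y c)"
      using Bix[OF rc(1,3)] rc(2) \<alpha>0 by (simp add: field_simps)
    also have "\<bar>\<dots>\<bar> \<le> \<bar>A $$ (r, c) - \<alpha> r * y c\<bar> + \<bar>\<alpha> r / \<alpha> 0\<bar> * \<bar>A $$ (0, c) - \<alpha> 0 * y c\<bar>"
      by (metis abs_mult abs_triangle_ineq4)
    also have "\<dots> \<le> \<epsilon> r + K * \<epsilon> 0"
      using approx[OF rc(1,3)] approx[OF g rc(3)] K K0 by (intro add_mono mult_mono) auto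
    also have "\<dots> \<le> \<epsilon> r + K * \<epsilon> r"
      using \<epsilon>[OF rc(1)] K0 by (intro add_mono mult_left_mono) auto
    finally show ?thesis by (simp add: algebra_simps)
  qed
  let ?Pr = "Bd * (\<Prod>r=1..<g. (1 + K) * \<epsilon> r)"
  have perm: "\<bar>signof p * (\<Prod>i=0..<g. B $$ (i, p i))\<bar> \<le> ?Pr" if p: "p permutes {0..<g}" for p
  proof -
    have pi: "p i < g" if "i < g" for i using permutes_in_image[OF p, of i] that by simp
    have "\<bar>signof p * (\<Prod>i=0..<g. B $$ (i, p i))\<bar> = (\<Prod>i=0..<g. \<bar>B $$ (i, p i)\<bar>)"
      by (simp add: abs_mult abs_prod sign_def)
    also have "\<dots> = \<bar>B $$ (0, p 0)\<bar> * (\<Prod>i=1..<g. \<bar>B $$ (i, p i)\<bar>)"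
      using g by (simp add: prod.atLeast_Suc_lessThan)
    also have "\<dots> \<le> ?Pr"
      using B0[OF pi[OF g]] Br pi g
      by (intro mult_mono prod_mono) (auto intro!: prod_nonneg intro: order_trans[OF abs_ge_zero])
    finally show ?thesis .
  qed
  have "\<bar>det A\<bar> = \<bar>\<Sum>p\<in>{p. p permutes {0..<g}}. signof p * (\<Prod>i=0..<g. B $$ (i, p i))\<bar>"
    using \<open>det B = det A\<close> det_def'[OF B] by simp
  also have "\<dots> \<le> (\<Sum>p\<in>{p. p permutes {0..<g}}. ?Pr)"
    using perm by (intro order_trans[OF sum_abs] sum_mono) auto
  also have "\<dots> = fact g * ?Pr"
    using card_permutations[of "{0..<g}" g] by simp
  finally show ?thesis .
qed

section \<open>Coefficient bounds for divisors of integer polynomials\<close>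

fun interp_const :: "nat \<Rightarrow> nat \<Rightarrow> int" where
  "interp_const K 0 = 1"
| "interp_const K (Suc n) = 1 + 2 * (1 + int K) * interp_const K n"

lemma interp_const_pos: "interp_const K n > 0"
  by (induction n) (auto simp: add_pos_nonneg)

text \<open>Newton interpolation, splitting off one node \<open>z0\<close> at a time: at the other
  nodes the quotient is at most \<open>2 * M\<close>, since distinct integers differ by at least
  1.\<close>

lemma coeff_bound_by_values:
  fixes p :: "int poly"
  assumes "degree p \<le> n" "finite Z" "card Z > n" "\<And>z. z \<in> Z \<Longrightarrow> 0 \<le> z \<and> z \<le> int K \<and> \<bar>poly p z\<bar> \<le> M"
  shows "\<bar>coeff p a\<bar> \<le> interp_const K n * M"
  using assms
proof (induction n arbitrary: p Z M a)
  case 0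
  then obtain c where c: "p = [:c:]" by (metis degree_eq_zeroE le_zero_eq)
  from 0 obtain z where "z \<in> Z" by fastforce
  with 0 c have "\<bar>c\<bar> \<le> M" by fastforce
  then show ?case by (cases a) (auto simp: c)
next
  case (Suc n)
  from Suc.prems obtain z0 where z0: "z0 \<in> Z" by fastforce
  have M0: "M \<ge> 0" using Suc.prems(4)[OF z0] by linarith
  have "poly (p - [:poly p z0:]) z0 = 0" by simp
  then have "[:- z0, 1:] dvd (p - [:poly p z0:])" by (simp only: poly_eq_0_iff_dvd)
  then obtain q where q: "p - [:poly p z0:] = [:- z0, 1:] * q" by (rule dvdE)
  then have pq: "p = [:poly p z0:] + [:- z0, 1:] * q" by (simp add: algebra_simps)
  have dq: "degree q \<le> n"
  proof (cases "q = 0")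
    case False
    then have "degree ([:- z0, 1:] * q) = Suc (degree q)" by (simp add: degree_mult_eq del: mult_pCons_left)
    moreover have "degree (p - [:poly p z0:]) \<le> Suc n" using Suc.prems(1) by (intro degree_diff_le) auto
    ultimately show ?thesis using q by simp
  qed simp
  have "\<bar>coeff q b\<bar> \<le> interp_const K n * (2 * M)" for b
  proof (rule Suc.IH[OF dq])
    show "finite (Z - {z0})" using Suc.prems by simp
    show "n < card (Z - {z0})" using Suc.prems z0 by (simp add: card_Diff_singleton)
    fix z assume z: "z \<in> Z - {z0}"
    have "\<bar>z - z0\<bar> \<ge> 1" using z by auto
    then have "\<bar>poly q z\<bar> \<le> \<bar>z - z0\<bar> * \<bar>poly q z\<bar>" by (simp add: mult_le_cancel_right1)
    also have "\<dots> = \<bar>poly ([:- z0, 1:] * q) z\<bar>" by (simp add: abs_mult[symmetric] algebra_simps)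
    also have "\<dots> = \<bar>poly p z - poly p z0\<bar>" unfolding q[symmetric] by simp
    also have "\<dots> \<le> 2 * M" using Suc.prems(4)[OF z0] Suc.prems(4)[of z] z by auto
    finally show "0 \<le> z \<and> z \<le> int K \<and> \<bar>poly q z\<bar> \<le> 2 * M" using Suc.prems(4)[of z] z by auto
  qed
  note cq = this
  have "coeff p a = (if a = 0 then poly p z0 else 0) + (if a = 0 then 0 else coeff q (a - 1)) - z0 * coeff q a"
    by (subst pq) (cases a; simp)
  then have "\<bar>coeff p a\<bar> \<le> M + interp_const K n * (2 * M) + z0 * (interp_const K n * (2 * M))"
  proof -
    have "\<bar>z0 * coeff q a\<bar> \<le> z0 * (interp_const K n * (2 * M))"
      using cq[of a] Suc.prems(4)[OF z0] by (simp add: abs_mult mult_left_mono)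
    moreover have "\<bar>if a = 0 then 0 else coeff q (a - 1)\<bar> \<le> interp_const K n * (2 * M)"
      using cq[of "a - 1"] M0 interp_const_pos[of K n] by auto
    moreover have "\<bar>if a = 0 then poly p z0 else 0\<bar> \<le> M" using Suc.prems(4)[OF z0] M0 by auto
    ultimately show ?thesis
      using \<open>coeff p a = _\<close> by linarith
  qed
  also have "\<dots> \<le> M + interp_const K n * (2 * M) + int K * (interp_const K n * (2 * M))"
    using Suc.prems(4)[OF z0] M0 interp_const_pos[of K n] by (intro add_mono mult_right_mono) auto
  also have "\<dots> = interp_const K (Suc n) * M" by (simp add: algebra_simps)
  finally show ?case .
qed

lemma poly_abs_bound:
  fixes P :: "int poly"
  assumes "degree P \<le> n" "\<And>a. \<bar>coeff P a\<bar> \<le> H" "0 \<le> z" "z \<le> int K"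
  shows "\<bar>poly P z\<bar> \<le> H * (\<Sum>a\<le>n. int K ^ a)"
proof -
  have "0 \<le> H" using assms(2)[of 0] by linarith
  have "poly P z = (\<Sum>a\<le>n. coeff P a * z ^ a)"
    unfolding poly_altdef using assms(1) by (intro sum.mono_neutral_left) (auto simp: coeff_eq_0)
  also have "\<bar>\<dots>\<bar> \<le> (\<Sum>a\<le>n. H * int K ^ a)"
    using assms \<open>0 \<le> H\<close> by (intro order_trans[OF sum_abs] sum_mono) (auto simp: abs_mult power_abs intro!: mult_mono power_mono)
  finally show ?thesis by (simp add: sum_distrib_left)
qed

text \<open>Among \<open>2 * n + 1\<close> integers the cofactor of \<open>G\<close> vanishes at no
  more than \<open>n\<close>. At the others it is at least 1 in absolute value, so \<open>G\<close>
  is bounded by \<open>P\<close> there, and interpolation recovers its coefficients.\<close>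

lemma dvd_coeff_bound:
  obtains C :: int where "C > 0"
    "\<And>G P H a. G dvd P \<Longrightarrow> P \<noteq> 0 \<Longrightarrow> degree P \<le> n \<Longrightarrow> (\<And>a. \<bar>coeff P a\<bar> \<le> H) \<Longrightarrow> \<bar>coeff G a\<bar> \<le> C * H"
proof
  let ?K = "2 * n"
  let ?S = "\<Sum>a\<le>n. int ?K ^ a"
  have S0: "?S > 0"
  proof -
    have "(\<Sum>a\<in>{0}. int ?K ^ a) \<le> ?S" by (intro sum_mono2) auto
    then show ?thesis by simp
  qed
  show "interp_const ?K n * ?S > 0" using S0 interp_const_pos by simp
  fix G P :: "int poly" and H :: int and a
  assume GP: "G dvd P" "P \<noteq> 0" "degree P \<le> n" "\<And>a. \<bar>coeff P a\<bar> \<le> H"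
  from GP(1) obtain Q where Q: "P = G * Q" by (rule dvdE)
  have Q0: "Q \<noteq> 0" "G \<noteq> 0" using GP(2) Q by auto
  have deg: "degree G \<le> n" "degree Q \<le> n" using GP(3) Q Q0 by (simp_all add: degree_mult_eq)
  define Z where "Z = {0..int ?K} - {z. poly Q z = 0}"
  have finr: "finite {z. poly Q z = 0}" using Q0(1) by (rule poly_roots_finite)
  have "card {0..int ?K} \<le> card (Z \<union> {z. poly Q z = 0})"
    using finr by (intro card_mono) (auto simp: Z_def)
  also have "\<dots> \<le> card Z + card {z. poly Q z = 0}" by (rule card_Un_le)
  also have "card {z. poly Q z = 0} \<le> n" using card_poly_roots_bound[OF Q0(1)] deg(2) by linarith
  finally have cZ: "card Z > n" by simp
  have "\<bar>coeff G a\<bar> \<le> interp_const ?K n * (H * ?S)"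
  proof (rule coeff_bound_by_values[OF deg(1) _ cZ])
    show "finite Z" by (simp add: Z_def)
    fix z assume z: "z \<in> Z"
    have "\<bar>poly Q z\<bar> \<ge> 1" using z by (auto simp: Z_def)
    then have "\<bar>poly G z\<bar> \<le> \<bar>poly G z\<bar> * \<bar>poly Q z\<bar>" by (simp add: mult_le_cancel_left1)
    also have "\<dots> = \<bar>poly P z\<bar>" by (simp add: Q abs_mult)
    also have "\<dots> \<le> H * ?S" using z GP(3,4) by (intro poly_abs_bound) (auto simp: Z_def)
    finally show "0 \<le> z \<and> z \<le> int ?K \<and> \<bar>poly G z\<bar> \<le> H * ?S" using z by (auto simp: Z_def)
  qed
  then show "\<bar>coeff G a\<bar> \<le> interp_const ?K n * ?S * H" by (simp add: algebra_simps)
qed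

section \<open>Cosets of an integer lattice of full rank\<close>

lemma mult_mat_vec_smult:
  fixes A :: "int mat"
  assumes "A \<in> carrier_mat g g" "v \<in> carrier_vec g"
  shows "A *\<^sub>v (k \<cdot>\<^sub>v v) = k \<cdot>\<^sub>v (A *\<^sub>v v)"
proof (rule eq_vecI)
  fix i assume "i < dim_vec (k \<cdot>\<^sub>v (A *\<^sub>v v))"
  then have i: "i < g" using assms by simp
  have kv: "k \<cdot>\<^sub>v v \<in> carrier_vec g" using assms(2) by simp
  show "(A *\<^sub>v (k \<cdot>\<^sub>v v)) $ i = (k \<cdot>\<^sub>v (A *\<^sub>v v)) $ i"
    using mult_mat_vec_index[OF assms(1) kv i] mult_mat_vec_index[OF assms(1,2) i] i assms
    by (simp add: sum_distrib_left algebra_simps)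
qed (use assms in simp)

lemma mult_mat_unit_vec:
  fixes A :: "int mat"
  assumes "A \<in> carrier_mat g g" "r < g"
  shows "A *\<^sub>v unit_vec g r = col A r"
  using assms by (intro eq_vecI) auto

text \<open>Hermite reduction: \<open>d r\<close> is the least positive \<open>r\<close>-th entry of
  a lattice vector whose first \<open>r\<close> entries vanish. Such vectors form a triangular
  basis, and reduction modulo its diagonal leaves a box of representatives whose size is the product
  of the \<open>d r\<close>.\<close>

lemma coset_reps:
  fixes B :: "int mat"
  assumes B: "B \<in> carrier_mat g g" and det: "Determinant.det B \<noteq> 0"
  obtains R where "finite R" "int (card R) \<le> \<bar>Determinant.det B\<bar>"
    "\<And>y. y \<in> carrier_vec g \<Longrightarrow> \<exists>\<rho>\<in>R. \<rho> \<in> carrier_vec g \<and> (\<exists>x\<in>carrier_vec g. y = \<rho> + B *\<^sub>v x)"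
proof -
  define lead where "lead r d x \<longleftrightarrow> x \<in> carrier_vec g \<and> d > 0 \<and> (\<forall>i<r. (B *\<^sub>v x) $ i = 0) \<and> (B *\<^sub>v x) $ r = int d"
    for r d x
  have ex: "\<exists>d x. lead r d x" if r: "r < g" for r
  proof -
    \<comment> \<open>The adjugate shows that the absolute determinant times the \<open>r\<close>-th
      unit vector is in the lattice, so a leading entry exists.\<close>
    define x where "x = sgn (Determinant.det B) \<cdot>\<^sub>v (adj_mat B *\<^sub>v unit_vec g r)"
    have adj: "adj_mat B \<in> carrier_mat g g" "B * adj_mat B = Determinant.det B \<cdot>\<^sub>m 1\<^sub>m g"
      using adj_mat[OF B] by auto
    have xc: "x \<in> carrier_vec g" using adj(1) by (simp add: x_def)
    have "B *\<^sub>v x = sgn (Determinant.det B) \<cdot>\<^sub>v (B *\<^sub>v (adj_mat B *\<^sub>v unit_vec g r))"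
      unfolding x_def by (rule mult_mat_vec_smult[OF B]) (use adj(1) in simp)
    also have "B *\<^sub>v (adj_mat B *\<^sub>v unit_vec g r) = (B * adj_mat B) *\<^sub>v unit_vec g r"
      using adj(1) B by (subst assoc_mult_mat_vec) auto
    also have "\<dots> = Determinant.det B \<cdot>\<^sub>v unit_vec g r"
      unfolding adj(2) by (intro eq_vecI) auto
    finally have "B *\<^sub>v x = sgn (Determinant.det B) \<cdot>\<^sub>v (Determinant.det B \<cdot>\<^sub>v unit_vec g r)" .
    then have "lead r (nat \<bar>Determinant.det B\<bar>) x"
      unfolding lead_def using xc det r sgn_mult_abs[of "Determinant.det B"]
      by (auto simp: abs_sgn algebra_simps sgn_if)
    then show ?thesis by blast
  qed
  define d where "d r = (LEAST d. \<exists>x. lead r d x)" for r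
  have d: "\<exists>x. lead r (d r) x" if "r < g" for r
    unfolding d_def using ex[OF that] by (rule LeastI_ex)
  have dmin: "d r \<le> d'" if "lead r d' x" for r d' x
    unfolding d_def using that by (intro Least_le) blast
  obtain \<beta> where \<beta>: "\<And>r. r < g \<Longrightarrow> lead r (d r) (\<beta> r)" using d by metis
  have dpos: "d r > 0" if "r < g" for r using \<beta>[OF that] by (simp add: lead_def)
  define Bt where "Bt = mat g g (\<lambda>(i, r). \<beta> r $ i)"
  have Bt: "Bt \<in> carrier_mat g g" by (simp add: Bt_def)
  define Tm where "Tm = B * Bt"
  have Tm: "Tm \<in> carrier_mat g g" using B Bt by (simp add: Tm_def)
  have Tmix: "Tm $$ (i, r) = (B *\<^sub>v \<beta> r) $ i" if "i < g" "r < g" for i r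
  proof -
    have "col Bt r = \<beta> r" using \<beta>[OF that(2)] that by (intro eq_vecI) (auto simp: Bt_def lead_def)
    then show ?thesis unfolding Tm_def using that B Bt by (simp add: index_mult_mat)
  qed
  have tri: "Tm $$ (i, r) = 0" if "i < r" "r < g" for i r
    using Tmix[of i r] that \<beta>[OF that(2)] by (simp add: lead_def)
  have diag: "Tm $$ (r, r) = int (d r)" if "r < g" for r
    using Tmix[of r r] that \<beta>[OF that] by (simp add: lead_def)
  have "Determinant.det Tm = prod_list (diag_mat Tm)" by (rule det_lower_triangular[OF _ Tm]) (use tri in auto)
  also have "diag_mat Tm = map (\<lambda>r. int (d r)) [0..<g]"
    unfolding diag_mat_def using Tm diag by (auto intro: map_cong)
  also have "prod_list \<dots> = (\<Prod>r<g. int (d r))"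
    by (subst prod.distinct_set_conv_list[symmetric]) (auto simp: lessThan_atLeast0)
  finally have detT: "Determinant.det Tm = (\<Prod>r<g. int (d r))" .
  have reduce: "\<exists>c\<in>carrier_vec g. \<forall>i<r. 0 \<le> (y - Tm *\<^sub>v c) $ i \<and> (y - Tm *\<^sub>v c) $ i < int (d i)"
    if "r \<le> g" "y \<in> carrier_vec g" for r y
    using that(1)
  proof (induction r)
    case 0
    show ?case by (rule bexI[of _ "0\<^sub>v g"]) auto
  next
    case (Suc r)
    then obtain c where c: "c \<in> carrier_vec g"
      "\<forall>i<r. 0 \<le> (y - Tm *\<^sub>v c) $ i \<and> (y - Tm *\<^sub>v c) $ i < int (d i)" by auto
    have r: "r < g" using Suc.prems by simp
    define q where "q = (y - Tm *\<^sub>v c) $ r div int (d r)"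
    define c' where "c' = c + q \<cdot>\<^sub>v unit_vec g r"
    have c': "c' \<in> carrier_vec g" using c(1) by (simp add: c'_def)
    have "Tm *\<^sub>v c' = Tm *\<^sub>v c + q \<cdot>\<^sub>v col Tm r"
      unfolding c'_def using Tm c(1) r
      by (simp add: mult_add_distrib_mat_vec[OF Tm] mult_mat_vec_smult[OF Tm] mult_mat_unit_vec[OF Tm])
    then have ix: "(y - Tm *\<^sub>v c') $ i = (y - Tm *\<^sub>v c) $ i - q * Tm $$ (i, r)" if "i < g" for i
      using that Tm r \<open>y \<in> carrier_vec g\<close> c(1) by (simp add: algebra_simps)
    show ?case
    proof (rule bexI[OF _ c'], intro allI impI)
      fix i assume "i < Suc r"
      then consider "i < r" | "i = r" by linarith
      then show "0 \<le> (y - Tm *\<^sub>v c') $ i \<and> (y - Tm *\<^sub>v c') $ i < int (d i)"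
      proof cases
        case 1
        then show ?thesis using ix[of i] tri[OF 1 r] c(2) r by simp
      next
        case 2
        have "(y - Tm *\<^sub>v c') $ r = (y - Tm *\<^sub>v c) $ r mod int (d r)"
          using ix[OF r] diag[OF r] by (simp add: q_def minus_div_mult_eq_mod)
        then show ?thesis using 2 dpos[OF r] by simp
      qed
    qed
  qed
  \<comment> \<open>A reduced lattice vector vanishes: its first nonzero entry would be a positive
    leading entry below \<open>d i\<close>.\<close>
  have zero: "y = Tm *\<^sub>v c" if x: "x \<in> carrier_vec g" and y: "y = B *\<^sub>v x" and c: "c \<in> carrier_vec g"
    and red: "\<forall>i<g. 0 \<le> (y - Tm *\<^sub>v c) $ i \<and> (y - Tm *\<^sub>v c) $ i < int (d i)" for x y c
  proof -
    define x' where "x' = x - Bt *\<^sub>v c"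
    have x': "x' \<in> carrier_vec g" using x c Bt by (simp add: x'_def)
    have Bx': "B *\<^sub>v x' = y - Tm *\<^sub>v c"
      unfolding x'_def y Tm_def using B Bt x c
      by (simp add: mult_minus_distrib_mat_vec[OF B x] assoc_mult_mat_vec[OF B Bt c])
    have "(y - Tm *\<^sub>v c) $ i = 0" if "i < g" for i
      using that
    proof (induction i rule: less_induct)
      case (less i)
      show ?case
      proof (rule ccontr)
        assume ne: "(y - Tm *\<^sub>v c) $ i \<noteq> 0"
        then have "lead i (nat ((y - Tm *\<^sub>v c) $ i)) x'"
          unfolding lead_def Bx' using red less x' by force
        from dmin[OF this] show False using red less.prems by force
      qed
    qed
    moreover have "y \<in> carrier_vec g" using y B x by simp
    moreover have "Tm *\<^sub>v c \<in> carrier_vec g" using Tm c by simp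
    ultimately have "y $ i = (Tm *\<^sub>v c) $ i" "dim_vec y = g" "dim_vec (Tm *\<^sub>v c) = g" if "i < g" for i
      using that by (metis carrier_vecD index_minus_vec(1) eq_iff_diff_eq_0, metis carrier_vecD, metis carrier_vecD)
    then show ?thesis using \<open>y \<in> carrier_vec g\<close> \<open>Tm *\<^sub>v c \<in> carrier_vec g\<close>
      by (intro eq_vecI) (simp_all only: carrier_vecD)
  qed
  have "\<exists>c\<in>carrier_vec g. col B j = Tm *\<^sub>v c" if j: "j < g" for j
  proof -
    have "col B j \<in> carrier_vec g" using B by (metis col_dim carrier_matD(1))
    from reduce[OF order_refl this] obtain c where c: "c \<in> carrier_vec g"
      "\<forall>i<g. 0 \<le> (col B j - Tm *\<^sub>v c) $ i \<and> (col B j - Tm *\<^sub>v c) $ i < int (d i)" by blast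
    have "col B j = B *\<^sub>v unit_vec g j" using mult_mat_unit_vec[OF B j] by simp
    from zero[OF _ this c] c(1) show ?thesis by auto
  qed
  then obtain cf where cf: "\<And>j. j < g \<Longrightarrow> cf j \<in> carrier_vec g \<and> col B j = Tm *\<^sub>v cf j" by metis
  define S where "S = mat g g (\<lambda>(i, j). cf j $ i)"
  have S: "S \<in> carrier_mat g g" by (simp add: S_def)
  have "B = Tm * S"
  proof (rule eq_matI)
    fix i j assume "i < dim_row (Tm * S)" "j < dim_col (Tm * S)"
    then have ij: "i < g" "j < g" using Tm S by auto
    have "col S j = cf j" using cf[OF ij(2)] ij by (intro eq_vecI) (auto simp: S_def)
    then have "(Tm * S) $$ (i, j) = (Tm *\<^sub>v cf j) $ i" using ij Tm S by simp
    also have "\<dots> = col B j $ i" using cf[OF ij(2)] by simp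
    finally show "B $$ (i, j) = (Tm * S) $$ (i, j)" using ij B by simp
  qed (use B Tm S in auto)
  then have "Determinant.det B = Determinant.det Tm * Determinant.det S" using det_mult[OF Tm S] by simp
  then have "\<bar>Determinant.det B\<bar> = (\<Prod>r<g. int (d r)) * \<bar>Determinant.det S\<bar>" "Determinant.det S \<noteq> 0"
    using detT det by (auto simp: abs_mult abs_prod)
  moreover have "(\<Prod>r<g. int (d r)) \<ge> 0" by (intro prod_nonneg) auto
  moreover from calculation have "1 \<le> \<bar>Determinant.det S\<bar>" by linarith
  ultimately have dle: "(\<Prod>r<g. int (d r)) \<le> \<bar>Determinant.det B\<bar>"
    using mult_left_mono[of 1 "\<bar>Determinant.det S\<bar>" "\<Prod>r<g. int (d r)"] by linarith
  define F where "F = (\<Pi>\<^sub>E r\<in>{..<g}. {0..<int (d r)})"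
  define R where "R = (\<lambda>f. vec g f) ` F"
  have finF: "finite F" unfolding F_def by (intro finite_PiE) auto
  have "card R \<le> card F" unfolding R_def by (rule card_image_le[OF finF])
  also have "card F = (\<Prod>r<g. d r)" unfolding F_def by (subst card_PiE) auto
  finally have "int (card R) \<le> (\<Prod>r<g. int (d r))" by (metis int_ops(1) of_nat_le_iff of_nat_prod)
  then have cardR: "int (card R) \<le> \<bar>Determinant.det B\<bar>" using dle by linarith
  have "\<exists>\<rho>\<in>R. \<rho> \<in> carrier_vec g \<and> (\<exists>x\<in>carrier_vec g. y = \<rho> + B *\<^sub>v x)" if y: "y \<in> carrier_vec g" for y
  proof -
    from reduce[OF order_refl y] obtain c where c: "c \<in> carrier_vec g"
      "\<forall>i<g. 0 \<le> (y - Tm *\<^sub>v c) $ i \<and> (y - Tm *\<^sub>v c) $ i < int (d i)" by blast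
    define \<rho> where "\<rho> = y - Tm *\<^sub>v c"
    have \<rho>c: "\<rho> \<in> carrier_vec g" using y Tm c by (simp add: \<rho>_def)
    have "restrict (\<lambda>i. \<rho> $ i) {..<g} \<in> F" unfolding F_def using c(2) by (auto simp: \<rho>_def)
    moreover have "\<rho> = vec g (restrict (\<lambda>i. \<rho> $ i) {..<g})" using \<rho>c by (intro eq_vecI) auto
    ultimately have "\<rho> \<in> R" unfolding R_def by blast
    moreover have "y = \<rho> + B *\<^sub>v (Bt *\<^sub>v c)"
      unfolding \<rho>_def Tm_def using y B Bt c(1)
      by (simp add: assoc_mult_mat_vec[OF B Bt c(1)]) (intro eq_vecI, auto)
    moreover have "Bt *\<^sub>v c \<in> carrier_vec g" using Bt c(1) by simp
    ultimately show ?thesis using \<rho>c by blast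
  qed
  then show ?thesis using that[of R] finF cardR unfolding R_def by blast
qed

text \<open>Pigeonhole over the cosets of the lattice spanned by the columns of a maximal minor; by Cramer's rule
  the maximality keeps the coordinates in these columns small.\<close>

lemma siegel:
  assumes ind: "indep l us" and g: "length us \<le> l"
    and js: "length js = length us" "set js \<subseteq> {..l}" "Determinant.det (minor_mat us js) \<noteq> 0"
    and max: "\<And>js'. length js' = length us \<Longrightarrow> set js' \<subseteq> {..l} \<Longrightarrow>
       \<bar>Determinant.det (minor_mat us js')\<bar> \<le> \<bar>Determinant.det (minor_mat us js)\<bar>"
  obtains P H where "P \<in> annih l (set us)" "P \<noteq> 0" "\<And>a. \<bar>coeff P a\<bar> \<le> int H"
    "int H ^ (Suc l - length us) \<le> int (4 * Suc l) ^ Suc l * \<bar>Determinant.det (minor_mat us js)\<bar>"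
proof -
  define g where "g = length us"
  define c where "c = Suc l - g"
  define D where "D = Suc l"
  define M where "M = minor_mat us js"
  define d where "d = Determinant.det M"
  have M: "M \<in> carrier_mat g g" by (simp add: M_def g_def)
  have d0: "d \<noteq> 0" using js(3) by (simp add: d_def M_def)
  have c0: "c > 0" "c + g = D" using assms(2) by (auto simp: c_def D_def g_def)
  define bound where "bound = int (4 * D) ^ D * \<bar>d\<bar>"
  have bound0: "bound \<ge> 0" by (simp add: bound_def)
  have "\<exists>B::nat. bound < int B ^ c"
  proof
    have "bound < int (nat bound + 1)" by simp
    also have "\<dots> \<le> int (nat bound + 1) ^ c" using c0 by (intro self_le_power) auto
    finally show "bound < int (nat bound + 1) ^ c" .
  qed
  \<comment> \<open>The least side for which the coefficient box outnumbers the coset data.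
    Minimality bounds \<open>B - 1\<close>, the height of the polynomial obtained.\<close>
  define B where "B = (LEAST B::nat. bound < int B ^ c)"
  have B: "bound < int B ^ c" unfolding B_def by (rule LeastI_ex) fact
  have Bmin: "int (B - 1) ^ c \<le> bound"
  proof (cases "B = 0")
    case True
    then show ?thesis using c0 bound0 by (simp add: zero_power)
  next
    case False
    then show ?thesis using not_less_Least[of "B - 1" "\<lambda>B. bound < int B ^ c"] by (simp add: B_def not_less)
  qed
  have B0: "B > 0" using B c0 bound0 by (cases "B = 0") (auto simp: zero_power)
  obtain R where R: "finite R" "int (card R) \<le> \<bar>d\<bar>"
    "\<And>y. y \<in> carrier_vec g \<Longrightarrow> \<exists>\<rho>\<in>R. \<rho> \<in> carrier_vec g \<and> (\<exists>x\<in>carrier_vec g. y = \<rho> + M *\<^sub>v x)"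
    using coset_reps[OF M] d0 unfolding d_def by blast
  define pf where "pf f = (\<Sum>a\<le>l. monom (f a :: int) a)" for f
  have cpf: "coeff (pf f) a = (if a \<le> l then f a else 0)" for f a
    by (simp add: pf_def coeff_sum)
  have dpf: "degree (pf f) \<le> l" for f by (intro degree_le) (simp add: cpf)
  have prpf: "pr (pf f) u = (\<Sum>a\<le>l. f a * u a)" for f u
    unfolding pf_def pr_sum pr_monom ..
  define v where "v f = vec g (\<lambda>r. pr (pf f) (us ! r))" for f
  have "\<exists>\<rho> x. \<rho> \<in> R \<and> \<rho> \<in> carrier_vec g \<and> x \<in> carrier_vec g \<and> v f = \<rho> + M *\<^sub>v x" for f
    using R(3)[of "v f"] by (auto simp: v_def)
  then obtain \<rho> x where \<rho>x: "\<And>f. \<rho> f \<in> R" "\<And>f. \<rho> f \<in> carrier_vec g" "\<And>f. x f \<in> carrier_vec g"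
    "\<And>f. v f = \<rho> f + M *\<^sub>v x f" by metis
  have "\<exists>e. \<forall>i<g. \<bar>e i\<bar> \<le> \<bar>d\<bar> \<and> True" by (rule exI[of _ "\<lambda>_. 0"]) simp
  define e where "e a i = Determinant.det (minor_mat us (js[i := a]))" for a i
  have eb: "\<bar>e a i\<bar> \<le> \<bar>d\<bar>" if "a \<le> l" "i < g" for a i
  proof -
    have "set (js[i := a]) \<subseteq> {..l}" using js(2) that(1) set_update_subset_insert[of js i a] by auto
    then show ?thesis unfolding e_def d_def M_def using js(1) by (intro max) auto
  qed
  have rel: "d * (us ! r) a = (\<Sum>i<g. e a i * (us ! r) (js ! i))" if "a \<le> l" "r < g" for a r
  proof -
    have "monom d a - (\<Sum>i<g. monom (e a i) (js ! i)) \<in> annih l (set us)"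
      using cramer_poly[OF js(1,2) that(1) js(3)] by (simp add: d_def M_def e_def g_def)
    then have "pr (monom d a - (\<Sum>i<g. monom (e a i) (js ! i))) (us ! r) = 0"
      using that(2) by (simp add: annih_def g_def)
    then show ?thesis by (simp add: pr_diff pr_sum pr_monom)
  qed
  \<comment> \<open>\<open>t f\<close> is \<open>d\<close> times the rational solution
    \<open>y\<close> of \<open>M y = v f\<close>. By Cramer's rule it is a combination of the
    replaced minors \<open>e a i\<close>, each at most \<open>d\<close> in absolute value.\<close>
  define t where "t f = vec g (\<lambda>i. \<Sum>a\<le>l. f a * e a i)" for f
  have Mt: "M *\<^sub>v t f = d \<cdot>\<^sub>v v f" for f
  proof (rule eq_vecI)
    fix r assume "r < dim_vec (d \<cdot>\<^sub>v v f)"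
    then have r: "r < g" by (simp add: v_def)
    have "(M *\<^sub>v t f) $ r = (\<Sum>i<g. (us ! r) (js ! i) * (\<Sum>a\<le>l. f a * e a i))"
      using mult_mat_vec_index[OF M _ r, of "t f"] r by (simp add: t_def M_def minor_mat_def g_def)
    also have "\<dots> = (\<Sum>i<g. \<Sum>a\<le>l. f a * (e a i * (us ! r) (js ! i)))"
      by (simp add: sum_distrib_left algebra_simps)
    also have "\<dots> = (\<Sum>a\<le>l. \<Sum>i<g. f a * (e a i * (us ! r) (js ! i)))" by (rule sum.swap)
    also have "\<dots> = (\<Sum>a\<le>l. f a * (d * (us ! r) a))"
      using rel r by (simp add: sum_distrib_left[symmetric])
    also have "\<dots> = (d \<cdot>\<^sub>v v f) $ r"
      using r by (simp add: v_def prpf sum_distrib_left algebra_simps)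
    finally show "(M *\<^sub>v t f) $ r = (d \<cdot>\<^sub>v v f) $ r" .
  qed (use M in \<open>simp add: v_def\<close>)
  have inj: "y = y'" if "y \<in> carrier_vec g" "y' \<in> carrier_vec g" "M *\<^sub>v y = M *\<^sub>v y'" for y y'
  proof -
    have adj: "adj_mat M \<in> carrier_mat g g" "adj_mat M * M = d \<cdot>\<^sub>m 1\<^sub>m g"
      using adj_mat[OF M] by (auto simp: d_def)
    have "d \<cdot>\<^sub>v w = adj_mat M *\<^sub>v (M *\<^sub>v w)" if "w \<in> carrier_vec g" for w
    proof -
      have "adj_mat M *\<^sub>v (M *\<^sub>v w) = (d \<cdot>\<^sub>m 1\<^sub>m g) *\<^sub>v w"
        unfolding adj(2)[symmetric] using assoc_mult_mat_vec[OF adj(1) M that] by simp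
      also have "\<dots> = d \<cdot>\<^sub>v w" using that by (intro eq_vecI) auto
      finally show ?thesis by simp
    qed
    then have "d \<cdot>\<^sub>v y = d \<cdot>\<^sub>v y'" using that by metis
    then have "d * y $ i = d * y' $ i" if "i < g" for i
      using that \<open>y \<in> _\<close> \<open>y' \<in> _\<close> by (metis carrier_vecD index_smult_vec(1))
    then show ?thesis using d0 that(1,2) by (intro eq_vecI) auto
  qed
  have key: "t f $ i - t f' $ i = d * (x f $ i - x f' $ i)" if "\<rho> f = \<rho> f'" "i < g" for f f' i
  proof -
    have tc: "t f \<in> carrier_vec g" for f by (simp add: t_def)
    have 1: "M *\<^sub>v (t f - d \<cdot>\<^sub>v x f) = d \<cdot>\<^sub>v \<rho> f" for f
    proof -
      have "M *\<^sub>v (t f - d \<cdot>\<^sub>v x f) = M *\<^sub>v t f - d \<cdot>\<^sub>v (M *\<^sub>v x f)"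
        using mult_minus_distrib_mat_vec[OF M tc, of "d \<cdot>\<^sub>v x f" f] mult_mat_vec_smult[OF M \<rho>x(3)[of f], of d] \<rho>x(3)[of f] by simp
      also have "\<dots> = d \<cdot>\<^sub>v \<rho> f"
        unfolding Mt \<rho>x(4)[of f] using \<rho>x(2,3)[of f] M by (intro eq_vecI) (auto simp: algebra_simps)
      finally show ?thesis .
    qed
    have "t f - d \<cdot>\<^sub>v x f = t f' - d \<cdot>\<^sub>v x f'"
    proof -
      have c1: "t f - d \<cdot>\<^sub>v x f \<in> carrier_vec g" for f using tc[of f] \<rho>x(3)[of f] by simp
      show ?thesis by (rule inj[OF c1 c1]) (simp only: 1 that(1))
    qed
    then have "(t f - d \<cdot>\<^sub>v x f) $ i = (t f' - d \<cdot>\<^sub>v x f') $ i" by simp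
    then show ?thesis using that(2) tc[of f] tc[of f'] \<rho>x(3)[of f] \<rho>x(3)[of f'] by (simp add: algebra_simps)
  qed
  define Box where "Box = (\<Pi>\<^sub>E a\<in>{..l}. {0..<int B})"
  have finBox: "finite Box" unfolding Box_def by (intro finite_PiE) auto
  have cardBox: "card Box = B ^ D" unfolding Box_def by (subst card_PiE) (auto simp: D_def)
  have fb: "0 \<le> f a \<and> f a < int B" if "f \<in> Box" "a \<le> l" for f a
    using PiE_mem[of f "{..l}" "\<lambda>_. {0..<int B}" a] that unfolding Box_def by simp
  \<comment> \<open>One base polynomial per coset: the vectors \<open>x f\<close> are controlled
    only relative to others of the same coset, so the pigeonhole counts their differences from
    it.\<close>
  define f0 where "f0 r = (SOME f. f \<in> Box \<and> \<rho> f = r)" for r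
  have f0: "f0 (\<rho> f) \<in> Box \<and> \<rho> (f0 (\<rho> f)) = \<rho> f" if "f \<in> Box" for f
    unfolding f0_def by (rule someI[of _ f]) (use that in simp)
  define kk where "kk f = (\<rho> f, restrict (\<lambda>i. x f $ i - x (f0 (\<rho> f)) $ i) {..<g})" for f
  define m where "m = int D * int B"
  define Tg where "Tg = R \<times> (\<Pi>\<^sub>E i\<in>{..<g}. {- m..m})"
  have xb: "\<bar>x f $ i - x (f0 (\<rho> f)) $ i\<bar> \<le> m" if f: "f \<in> Box" and i: "i < g" for f i
  proof -
    let ?f = "f0 (\<rho> f)"
    have "d * (x f $ i - x ?f $ i) = t f $ i - t ?f $ i"
      using key[of f ?f i] f0[OF f] i by simp
    also have "\<dots> = (\<Sum>a\<le>l. (f a - ?f a) * e a i)"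
      using i by (simp add: t_def sum_subtractf algebra_simps)
    finally have "\<bar>d\<bar> * \<bar>x f $ i - x ?f $ i\<bar> = \<bar>\<Sum>a\<le>l. (f a - ?f a) * e a i\<bar>" by (simp add: abs_mult[symmetric])
    also have "\<dots> \<le> (\<Sum>a\<le>l. int B * \<bar>d\<bar>)"
    proof (rule order_trans[OF sum_abs], rule sum_mono)
      fix a assume "a \<in> {..l}"
      then have "\<bar>f a - ?f a\<bar> \<le> int B" "\<bar>e a i\<bar> \<le> \<bar>d\<bar>"
        using fb[OF f, of a] fb[OF conjunct1[OF f0[OF f]], of a] eb i by auto
      then show "\<bar>(f a - ?f a) * e a i\<bar> \<le> int B * \<bar>d\<bar>" unfolding abs_mult by (intro mult_mono) auto
    qed
    also have "\<dots> = \<bar>d\<bar> * m" by (simp add: m_def D_def algebra_simps)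
    finally show ?thesis using d0 by simp
  qed
  have sub: "kk ` Box \<subseteq> Tg"
  proof
    fix y assume "y \<in> kk ` Box"
    then obtain f where f: "f \<in> Box" "y = kk f" by blast
    have "restrict (\<lambda>i. x f $ i - x (f0 (\<rho> f)) $ i) {..<g} \<in> (\<Pi>\<^sub>E i\<in>{..<g}. {- m..m})"
    proof (rule PiE_I)
      fix i assume "i \<in> {..<g}"
      then have "\<bar>x f $ i - x (f0 (\<rho> f)) $ i\<bar> \<le> m" using xb[OF f(1)] by simp
      then have "- m \<le> x f $ i - x (f0 (\<rho> f)) $ i" "x f $ i - x (f0 (\<rho> f)) $ i \<le> m" by linarith+
      with \<open>i \<in> {..<g}\<close> show "restrict (\<lambda>i. x f $ i - x (f0 (\<rho> f)) $ i) {..<g} i \<in> {- m..m}"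
        unfolding atLeastAtMost_iff by simp
    qed simp
    then show "y \<in> Tg" unfolding f(2) kk_def Tg_def using \<rho>x(1) by blast
  qed
  have "int (card Tg) \<le> \<bar>d\<bar> * (4 * m) ^ g"
  proof -
    have m1: "m \<ge> 1" using B0 mult_mono[of 1 "int D" 1 "int B"] by (simp add: m_def D_def)
    have "card Tg = card R * nat (2 * m + 1) ^ g"
      unfolding Tg_def by (simp add: card_cartesian_product card_PiE)
    also have "int \<dots> = int (card R) * (2 * m + 1) ^ g" using m1 by simp
    also have "\<dots> \<le> \<bar>d\<bar> * (4 * m) ^ g" using R(2) m1 by (intro mult_mono power_mono) auto
    finally show ?thesis .
  qed
  also have "\<dots> = (\<bar>d\<bar> * int (4 * D) ^ g) * int B ^ g" by (simp add: m_def power_mult_distrib)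
  also have "\<dots> \<le> bound * int B ^ g"
  proof -
    have "int (4 * D) ^ g \<le> int (4 * D) ^ D" using c0 by (intro power_increasing) (auto simp: D_def)
    then show ?thesis unfolding bound_def by (intro mult_right_mono) (auto simp: mult.commute mult_left_mono)
  qed
  also have "\<dots> < int B ^ c * int B ^ g" using B B0 by (intro mult_strict_right_mono) auto
  also have "\<dots> = int (card Box)" by (simp add: cardBox c0(2)[symmetric] power_add)
  finally have "card Tg < card Box" by simp
  moreover have "finite Tg" unfolding Tg_def using R(1) by (intro finite_cartesian_product finite_PiE) auto
  ultimately have "\<not> inj_on kk Box" using card_inj_on_le[of kk Box Tg] sub by linarith
  then obtain f f' where ff: "f \<in> Box" "f' \<in> Box" "f \<noteq> f'" "kk f = kk f'" by (auto simp: inj_on_def)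
  have \<rho>eq: "\<rho> f = \<rho> f'" using ff(4) by (simp add: kk_def)
  have "x f $ i = x f' $ i" if "i < g" for i
    using ff(4) that \<rho>eq by (auto simp: kk_def restrict_def fun_eq_iff split: if_splits dest: spec[of _ i])
  then have "x f = x f'" using \<rho>x(3)[of f] \<rho>x(3)[of f'] by (intro eq_vecI) auto
  then have veq: "v f = v f'" using \<rho>x(4) \<rho>eq by metis
  define P where "P = pf f - pf f'"
  have "pr P u = 0" if "u \<in> set us" for u
  proof -
    from that obtain r where "r < g" "u = us ! r" by (metis in_set_conv_nth g_def)
    moreover have "v f $ r = v f' $ r" using veq by simp
    ultimately show ?thesis by (simp add: P_def pr_diff v_def)
  qed
  moreover have "degree P \<le> l" unfolding P_def using dpf by (intro degree_diff_le)
  ultimately have "P \<in> annih l (set us)" by (simp add: annih_def)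
  moreover have "P \<noteq> 0"
  proof
    assume "P = 0"
    then have "coeff (pf f) a = coeff (pf f') a" for a by (simp add: P_def)
    then have "f a = f' a" if "a \<in> {..l}" for a using that by (metis atMost_iff cpf)
    then show False using ff(1-3) PiE_ext unfolding Box_def by blast
  qed
  moreover have "\<bar>coeff P a\<bar> \<le> int (B - 1)" for a
    using fb[OF ff(1), of a] fb[OF ff(2), of a] B0 by (auto simp: P_def cpf)
  moreover have "int (B - 1) ^ (Suc l - length us) \<le> int (4 * Suc l) ^ Suc l * \<bar>Determinant.det (minor_mat us js)\<bar>"
    using Bmin by (simp add: bound_def c_def g_def D_def d_def M_def)
  ultimately show ?thesis using that[of P "B - 1"] by blast
qed

section \<open>Minimal points\<close>

definition lerr :: "nat \<Rightarrow> real \<Rightarrow> (nat \<Rightarrow> int) \<Rightarrow> real" where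
  "lerr n \<xi> x = (MAX k\<in>{1..n}. \<bar>real_of_int (x 0) * \<xi> ^ k - real_of_int (x k)\<bar>)"

lemma lerr_ge: "1 \<le> k \<Longrightarrow> k \<le> n \<Longrightarrow> \<bar>real_of_int (x 0) * \<xi> ^ k - real_of_int (x k)\<bar> \<le> lerr n \<xi> x"
  unfolding lerr_def by (intro Max_ge) auto

lemma lerr_less: "n \<ge> 1 \<Longrightarrow> (\<And>k. 1 \<le> k \<Longrightarrow> k \<le> n \<Longrightarrow> \<bar>real_of_int (x 0) * \<xi> ^ k - real_of_int (x k)\<bar> < c) \<Longrightarrow> lerr n \<xi> x < c"
  unfolding lerr_def by (subst Max_less_iff) auto

lemma lerr_nonneg: "n \<ge> 1 \<Longrightarrow> 0 \<le> lerr n \<xi> x"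
  using lerr_ge[of 1 n x \<xi>] by linarith

text \<open>\<open>z T\<close> minimises the error among the points of height at most \<open>T\<close>; breaking ties by the least first
  coordinate gives \<open>z_mono\<close>.\<close>

locale approx =
  fixes n :: nat and \<xi> lam :: real and z :: "nat \<Rightarrow> nat \<Rightarrow> int" and T0 :: nat
  assumes n1: "n \<ge> 1"
    and nonroot: "\<And>P :: int poly. degree P \<le> n \<Longrightarrow> P \<noteq> 0 \<Longrightarrow> poly (map_poly real_of_int P) \<xi> \<noteq> 0"
    and lam: "lam > 0"
    and T0: "T0 \<ge> 2"
    and z_size: "\<And>T. T \<ge> T0 \<Longrightarrow> \<bar>z T 0\<bar> \<le> int T"
    and z_nz: "\<And>T. T \<ge> T0 \<Longrightarrow> z T 0 \<noteq> 0"
    and z_err: "\<And>T. T \<ge> T0 \<Longrightarrow> lerr n \<xi> (z T) \<le> real T powr (- lam)"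
    and z_min: "\<And>T x. T \<ge> T0 \<Longrightarrow> \<exists>k\<le>n. x k \<noteq> 0 \<Longrightarrow> \<bar>x 0\<bar> \<le> int T \<Longrightarrow> lerr n \<xi> (z T) \<le> lerr n \<xi> x"
    and z_mono: "\<And>T T'. T0 \<le> T \<Longrightarrow> T \<le> T' \<Longrightarrow> \<bar>z T 0\<bar> \<le> \<bar>z T' 0\<bar>"
    and z_small: "\<And>T. T \<ge> T0 \<Longrightarrow> lerr n \<xi> (z T) \<le> min 1 \<bar>\<xi>\<bar> ^ n / 2"
begin

abbreviation L :: "nat \<Rightarrow> real" where "L T \<equiv> lerr n \<xi> (z T)"
abbreviation H0 :: "nat \<Rightarrow> real" where "H0 T \<equiv> real_of_int \<bar>z T 0\<bar>"
abbreviation seg :: "nat \<Rightarrow> nat \<Rightarrow> (nat \<Rightarrow> int) set" where "seg p q \<equiv> z ` {p..q}"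

definition Y :: real where "Y = (1 + \<bar>\<xi>\<bar>) ^ n"
definition \<eta> :: real where "\<eta> = min 1 \<bar>\<xi>\<bar> ^ n"

lemma xi_nz: "\<xi> \<noteq> 0"
proof
  assume "\<xi> = 0"
  then have "poly (map_poly real_of_int [:0, 1:]) \<xi> = 0" by (simp add: map_poly_pCons)
  then show False using nonroot[of "[:0, 1:]"] n1 by simp
qed

lemma Y_ge1: "Y \<ge> 1" and pow_le_Y: "a \<le> n \<Longrightarrow> \<bar>\<xi>\<bar> ^ a \<le> Y"
proof -
  show "Y \<ge> 1" unfolding Y_def by (rule one_le_power) simp
  assume "a \<le> n"
  have "\<bar>\<xi>\<bar> ^ a \<le> (1 + \<bar>\<xi>\<bar>) ^ a" by (rule power_mono) auto
  also have "\<dots> \<le> Y" unfolding Y_def using \<open>a \<le> n\<close> by (intro power_increasing) auto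
  finally show "\<bar>\<xi>\<bar> ^ a \<le> Y" .
qed

lemma eta_pos: "\<eta> > 0" and eta_le1: "\<eta> \<le> 1" and pow_ge_eta: "a \<le> n \<Longrightarrow> \<eta> \<le> \<bar>\<xi>\<bar> ^ a"
proof -
  show "\<eta> > 0" unfolding \<eta>_def using xi_nz by simp
  show "\<eta> \<le> 1" unfolding \<eta>_def by (rule power_le_one) auto
  assume "a \<le> n"
  have "\<eta> \<le> min 1 \<bar>\<xi>\<bar> ^ a" unfolding \<eta>_def using \<open>a \<le> n\<close> by (intro power_decreasing) auto
  also have "\<dots> \<le> \<bar>\<xi>\<bar> ^ a" by (rule power_mono) auto
  finally show "\<eta> \<le> \<bar>\<xi>\<bar> ^ a" .
qed

lemma L_nonneg: "0 \<le> L T"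
  by (rule lerr_nonneg[OF n1])

lemma L_small: "T \<ge> T0 \<Longrightarrow> L T \<le> \<eta> / 2"
  using z_small[of T] by (simp add: \<eta>_def)

lemma L_le_half: "T \<ge> T0 \<Longrightarrow> L T \<le> 1 / 2"
  using L_small[of T] eta_le1 by linarith

lemma H0_ge1: "T \<ge> T0 \<Longrightarrow> H0 T \<ge> 1"
  using z_nz[of T] by linarith

lemma L_antimono: "T0 \<le> T \<Longrightarrow> T \<le> T' \<Longrightarrow> L T' \<le> L T"
  by (rule z_min) (use z_size[of T] z_nz[of T] in \<open>auto intro: exI[of _ 0]\<close>)

lemma lerr_pow: "k \<le> n \<Longrightarrow> \<bar>real_of_int (x 0) * \<xi> ^ k - real_of_int (x k)\<bar> \<le> lerr n \<xi> x"
  using lerr_ge[of k n x \<xi>] lerr_nonneg[OF n1, of \<xi> x] by (cases "k = 0") auto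

lemma window_err:
  assumes "a + b \<le> n"
  shows "\<bar>real_of_int (x (a + b)) - real_of_int (x b) * \<xi> ^ a\<bar> \<le> 2 * Y * lerr n \<xi> x"
proof -
  let ?l = "lerr n \<xi> x"
  have "real_of_int (x (a + b)) - real_of_int (x b) * \<xi> ^ a =
      \<xi> ^ a * (real_of_int (x 0) * \<xi> ^ b - real_of_int (x b)) - (real_of_int (x 0) * \<xi> ^ (a + b) - real_of_int (x (a + b)))"
    by (simp add: algebra_simps power_add)
  also have "\<bar>\<dots>\<bar> \<le> \<bar>\<xi> ^ a\<bar> * \<bar>real_of_int (x 0) * \<xi> ^ b - real_of_int (x b)\<bar> +
      \<bar>real_of_int (x 0) * \<xi> ^ (a + b) - real_of_int (x (a + b))\<bar>"
    by (metis abs_mult abs_triangle_ineq4)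
  also have "\<dots> \<le> Y * ?l + Y * ?l"
  proof (rule add_mono)
    show "\<bar>\<xi> ^ a\<bar> * \<bar>real_of_int (x 0) * \<xi> ^ b - real_of_int (x b)\<bar> \<le> Y * ?l"
      using pow_le_Y[of a] lerr_pow[of b x] assms Y_ge1 by (intro mult_mono) (auto simp: power_abs)
    have "\<bar>real_of_int (x 0) * \<xi> ^ (a + b) - real_of_int (x (a + b))\<bar> \<le> 1 * ?l"
      using lerr_pow[of "a + b" x] assms by simp
    also have "\<dots> \<le> Y * ?l" using Y_ge1 lerr_nonneg[OF n1] by (rule mult_right_mono)
    finally show "\<bar>real_of_int (x 0) * \<xi> ^ (a + b) - real_of_int (x (a + b))\<bar> \<le> Y * ?l" .
  qed
  finally show ?thesis by simp
qed

lemma entry_upper: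
  assumes "T \<ge> T0" "b \<le> n"
  shows "\<bar>real_of_int (z T b)\<bar> \<le> 2 * Y * H0 T"
proof -
  have "\<bar>real_of_int (z T b)\<bar> \<le> \<bar>real_of_int (z T 0) * \<xi> ^ b\<bar> + L T"
    using lerr_pow[OF assms(2), of "z T"] by linarith
  also have "\<bar>real_of_int (z T 0) * \<xi> ^ b\<bar> \<le> H0 T * Y"
    using pow_le_Y[OF assms(2)] by (auto simp: abs_mult power_abs intro!: mult_left_mono)
  also have "L T \<le> H0 T * Y"
    using L_le_half[OF assms(1)] H0_ge1[OF assms(1)] Y_ge1 mult_mono[of 1 "H0 T" 1 Y] by simp
  finally show ?thesis by (simp add: algebra_simps)
qed

text \<open>This is the purpose of \<open>z_small\<close>: every coordinate, not just the first, has
  the order of the height, so any window can be the pivot row in \<open>det_bound\<close>.\<close>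

lemma entry_lower:
  assumes "T \<ge> T0" "b \<le> n"
  shows "\<eta> / 2 * H0 T \<le> \<bar>real_of_int (z T b)\<bar>"
proof -
  have "H0 T * \<eta> \<le> \<bar>real_of_int (z T 0) * \<xi> ^ b\<bar>"
    using pow_ge_eta[OF assms(2)] by (auto simp: abs_mult power_abs intro!: mult_left_mono)
  moreover have "L T \<le> \<eta> / 2 * H0 T"
  proof -
    have "L T \<le> \<eta> / 2 * 1" using L_small[OF assms(1)] by simp
    also have "\<dots> \<le> \<eta> / 2 * H0 T"
      by (rule mult_left_mono[OF H0_ge1[OF assms(1)]]) (use eta_pos in simp)
    finally show ?thesis .
  qed
  ultimately show ?thesis using lerr_pow[OF assms(2), of "z T"] by (simp add: algebra_simps abs_le_iff) linarith
qed

text \<open>Bound for the ratio of the leading entry of a window to that of the pivot window. This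
  and the next two constants depend on \<open>n\<close> and \<open>\<xi>\<close> only, so in the end
  they are outweighed by a large \<open>E I 0\<close>.\<close>

definition Kc :: real where "Kc = 4 * Y / \<eta>"
definition Ec :: real where "Ec = (1 + Kc) * (2 * Y)"
definition Mc :: real where "Mc = fact (Suc n) * (2 * Y) * Ec ^ Suc n"

lemma Ec_ge1: "Ec \<ge> 1"
proof -
  have "Kc \<ge> 0" unfolding Kc_def using Y_ge1 eta_pos by simp
  then show ?thesis unfolding Ec_def using Y_ge1 mult_mono[of 1 "1 + Kc" 1 "2 * Y"] by simp
qed

lemma Mc_pos: "Mc > 0"
  unfolding Mc_def using Y_ge1 Ec_ge1 by (intro mult_pos_pos zero_less_power) auto

abbreviation vec_of :: "nat \<times> nat \<Rightarrow> nat \<Rightarrow> int" where "vec_of \<equiv> \<lambda>(T, b). win (z T) b"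

text \<open>\<open>det_bound\<close> with the first tag as pivot: it has the largest index, hence
  the largest height and the smallest error, as both side conditions there demand.\<close>

lemma minor_bound:
  assumes len: "length js = length ts" "length ts > 0" "length ts \<le> Suc n"
    and js: "set js \<subseteq> {..l}" and l: "l \<le> n"
    and ts: "\<And>T b. (T, b) \<in> set ts \<Longrightarrow> T0 \<le> T \<and> T \<le> fst (ts ! 0) \<and> b \<le> n - l"
  shows "real_of_int \<bar>Determinant.det (minor_mat (map vec_of ts) js)\<bar> \<le>
     Mc * (H0 (fst (ts ! 0)) * (\<Prod>v=1..<length ts. L (fst (ts ! v))))"
proof -
  let ?g = "length ts" and ?p = "fst (ts ! 0)"
  define A where "A = map_mat real_of_int (minor_mat (map vec_of ts) js)"
  define Tv where "Tv v = fst (ts ! v)" for v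
  define bv where "bv v = snd (ts ! v)" for v
  have tv: "T0 \<le> Tv v" "Tv v \<le> ?p" "bv v \<le> n - l" if "v < ?g" for v
    using ts[of "Tv v" "bv v"] that nth_mem[OF that] by (auto simp: Tv_def bv_def)
  have jc: "js ! c \<le> l" if "c < ?g" for c using js that len(1) by (metis nth_mem atMost_iff subsetD)
  have A: "A \<in> carrier_mat ?g ?g" by (simp add: A_def minor_mat_def)
  have Aix: "A $$ (r, c) = real_of_int (z (Tv r) (js ! c + bv r))" if "r < ?g" "c < ?g" for r c
    using that by (simp add: A_def minor_mat_def win_def Tv_def bv_def split_beta)
  have p: "T0 \<le> ?p" using tv[OF len(2)] by simp
  define \<alpha> where "\<alpha> r = real_of_int (z (Tv r) (bv r))" for r
  have a0: "\<eta> / 2 * H0 ?p \<le> \<bar>\<alpha> 0\<bar>"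
    using entry_lower[OF p, of "bv 0"] tv(3)[OF len(2)] by (simp add: \<alpha>_def Tv_def)
  have "0 < \<eta> / 2 * H0 ?p" by (rule mult_pos_pos) (use eta_pos H0_ge1[OF p] in linarith)+
  with a0 have "0 < \<bar>\<alpha> 0\<bar>" by (rule less_le_trans[rotated])
  then have a0n: "\<alpha> 0 \<noteq> 0" by simp
  have "\<bar>Determinant.det A\<bar> \<le> fact ?g * ((2 * Y * H0 ?p) * (\<Prod>r=1..<?g. (1 + Kc) * (2 * Y * L (Tv r))))"
  proof (rule det_bound[where \<alpha> = \<alpha> and K = Kc and Bd = "2 * Y * H0 ?p"
        and \<epsilon> = "\<lambda>r. 2 * Y * L (Tv r)" and y = "\<lambda>c. \<xi> ^ (js ! c)", OF A len(2) a0n])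
    fix r assume r: "r < ?g"
    have "\<bar>\<alpha> r\<bar> \<le> 2 * Y * H0 (Tv r)" unfolding \<alpha>_def using tv[OF r] by (intro entry_upper) auto
    also have "\<dots> \<le> 2 * Y * H0 ?p" using z_mono[OF tv(1,2)[OF r]] Y_ge1 by (intro mult_left_mono) auto
    also have "\<dots> = Kc * (\<eta> / 2 * H0 ?p)" using eta_pos by (simp add: Kc_def field_simps)
    also have "\<dots> \<le> Kc * \<bar>\<alpha> 0\<bar>" using a0 Y_ge1 eta_pos by (intro mult_left_mono) (auto simp: Kc_def)
    finally show "\<bar>\<alpha> r\<bar> \<le> Kc * \<bar>\<alpha> 0\<bar>" .
    show "2 * Y * L (Tv 0) \<le> 2 * Y * L (Tv r)"
      using L_antimono[OF tv(1,2)[OF r]] Y_ge1 by (intro mult_left_mono) (auto simp: Tv_def)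
  next
    fix c assume c: "c < ?g"
    show "\<bar>A $$ (0, c)\<bar> \<le> 2 * Y * H0 ?p"
      using Aix[OF len(2) c] entry_upper[OF p, of "js ! c + bv 0"] jc[OF c] tv(3)[OF len(2)] l
      by (simp add: Tv_def)
  next
    fix r c assume rc: "r < ?g" "c < ?g"
    show "\<bar>A $$ (r, c) - \<alpha> r * \<xi> ^ (js ! c)\<bar> \<le> 2 * Y * L (Tv r)"
      using Aix[OF rc] window_err[of "js ! c" "bv r" "z (Tv r)"] jc[OF rc(2)] tv(3)[OF rc(1)] l
      by (simp add: \<alpha>_def)
  qed
  also have "(\<Prod>r=1..<?g. (1 + Kc) * (2 * Y * L (Tv r))) = Ec ^ (?g - 1) * (\<Prod>r=1..<?g. L (Tv r))"
  proof -
    have "(1 + Kc) * (2 * Y * x) = Ec * x" for x by (simp add: Ec_def algebra_simps)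
    then show ?thesis by (simp only: prod.distrib prod_constant card_atLeastLessThan)
  qed
  also have "fact ?g * ((2 * Y * H0 ?p) * (Ec ^ (?g - 1) * (\<Prod>r=1..<?g. L (Tv r)))) =
      (fact ?g * (2 * Y) * Ec ^ (?g - 1)) * (H0 ?p * (\<Prod>r=1..<?g. L (Tv r)))"
    by (simp add: algebra_simps)
  also have "\<dots> \<le> Mc * (H0 ?p * (\<Prod>r=1..<?g. L (Tv r)))"
  proof (rule mult_right_mono)
    show "fact ?g * (2 * Y) * Ec ^ (?g - 1) \<le> Mc"
      unfolding Mc_def using len(3) Y_ge1 Ec_ge1
      by (intro mult_mono power_increasing fact_mono) auto
    show "0 \<le> H0 ?p * (\<Prod>r=1..<?g. L (Tv r))"
      using L_nonneg by (intro mult_nonneg_nonneg prod_nonneg) auto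
  qed
  finally have main: "\<bar>Determinant.det A\<bar> \<le> Mc * (H0 ?p * (\<Prod>r=1..<?g. L (Tv r)))" .
  have hom: "comm_ring_hom real_of_int" by unfold_locales auto
  have "Determinant.det A = real_of_int (Determinant.det (minor_mat (map vec_of ts) js))"
    unfolding A_def by (rule comm_ring_hom.hom_det[OF hom])
  then show ?thesis using main by (simp add: Tv_def)
qed

lemma nonzero_minor_ge1:
  assumes "indep l (map vec_of ts)" "length ts > 0" "l \<le> n"
    and ts: "\<And>T b. (T, b) \<in> set ts \<Longrightarrow> T0 \<le> T \<and> T \<le> fst (ts ! 0) \<and> b \<le> n - l"
  shows "1 \<le> Mc * (H0 (fst (ts ! 0)) * (\<Prod>v=1..<length ts. L (fst (ts ! v))))"
proof -
  obtain js where js: "length js = length (map vec_of ts)" "set js \<subseteq> {..l}"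
    "Determinant.det (minor_mat (map vec_of ts) js) \<noteq> 0"
    using minor_exists[OF assms(1)] by blast
  have "length ts \<le> Suc n" using assms(1,3) by (simp add: indep_def)
  then have "real_of_int \<bar>Determinant.det (minor_mat (map vec_of ts) js)\<bar> \<le>
     Mc * (H0 (fst (ts ! 0)) * (\<Prod>v=1..<length ts. L (fst (ts ! v))))"
    using js assms by (intro minor_bound[where l = l]) auto
  moreover have "1 \<le> real_of_int \<bar>Determinant.det (minor_mat (map vec_of ts) js)\<bar>" using js(3) by linarith
  ultimately show ?thesis by linarith
qed

definition Sc :: real where "Sc = real (4 * Suc n) ^ Suc n * Mc"

lemma siegel_seg:
  assumes ind: "indep l (map vec_of ts)" "length ts > 0" "length ts \<le> l" "l \<le> n"
    and ts: "\<And>T b. (T, b) \<in> set ts \<Longrightarrow> T0 \<le> T \<and> T \<le> fst (ts ! 0) \<and> b \<le> n - l"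
  obtains P H where "P \<in> annih l (vec_of ` set ts)" "P \<noteq> 0" "\<And>a. \<bar>coeff P a\<bar> \<le> int H"
    "real H ^ (Suc l - length ts) \<le> Sc * (H0 (fst (ts ! 0)) * (\<Prod>v=1..<length ts. L (fst (ts ! v))))"
proof -
  let ?us = "map vec_of ts"
  obtain js0 where js0: "length js0 = length ?us" "set js0 \<subseteq> {..l}" "Determinant.det (minor_mat ?us js0) \<noteq> 0"
    using minor_exists[OF ind(1)] by blast
  obtain js where js: "length js = length ?us" "set js \<subseteq> {..l}" "Determinant.det (minor_mat ?us js) \<noteq> 0"
    "\<And>js'. length js' = length ?us \<Longrightarrow> set js' \<subseteq> {..l} \<Longrightarrow> True \<Longrightarrow>
       \<bar>Determinant.det (minor_mat ?us js')\<bar> \<le> \<bar>Determinant.det (minor_mat ?us js)\<bar>"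
    by (rule max_minor[OF js0, of "\<lambda>_. True"]) (rule TrueI, rule that, assumption+)
  have len: "length ?us \<le> l" using ind(3) by simp
  have js4: "\<bar>Determinant.det (minor_mat ?us js')\<bar> \<le> \<bar>Determinant.det (minor_mat ?us js)\<bar>"
    if "length js' = length ?us" "set js' \<subseteq> {..l}" for js' using js(4) that by simp
  obtain P H where P: "P \<in> annih l (set ?us)" "P \<noteq> 0" "\<And>a. \<bar>coeff P a\<bar> \<le> int H"
    "int H ^ (Suc l - length ?us) \<le> int (4 * Suc l) ^ Suc l * \<bar>Determinant.det (minor_mat ?us js)\<bar>"
    by (rule siegel[OF ind(1) len js(1-3) js4]) (assumption, assumption, rule that, assumption+)
  have "real_of_int (int H ^ (Suc l - length ?us)) \<le> real_of_int (int (4 * Suc l) ^ Suc l * \<bar>Determinant.det (minor_mat ?us js)\<bar>)"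
    using P(4) by (simp only: of_int_le_iff)
  then have "real H ^ (Suc l - length ts) \<le> real (4 * Suc l) ^ Suc l * real_of_int \<bar>Determinant.det (minor_mat ?us js)\<bar>"
    by (simp only: of_int_power of_int_mult of_int_of_nat_eq length_map)
  also have "\<dots> \<le> real (4 * Suc n) ^ Suc n * (Mc * (H0 (fst (ts ! 0)) * (\<Prod>v=1..<length ts. L (fst (ts ! v)))))"
  proof (rule mult_mono)
    have "real (4 * Suc l) ^ Suc l \<le> real (4 * Suc n) ^ Suc l" using ind(4) by (intro power_mono) auto
    also have "\<dots> \<le> real (4 * Suc n) ^ Suc n" using ind(4) by (intro power_increasing) auto
    finally show "real (4 * Suc l) ^ Suc l \<le> real (4 * Suc n) ^ Suc n" .
    show "real_of_int \<bar>Determinant.det (minor_mat ?us js)\<bar> \<le> Mc * (H0 (fst (ts ! 0)) * (\<Prod>v=1..<length ts. L (fst (ts ! v))))"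
      using js ind ts by (intro minor_bound[where l = l]) auto
  qed auto
  finally have "real H ^ (Suc l - length ts) \<le> Sc * (H0 (fst (ts ! 0)) * (\<Prod>v=1..<length ts. L (fst (ts ! v))))"
    by (simp add: Sc_def mult.assoc)
  then show ?thesis using that[OF _ P(2,3)] P(1) by simp
qed

lemma Sc_pos: "Sc > 0"
  unfolding Sc_def using Mc_pos by simp

lemma poly_real_sum:
  assumes "degree P \<le> l"
  shows "poly (map_poly real_of_int P) \<xi> = (\<Sum>a\<le>l. real_of_int (coeff P a) * \<xi> ^ a)"
proof -
  have "degree (map_poly real_of_int P) \<le> l" using assms by (simp add: degree_map_poly)
  then show ?thesis unfolding poly_altdef
    by (subst sum.mono_neutral_left[of "{..l}"]) (auto simp: coeff_eq_0 coeff_map_poly)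
qed

lemma pr_window:
  assumes "degree P \<le> l" "l + b \<le> n" "\<And>a. \<bar>real_of_int (coeff P a)\<bar> \<le> H"
  shows "\<bar>real_of_int (pr P (win x b)) - real_of_int (x b) * poly (map_poly real_of_int P) \<xi>\<bar> \<le>
     real (Suc n) * (2 * Y) * H * lerr n \<xi> x"
proof -
  have H: "H \<ge> 0" using assms(3)[of 0] by linarith
  have "real_of_int (pr P (win x b)) - real_of_int (x b) * poly (map_poly real_of_int P) \<xi> =
     (\<Sum>a\<le>l. real_of_int (coeff P a) * (real_of_int (x (a + b)) - real_of_int (x b) * \<xi> ^ a))"
    by (simp add: pr_bound[OF assms(1)] poly_real_sum[OF assms(1)] win_def sum_distrib_left sum_subtractf algebra_simps)
  also have "\<bar>\<dots>\<bar> \<le> (\<Sum>a\<le>l. H * (2 * Y * lerr n \<xi> x))"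
  proof (rule order_trans[OF sum_abs], rule sum_mono)
    fix a assume "a \<in> {..l}"
    then show "\<bar>real_of_int (coeff P a) * (real_of_int (x (a + b)) - real_of_int (x b) * \<xi> ^ a)\<bar> \<le> H * (2 * Y * lerr n \<xi> x)"
      unfolding abs_mult using assms(2,3) H window_err[of a b x] by (intro mult_mono) auto
  qed
  also have "\<dots> = real (Suc l) * (H * (2 * Y * lerr n \<xi> x))" by simp
  also have "\<dots> \<le> real (Suc n) * (H * (2 * Y * lerr n \<xi> x))"
    using assms(2) H Y_ge1 lerr_nonneg[OF n1] by (intro mult_right_mono) auto
  finally show ?thesis by (simp add: algebra_simps)
qed

definition Nc :: real where "Nc = 2 * (real (Suc n) * (2 * Y)) * (2 * Y)"

lemma Nc_pos: "Nc > 0"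
  unfolding Nc_def using Y_ge1 by simp

text \<open>As \<open>P\<close> annihilates \<open>z I\<close>, its value at \<open>\<xi>\<close> is
  at most of order \<open>H * L I / H0 I\<close>. The preceding point has no larger height and no
  smaller error, so the nonzero integer \<open>pr P (win (z (I - 1)) b)\<close> is at most of order
  \<open>H * L (I - 1)\<close>.\<close>

lemma nonvanishing:
  assumes P: "degree P \<le> l" "l + b \<le> n" "\<And>a. \<bar>real_of_int (coeff P a)\<bar> \<le> H"
    and I: "T0 \<le> I - 1" "pr P (z I) = 0" "pr P (win (z (I - 1)) b) \<noteq> 0"
  shows "1 \<le> Nc * H * L (I - 1)"
proof -
  let ?v = "poly (map_poly real_of_int P) \<xi>" and ?J = "I - 1" and ?c = "real (Suc n) * (2 * Y)"
  have H: "H \<ge> 0" using P(3)[of 0] by linarith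
  have TI: "T0 \<le> I" "?J \<le> I" using I(1) T0 by auto
  have c0: "?c \<ge> 0" using Y_ge1 by simp
  have "H0 I * \<bar>?v\<bar> \<le> ?c * H * L I"
    using pr_window[OF P(1) _ P(3), of 0 "z I"] P(2) I(2) by (simp add: abs_mult)
  also have "\<dots> \<le> ?c * H * L ?J" using L_antimono[OF I(1) TI(2)] c0 H by (intro mult_left_mono) auto
  finally have v: "H0 I * \<bar>?v\<bar> \<le> ?c * H * L ?J" .
  have "\<bar>real_of_int (z ?J b)\<bar> * \<bar>?v\<bar> \<le> 2 * Y * H0 ?J * \<bar>?v\<bar>"
    using entry_upper[OF I(1), of b] P(2) by (intro mult_right_mono) auto
  also have "\<dots> \<le> 2 * Y * (H0 I * \<bar>?v\<bar>)"
    using z_mono[OF I(1) TI(2)] Y_ge1 by (simp add: mult.assoc mult_left_mono mult_right_mono)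
  also have "\<dots> \<le> 2 * Y * (?c * H * L ?J)" using v Y_ge1 by (intro mult_left_mono) auto
  finally have 1: "\<bar>real_of_int (z ?J b) * ?v\<bar> \<le> 2 * Y * (?c * H * L ?J)" by (simp add: abs_mult)
  have "1 \<le> \<bar>real_of_int (pr P (win (z ?J) b))\<bar>" using I(3) by linarith
  also have "\<dots> \<le> ?c * H * L ?J + 2 * Y * (?c * H * L ?J)"
    using pr_window[OF P, of "z ?J"] 1 by linarith
  also have "\<dots> \<le> 2 * Y * (?c * H * L ?J) + 2 * Y * (?c * H * L ?J)"
  proof -
    have "1 * (?c * H * L ?J) \<le> 2 * Y * (?c * H * L ?J)"
      using Y_ge1 c0 H L_nonneg by (intro mult_right_mono) auto
    then show ?thesis by simp
  qed
  also have "\<dots> = Nc * H * L ?J" by (simp add: Nc_def algebra_simps)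
  finally show ?thesis .
qed


lemma L_pos:
  assumes "T \<ge> T0"
  shows "L T > 0"
proof (rule ccontr)
  assume "\<not> ?thesis"
  then have "L T = 0" using L_nonneg[of T] by linarith
  then have "real_of_int (z T 0) * \<xi> ^ 1 - real_of_int (z T 1) = 0"
    using lerr_pow[of 1 "z T"] n1 by simp
  then have "poly (map_poly real_of_int [:- z T 1, z T 0:]) \<xi> = 0"
    by (simp add: map_poly_pCons mult.commute)
  then show False using nonroot[of "[:- z T 1, z T 0:]"] z_nz[OF assms] n1 by simp
qed

text \<open>As \<open>z q\<close> is a best approximation, a box of height \<open>H0 q\<close> and width \<open>L q\<close> contains few integer points, so
  counting bounds its volume in the span of the given points by their covolume.\<close>

lemma minkowski_core:
  assumes ind: "indep n (map vec_of ts)" "length ts > 0"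
    and ts: "\<And>T b. (T, b) \<in> set ts \<Longrightarrow> T0 \<le> T \<and> b = 0"
    and q: "q \<ge> T0" "\<And>P. P \<in> annih n (vec_of ` set ts) \<Longrightarrow> pr P (z q) = 0"
  obtains js where "length js = length ts" "set js \<subseteq> {..n}"
    "H0 q * L q ^ (length ts - 1) \<le> real (8 * (n + 2)) ^ length ts *
       real_of_int \<bar>Determinant.det (minor_mat (map vec_of ts) js)\<bar>"
proof -
  define us where "us = map vec_of ts"
  define g where "g = length ts"
  have g: "length us = g" "g > 0" using ind by (simp_all add: us_def g_def)
  have gn: "g \<le> Suc n" using ind(1) by (simp add: indep_def us_def g_def)
  have indu: "indep n us" using ind by (simp add: us_def)
  have setus: "set us = vec_of ` set ts" by (simp add: us_def)
  obtain js0 where js0: "length js0 = length us" "set js0 \<subseteq> {..n}" "Determinant.det (minor_mat us js0) \<noteq> 0"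
    "js0 = sorted_list_of_set ({..n} - degree ` (annih n (set us) - {0}))"
    using minor_exists[OF indu] by blast
  \<comment> \<open>No nonzero constant annihilates a point with nonzero first coordinate. Hence
    column 0 can be among the columns, and the remaining ones are measured by their errors.\<close>
  have "0 \<notin> degree ` (annih n (set us) - {0})"
  proof
    assume "0 \<in> degree ` (annih n (set us) - {0})"
    then obtain P where "P \<in> annih n (set us) - {0}" "0 = degree P" by blast
    then have P: "P \<in> annih n (set us)" "P \<noteq> 0" "degree P = 0" by simp_all
    then obtain c where c: "P = [:c:]" "c \<noteq> 0" by (metis degree_eq_zeroE pCons_0_0)
    obtain T b where tb: "ts ! 0 = (T, b)" by (metis surj_pair)
    have mem: "(T, b) \<in> set ts" using ind(2) tb nth_mem by metis
    then have "win (z T) b \<in> set us" unfolding setus by force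
    then have "pr P (win (z T) b) = 0" using P(1) by (simp add: annih_def)
    then have "c * z T 0 = 0" using ts[OF mem] by (simp add: c(1) pr_def)
    then show False using c(2) z_nz ts[OF mem] by auto
  qed
  then have "0 \<in> set js0" unfolding js0(4) by simp
  moreover have "sorted js0" unfolding js0(4) by simp
  ultimately have js00: "js0 ! 0 = 0" using g js0(1)
    by (metis in_set_conv_nth le_zero_eq sorted_nth_mono zero_le)
  obtain js where js: "length js = length us" "set js \<subseteq> {..n}" "Determinant.det (minor_mat us js) \<noteq> 0" "js ! 0 = 0"
    "\<And>js'. length js' = length us \<Longrightarrow> set js' \<subseteq> {..n} \<Longrightarrow> js' ! 0 = 0 \<Longrightarrow>
       \<bar>Determinant.det (minor_mat us js')\<bar> \<le> \<bar>Determinant.det (minor_mat us js)\<bar>"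
    by (rule max_minor[OF js0(1-3), of "\<lambda>js. js ! 0 = 0"]) (rule js00, rule that, assumption+)
  define d where "d = Determinant.det (minor_mat us js)"
  have d0: "d \<noteq> 0" using js(3) by (simp add: d_def)
  define e where "e a i = Determinant.det (minor_mat us (js[i := a]))" for a i
  define Pa where "Pa a = monom d a - (\<Sum>i<g. monom (e a i) (js ! i))" for a
  have Pa: "Pa a \<in> annih n (set us)" if "a \<le> n" for a
    using cramer_poly[OF js(1,2) that js(3)] by (simp add: Pa_def d_def e_def g(1))
  \<comment> \<open>Index 0 is excluded: replacing column 0 may leave the family in which
    \<open>js\<close> is maximal. Its term disappears from \<open>rel\<close> because
    \<open>Dl x 0 = 0\<close>.\<close>
  have eb: "\<bar>e a i\<bar> \<le> \<bar>d\<bar>" if "a \<le> n" "i < g" "i \<noteq> 0" for a i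
  proof -
    have "set (js[i := a]) \<subseteq> {..n}" using js(2) that(1) set_update_subset_insert[of js i a] by auto
    moreover have "js[i := a] ! 0 = 0" using that(3) js(4) by simp
    ultimately show ?thesis unfolding e_def d_def using js(1) by (intro js(5)) auto
  qed
  have jsn: "js ! i \<le> n" if "i < g" for i using js(1,2) that g(1) by (metis nth_mem atMost_iff subsetD)
  define \<kappa> where "\<kappa> a = real_of_int d * \<xi> ^ a - (\<Sum>i<g. real_of_int (e a i) * \<xi> ^ (js ! i))" for a
  define Dl where "Dl x k = real_of_int (x 0) * \<xi> ^ k - real_of_int (x k)" for x :: "nat \<Rightarrow> int" and k
  have rel: "real_of_int (x 0) * \<kappa> a = real_of_int d * Dl x a - (\<Sum>i\<in>{1..<g}. real_of_int (e a i) * Dl x (js ! i))"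
    if "pr (Pa a) x = 0" for x a
  proof -
    have "d * x a = (\<Sum>i<g. e a i * x (js ! i))"
      using that by (simp add: Pa_def pr_diff pr_sum pr_monom)
    then have "real_of_int d * real_of_int (x a) = (\<Sum>i<g. real_of_int (e a i) * real_of_int (x (js ! i)))"
      by (metis (no_types, lifting) of_int_mult of_int_sum sum.cong)
    then have "real_of_int (x 0) * \<kappa> a = real_of_int d * Dl x a - (\<Sum>i<g. real_of_int (e a i) * Dl x (js ! i))"
      by (simp add: \<kappa>_def Dl_def sum_distrib_left sum_subtractf algebra_simps)
    also have "(\<Sum>i<g. real_of_int (e a i) * Dl x (js ! i)) = (\<Sum>i\<in>{1..<g}. real_of_int (e a i) * Dl x (js ! i))"
      using g(2) js(4) by (intro sum.mono_neutral_right) (auto simp: Dl_def Suc_le_eq)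
    finally show ?thesis .
  qed
  have sumb: "\<bar>\<Sum>i\<in>{1..<g}. real_of_int (e a i) * Dl x (js ! i)\<bar> \<le> real (g - 1) * (real_of_int \<bar>d\<bar> * \<beta>)"
    if "a \<le> n" "\<And>i. 1 \<le> i \<Longrightarrow> i < g \<Longrightarrow> \<bar>Dl x (js ! i)\<bar> \<le> \<beta>" for a x \<beta>
  proof -
    have "\<bar>\<Sum>i\<in>{1..<g}. real_of_int (e a i) * Dl x (js ! i)\<bar> \<le> (\<Sum>i\<in>{1..<g}. real_of_int \<bar>d\<bar> * \<beta>)"
    proof (rule order_trans[OF sum_abs], rule sum_mono)
      fix i assume i: "i \<in> {1..<g}"
      have "\<bar>real_of_int (e a i)\<bar> \<le> real_of_int \<bar>d\<bar>" using eb[OF that(1), of i] i by simp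
      then show "\<bar>real_of_int (e a i) * Dl x (js ! i)\<bar> \<le> real_of_int \<bar>d\<bar> * \<beta>"
        unfolding abs_mult using that(2)[of i] i by (intro mult_mono) auto
    qed
    then show ?thesis by simp
  qed
  \<comment> \<open>\<open>\<kappa> a\<close> is the value of \<open>Pa a\<close> at
    \<open>\<xi>\<close>. It is bounded by inserting \<open>z q\<close> itself into
    \<open>rel\<close>, all of whose errors are at most \<open>L q\<close>.\<close>
  have \<kappa>b: "H0 q * \<bar>\<kappa> a\<bar> \<le> real g * (real_of_int \<bar>d\<bar> * L q)" if a: "a \<le> n" for a
  proof -
    have "pr (Pa a) (z q) = 0" using q(2) Pa[OF a] setus by simp
    from rel[OF this] have "H0 q * \<bar>\<kappa> a\<bar> = \<bar>real_of_int d * Dl (z q) a - (\<Sum>i\<in>{1..<g}. real_of_int (e a i) * Dl (z q) (js ! i))\<bar>"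
      by (metis abs_mult of_int_abs)
    also have "\<dots> \<le> \<bar>real_of_int d * Dl (z q) a\<bar> + \<bar>\<Sum>i\<in>{1..<g}. real_of_int (e a i) * Dl (z q) (js ! i)\<bar>"
      by (rule abs_triangle_ineq4)
    also have "\<dots> \<le> real_of_int \<bar>d\<bar> * L q + real (g - 1) * (real_of_int \<bar>d\<bar> * L q)"
    proof (rule add_mono)
      show "\<bar>real_of_int d * Dl (z q) a\<bar> \<le> real_of_int \<bar>d\<bar> * L q"
        using lerr_pow[OF a, of "z q"] by (simp add: abs_mult Dl_def mult_left_mono)
      show "\<bar>\<Sum>i\<in>{1..<g}. real_of_int (e a i) * Dl (z q) (js ! i)\<bar> \<le> real (g - 1) * (real_of_int \<bar>d\<bar> * L q)"
        by (rule sumb[OF a]) (use lerr_pow[of _ "z q"] jsn in \<open>simp add: Dl_def\<close>)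
    qed
    also have "\<dots> = (1 + real (g - 1)) * (real_of_int \<bar>d\<bar> * L q)" by (simp add: algebra_simps)
    also have "1 + real (g - 1) = real g" using g(2) by linarith
    finally show ?thesis .
  qed
  \<comment> \<open>Small enough for \<open>2 * \<epsilon> * g < 1\<close> whenever
    \<open>g \<le> n + 1\<close>, so that the point found below beats \<open>L q\<close>
    strictly.\<close>
  define \<epsilon> where "\<epsilon> = 1 / (4 * real (n + 2))"
  have \<epsilon>0: "\<epsilon> > 0" by (simp add: \<epsilon>_def)
  define X1 where "X1 = \<epsilon> * H0 q"
  define \<delta> where "\<delta> = \<epsilon> * L q"
  have X10: "X1 > 0" unfolding X1_def using \<epsilon>0 H0_ge1[OF q(1)] by (intro mult_pos_pos) auto
  have \<delta>0: "\<delta> > 0" unfolding \<delta>_def using \<epsilon>0 L_pos[OF q(1)] by simp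
  have "X1 * \<delta> ^ (g - 1) \<le> 2 ^ g * real_of_int \<bar>d\<bar>"
  proof (rule ccontr)
    assume "\<not> ?thesis"
    then have big: "2 ^ g * real_of_int \<bar>d\<bar> < X1 * \<delta> ^ (g - 1)" by simp
    \<comment> \<open>Scaling by \<open>Q\<close> replaces the real box by an integer one. The
      determinant becomes \<open>Q ^ g * d\<close>, and rounding the \<open>g\<close> sides down
      costs at most the factor \<open>2 ^ g\<close>.\<close>
    obtain Q :: nat where Q: "1 / X1 \<le> real Q" "1 / \<delta> \<le> real Q"
      using real_arch_simple[of "max (1 / X1) (1 / \<delta>)"] by auto
    have QX: "1 \<le> real Q * X1" "1 \<le> real Q * \<delta>" using Q X10 \<delta>0 by (simp_all add: field_simps)
    have Q0: "Q > 0" using QX(1) by (cases "Q = 0") auto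
    define X' where "X' = nat \<lfloor>real Q * X1\<rfloor>"
    define D' where "D' = nat \<lfloor>real Q * \<delta>\<rfloor>"
    have fl: "x / 2 \<le> real (nat \<lfloor>x\<rfloor>)" "real (nat \<lfloor>x\<rfloor>) \<le> x" if "1 \<le> x" for x :: real
    proof -
      have "1 \<le> \<lfloor>x\<rfloor>" using that by (simp add: le_floor_iff)
      then have "real (nat \<lfloor>x\<rfloor>) = real_of_int \<lfloor>x\<rfloor>" "1 \<le> real_of_int \<lfloor>x\<rfloor>" by linarith+
      moreover have "x < real_of_int \<lfloor>x\<rfloor> + 1" "real_of_int \<lfloor>x\<rfloor> \<le> x" by linarith+
      ultimately show "x / 2 \<le> real (nat \<lfloor>x\<rfloor>)" "real (nat \<lfloor>x\<rfloor>) \<le> x" by linarith+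
    qed
    have X'b: "real Q * X1 / 2 \<le> real X'" "real X' \<le> real Q * X1" unfolding X'_def by (rule fl[OF QX(1)])+
    have D'b: "real Q * \<delta> / 2 \<le> real D'" "real D' \<le> real Q * \<delta>" unfolding D'_def by (rule fl[OF QX(2)])+
    have "real Q ^ g * real_of_int \<bar>d\<bar> < real Q ^ g * (X1 * \<delta> ^ (g - 1)) / 2 ^ g"
      using big Q0 by (simp add: field_simps)
    also have "real Q ^ g = real Q * real Q ^ (g - 1)" and "(2::real) ^ g = 2 * 2 ^ (g - 1)"
      using g(2) by (metis Suc_pred' power_Suc)+
    then have "real Q ^ g * (X1 * \<delta> ^ (g - 1)) / 2 ^ g = (real Q * X1 / 2) * (real Q * \<delta> / 2) ^ (g - 1)"
      by (simp add: power_mult_distrib power_divide)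
    also have "\<dots> \<le> real X' * real D' ^ (g - 1)"
      using X'b(1) D'b(1) \<delta>0 X10 by (intro mult_mono power_mono) auto
    finally have "real_of_int (int Q ^ g * \<bar>d\<bar>) < real_of_int (int (X' * D' ^ (g - 1)))" by simp
    then have cnt: "int Q ^ g * \<bar>d\<bar> < int (X' * D' ^ (g - 1))" by (simp only: of_int_less_iff)
    define B where "B = int Q \<cdot>\<^sub>m transpose_mat (minor_mat us js)"
    have B: "B \<in> carrier_mat g g" by (simp add: B_def minor_mat_def g(1))
    have detB: "Determinant.det B = int Q ^ g * d"
    proof -
      have "Determinant.det (transpose_mat (minor_mat us js)) = d"
        unfolding d_def by (rule det_transpose[OF minor_mat_carrier])
      then show ?thesis unfolding B_def by (simp add: minor_mat_def g(1))
    qed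
    have "Determinant.det B \<noteq> 0" using detB d0 Q0 by simp
    from coset_reps[OF B this] obtain R where R: "finite R" "int (card R) \<le> \<bar>Determinant.det B\<bar>"
      "\<And>y. y \<in> carrier_vec g \<Longrightarrow> \<exists>\<rho>\<in>R. \<rho> \<in> carrier_vec g \<and> (\<exists>x\<in>carrier_vec g. y = \<rho> + B *\<^sub>v x)"
      by blast
    define S where "S = {0..<X'} \<times> (\<Pi>\<^sub>E i\<in>{1..<g}. {0..<D'})"
    have finS: "finite S" unfolding S_def by (intro finite_cartesian_product finite_PiE) auto
    have cardS: "card S = X' * D' ^ (g - 1)"
      unfolding S_def by (simp add: card_cartesian_product card_PiE)
    \<comment> \<open>A sheared box: coordinate \<open>i\<close> is measured from the line of slope
      \<open>\<xi> ^ (js ! i)\<close>, so that differences of box points have small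
      \<open>Dl\<close>.\<close>
    define yv where "yv s = vec g (\<lambda>i. if i = 0 then int (fst s) else \<lfloor>\<xi> ^ (js ! i) * real (fst s)\<rfloor> + int (snd s i))"
      for s :: "nat \<times> (nat \<Rightarrow> nat)"
    have "\<exists>\<rho> x. \<rho> \<in> R \<and> \<rho> \<in> carrier_vec g \<and> x \<in> carrier_vec g \<and> yv s = \<rho> + B *\<^sub>v x" for s
      using R(3)[of "yv s"] by (auto simp: yv_def)
    then obtain \<rho> x where \<rho>x: "\<And>s. \<rho> s \<in> R" "\<And>s. \<rho> s \<in> carrier_vec g" "\<And>s. x s \<in> carrier_vec g"
      "\<And>s. yv s = \<rho> s + B *\<^sub>v x s" by metis
    have "int (card R) < int (card S)" using R(2) detB cnt Q0 by (simp add: cardS abs_mult)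
    then have "\<not> inj_on \<rho> S" using card_inj_on_le[of \<rho> S R] \<rho>x(1) R(1) by fastforce
    then obtain s s' where ss: "s \<in> S" "s' \<in> S" "s \<noteq> s'" "\<rho> s = \<rho> s'" by (auto simp: inj_on_def)
    define c where "c v = x s $ v - x s' $ v" for v
    define w where "w a = (\<Sum>v<g. c v * (us ! v) a)" for a
    have Qw: "int Q * w (js ! i) = yv s $ i - yv s' $ i" if i: "i < g" for i
    proof -
      have Bi: "B $$ (i, v) = int Q * (us ! v) (js ! i)" if "v < g" for v
        using i that by (simp add: B_def minor_mat_def g(1))
      have "yv s $ i = \<rho> s $ i + (B *\<^sub>v x s) $ i" for s
        using \<rho>x(2,3)[of s] i B by (subst \<rho>x(4)) simp
      then have "yv s $ i - yv s' $ i = (B *\<^sub>v x s) $ i - (B *\<^sub>v x s') $ i" using ss(4) by simp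
      also have "\<dots> = (\<Sum>v<g. B $$ (i, v) * c v)"
        using mult_mat_vec_index[OF B \<rho>x(3) i] by (simp add: c_def sum_subtractf algebra_simps)
      also have "\<dots> = int Q * w (js ! i)"
        using Bi by (simp add: w_def sum_distrib_left algebra_simps)
      finally show ?thesis by simp
    qed
    have prw: "pr P w = 0" if "P \<in> annih n (set us)" for P
    proof -
      have "pr P w = (\<Sum>v<g. c v * pr P (us ! v))"
        unfolding pr_def w_def sum_distrib_left by (subst sum.swap) (simp add: algebra_simps)
      also have "\<dots> = 0" using that g(1) by (intro sum.neutral) (auto simp: annih_def)
      finally show ?thesis .
    qed
    have sX: "fst s < X'" "fst s' < X'" using ss(1,2) by (auto simp: S_def)
    have w0: "int Q * w 0 = int (fst s) - int (fst s')" using Qw[OF g(2)] js(4) g(2) by (simp add: yv_def)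
    then have "\<bar>int Q * w 0\<bar> < int X'" using sX by linarith
    then have "real_of_int \<bar>int Q * w 0\<bar> < real_of_int (int X')" by (simp only: of_int_less_iff)
    then have "real Q * \<bar>real_of_int (w 0)\<bar> < real Q * X1" using X'b(2) by (simp add: abs_mult)
    then have w0X: "\<bar>real_of_int (w 0)\<bar> < X1" using Q0 by simp
    have Dw: "\<bar>Dl w (js ! i)\<bar> \<le> \<delta>" if i: "1 \<le> i" "i < g" for i
    proof -
      have sD: "snd s i < D'" "snd s' i < D'" using ss(1,2) i by (auto simp: S_def PiE_iff)
      define \<theta> where "\<theta> s = \<xi> ^ (js ! i) * real (fst s) - real_of_int \<lfloor>\<xi> ^ (js ! i) * real (fst s)\<rfloor>" for s :: "nat \<times> (nat \<Rightarrow> nat)"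
      have \<theta>: "0 \<le> \<theta> s" "\<theta> s < 1" for s unfolding \<theta>_def by linarith+
      have ye: "real_of_int (yv s $ i) = \<xi> ^ (js ! i) * real (fst s) - \<theta> s + real (snd s i)" for s
        using i by (simp add: yv_def \<theta>_def)
      have e1: "real_of_int (yv s $ i) - real_of_int (yv s' $ i) =
          \<xi> ^ (js ! i) * (real (fst s) - real (fst s')) - (\<theta> s - \<theta> s') + (real (snd s i) - real (snd s' i))"
        unfolding ye by (simp add: algebra_simps)
      have e2: "real Q * real_of_int (w 0) = real (fst s) - real (fst s')"
        using arg_cong[OF w0, of real_of_int] by simp
      have e3: "real Q * real_of_int (w (js ! i)) = real_of_int (yv s $ i) - real_of_int (yv s' $ i)"
        using arg_cong[OF Qw[OF i(2)], of real_of_int] by simp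
      have "real Q * Dl w (js ! i) = \<xi> ^ (js ! i) * (real Q * real_of_int (w 0)) - real Q * real_of_int (w (js ! i))"
        by (simp add: Dl_def algebra_simps)
      also have "\<dots> = (\<theta> s - \<theta> s') - (real (snd s i) - real (snd s' i))" unfolding e2 e3 e1 by simp
      \<comment> \<open>The offsets differ by at most \<open>D' - 1\<close>, the fractional parts by
        less than 1.\<close>
      finally have "\<bar>real Q * Dl w (js ! i)\<bar> \<le> real D'" using \<theta>[of s] \<theta>[of s'] sD by linarith
      then have "real Q * \<bar>Dl w (js ! i)\<bar> \<le> real Q * \<delta>" using D'b(2) by (simp add: abs_mult)
      then show ?thesis using Q0 by simp
    qed
    have wn: "\<exists>k\<le>n. w k \<noteq> 0"
    proof (rule ccontr)
      assume "\<not> ?thesis"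
      then have yy: "yv s $ i = yv s' $ i" if "i < g" for i using Qw[OF that] jsn[OF that] by simp
      have f: "fst s = fst s'" using yy[OF g(2)] g(2) by (simp add: yv_def)
      have "snd s i = snd s' i" if "i \<in> {1..<g}" for i using yy[of i] that f by (simp add: yv_def)
      moreover have "snd s \<in> (\<Pi>\<^sub>E i\<in>{1..<g}. {0..<D'})" "snd s' \<in> (\<Pi>\<^sub>E i\<in>{1..<g}. {0..<D'})"
        using ss(1,2) unfolding S_def by (simp_all only: mem_Times_iff)
      ultimately have "snd s = snd s'" using PiE_ext[of "snd s" "{1..<g}" _ "snd s'"] by blast
      with f have "s = s'" by (intro prod_eqI)
      then show False using ss(3) by contradiction
    qed
    have X1q: "X1 \<le> H0 q"
    proof -
      have "\<epsilon> * H0 q \<le> 1 * H0 q" by (rule mult_right_mono) (simp_all add: \<epsilon>_def)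
      then show ?thesis by (simp add: X1_def)
    qed
    have "\<bar>real_of_int (w 0)\<bar> < real_of_int (int q)"
      using w0X X1q z_size[OF q(1)] by linarith
    then have "\<bar>w 0\<bar> \<le> int q" by linarith
    from z_min[OF q(1) wn this] have Lw: "L q \<le> lerr n \<xi> w" .
    have "lerr n \<xi> w < L q"
    proof (rule lerr_less[OF n1])
      fix a assume a: "1 \<le> a" "a \<le> n"
      have "real_of_int d * Dl w a = real_of_int (w 0) * \<kappa> a + (\<Sum>i\<in>{1..<g}. real_of_int (e a i) * Dl w (js ! i))"
        using rel[of a w] prw[OF Pa[OF a(2)]] by simp
      then have "\<bar>real_of_int d\<bar> * \<bar>Dl w a\<bar> \<le> \<bar>real_of_int (w 0)\<bar> * \<bar>\<kappa> a\<bar> + \<bar>\<Sum>i\<in>{1..<g}. real_of_int (e a i) * Dl w (js ! i)\<bar>"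
        by (metis abs_mult abs_triangle_ineq)
      also have "\<dots> \<le> \<epsilon> * (real g * (real_of_int \<bar>d\<bar> * L q)) + real (g - 1) * (real_of_int \<bar>d\<bar> * \<delta>)"
      proof (rule add_mono)
        have "\<bar>real_of_int (w 0)\<bar> * \<bar>\<kappa> a\<bar> \<le> X1 * \<bar>\<kappa> a\<bar>" using w0X by (intro mult_right_mono) auto
        also have "\<dots> = \<epsilon> * (H0 q * \<bar>\<kappa> a\<bar>)" by (simp add: X1_def)
        also have "\<dots> \<le> \<epsilon> * (real g * (real_of_int \<bar>d\<bar> * L q))" using \<kappa>b[OF a(2)] \<epsilon>0 by (intro mult_left_mono) auto
        finally show "\<bar>real_of_int (w 0)\<bar> * \<bar>\<kappa> a\<bar> \<le> \<epsilon> * (real g * (real_of_int \<bar>d\<bar> * L q))" .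
        show "\<bar>\<Sum>i\<in>{1..<g}. real_of_int (e a i) * Dl w (js ! i)\<bar> \<le> real (g - 1) * (real_of_int \<bar>d\<bar> * \<delta>)"
          by (rule sumb[OF a(2) Dw])
      qed
      also have "\<dots> \<le> real_of_int \<bar>d\<bar> * (2 * \<epsilon> * real g * L q)"
      proof -
        have "real (g - 1) * (real_of_int \<bar>d\<bar> * \<delta>) \<le> real g * (real_of_int \<bar>d\<bar> * \<delta>)"
          using \<delta>0 by (intro mult_right_mono) auto
        then show ?thesis by (simp add: \<delta>_def algebra_simps)
      qed
      finally have "\<bar>Dl w a\<bar> \<le> 2 * \<epsilon> * real g * L q" using d0 by simp
      also have "\<dots> < 1 * L q"
      proof (rule mult_strict_right_mono[OF _ L_pos[OF q(1)]])
        have "real g \<le> real n + 1" using gn by linarith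
        then show "2 * \<epsilon> * real g < 1" by (simp add: \<epsilon>_def field_simps)
      qed
      finally show "\<bar>real_of_int (w 0) * \<xi> ^ a - real_of_int (w a)\<bar> < L q" by (simp add: Dl_def)
    qed
    then show False using Lw by linarith
  qed
  also have "X1 * \<delta> ^ (g - 1) = \<epsilon> ^ g * (H0 q * L q ^ (g - 1))"
    using g(2) by (cases g) (simp_all add: X1_def \<delta>_def power_mult_distrib)
  finally have "\<epsilon> ^ g * (H0 q * L q ^ (g - 1)) \<le> 2 ^ g * real_of_int \<bar>d\<bar>" .
  then have "H0 q * L q ^ (g - 1) \<le> (2 / \<epsilon>) ^ g * real_of_int \<bar>d\<bar>"
    using \<epsilon>0 by (simp add: power_divide field_simps)
  also have "2 / \<epsilon> = real (8 * (n + 2))" by (simp add: \<epsilon>_def)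
  finally show ?thesis
    using that[of js] js(1,2) g by (simp add: d_def us_def g_def)
qed

end

section \<open>Chains of minimal points\<close>

lemma wins_0 [simp]: "wins 0 S = S"
  unfolding wins_def by auto

lemma W_top: "W n n S = annih n S"
  by (simp add: W_def)

lemma rk_empty: "rk n l {} = 0"
  by (simp add: rk_def W_def wins_def dm_annih_empty)

lemma rk_insert_le: "rk n n (insert x S) \<le> Suc (rk n n S)"
  using dm_annih_insert[of n S x] dm_W[of n n S] dm_W[of n n "insert x S"] by (simp add: W_top)

lemma rk_insert_new:
  assumes "P \<in> W n n S" "pr P x \<noteq> 0"
  shows "rk n n S < rk n n (insert x S)"
proof (rule ccontr)
  assume "\<not> ?thesis"
  then have "W n n S = W n n (insert x S)" by (intro W_eqI) auto
  then show False using assms by (simp add: W_top annih_def)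
qed

lemma rk_insert_newD:
  assumes "rk n n S < rk n n (insert x S)"
  obtains P where "P \<in> W n n S" "pr P x \<noteq> 0"
proof -
  have "W n n S \<noteq> W n n (insert x S)" using assms by (auto simp: rk_def)
  moreover have "W n n (insert x S) = {P \<in> W n n S. pr P x = 0}" by (auto simp: W_top annih_def)
  ultimately show ?thesis using that by blast
qed

lemma dm_zero: "dm {0} = 0"
  by (simp add: dm_def)

context approx
begin

lemma seg_Suc: "I \<le> Suc T \<Longrightarrow> seg I (Suc T) = insert (z (Suc T)) (seg I T)"
  by (simp add: atLeastAtMostSuc_conv)

lemma seg_mono: "p' \<le> p \<Longrightarrow> q \<le> q' \<Longrightarrow> seg p q \<subseteq> seg p' q'"
  by auto

lemma rk_single: "T \<ge> T0 \<Longrightarrow> rk n l {z T} \<ge> 1"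
proof (rule ccontr)
  assume T: "T \<ge> T0" and "\<not> rk n l {z T} \<ge> 1"
  then have "rk n l {z T} = 0" by simp
  then have "W n l {} = W n l {z T}" by (intro W_eqI) auto
  moreover have "[:1:] \<in> W n l {}" by (simp add: W_iff)
  ultimately have "[:1:] \<in> W n l {z T}" by simp
  then have "pr [:1:] (win (z T) 0) = 0" unfolding W_iff by auto
  then show False using z_nz[OF T] by (simp add: pr_def)
qed

text \<open>If the span of the points from \<open>I\<close> on stayed proper, one nonzero
  \<open>P\<close> would annihilate all of them. Since the errors tend to 0, \<open>P\<close> would
  vanish at \<open>\<xi>\<close>, against \<open>nonroot\<close>.\<close>

lemma full_eventually:
  assumes I: "I \<ge> T0"
  obtains q where "q \<ge> I" "W n n (seg I q) = {0}"
proof (rule ccontr)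
  assume neg: "\<not> thesis"
  have ne: "I \<le> q \<Longrightarrow> W n n (seg I q) \<noteq> {0}" for q using neg that by metis
  have "\<exists>q. q \<ge> I \<and> (\<forall>q'. q' \<ge> I \<longrightarrow> dm (W n n (seg I q)) \<le> dm (W n n (seg I q')))"
    using ex_has_least_nat[of "\<lambda>q. q \<ge> I" I "\<lambda>q. dm (W n n (seg I q))"] by simp
  then obtain q0 where q0: "q0 \<ge> I" "\<And>q. q \<ge> I \<Longrightarrow> dm (W n n (seg I q0)) \<le> dm (W n n (seg I q))"
    by metis
  have eq: "W n n (seg I q0) = W n n (seg I q)" if "q \<ge> q0" for q
    using that q0 dm_W[of n n "seg I q0"] dm_W[of n n "seg I q"]
    by (intro W_eqI seg_mono) (use q0(2)[of q] in linarith)+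
  obtain P where P: "P \<in> W n n (seg I q0)" "P \<noteq> 0" using ne[OF q0(1)] W_zero by blast
  define v where "v = \<bar>poly (map_poly real_of_int P) \<xi>\<bar>"
  have dP: "degree P \<le> n" using P(1) by (simp add: W_iff)
  have v0: "v > 0" unfolding v_def using nonroot[OF dP P(2)] by simp
  obtain H where H: "\<And>a. \<bar>real_of_int (coeff P a)\<bar> \<le> H"
  proof
    fix a
    show "\<bar>real_of_int (coeff P a)\<bar> \<le> (\<Sum>a\<le>degree P. \<bar>real_of_int (coeff P a)\<bar>)"
    proof (cases "a \<le> degree P")
      case True
      then show ?thesis by (intro member_le_sum) auto
    qed (simp add: coeff_eq_0 sum_nonneg)
  qed
  define C where "C = real (Suc n) * (2 * Y) * H"
  have bnd: "v \<le> C * real T powr (- lam)" if T: "T \<ge> q0" for T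
  proof -
    have T': "T \<ge> T0" using T q0(1) I by simp
    have "P \<in> W n n (seg I T)" using P(1) eq[OF T] by simp
    then have "pr P (z T) = 0" using T q0(1) by (auto simp: W_top annih_def)
    then have "H0 T * v \<le> C * L T"
      using pr_window[OF dP _ H, of 0 "z T"] by (simp add: v_def C_def abs_mult)
    moreover have "v \<le> H0 T * v" using H0_ge1[OF T'] v0 by simp
    moreover have "C * L T \<le> C * real T powr (- lam)"
    proof (rule mult_left_mono[OF z_err[OF T']])
      show "0 \<le> C" unfolding C_def using H[of 0] Y_ge1 by (intro mult_nonneg_nonneg) auto
    qed
    ultimately show ?thesis by linarith
  qed
  have "((\<lambda>T. C * real T powr (- lam)) \<longlongrightarrow> C * 0) at_top"
    using lam by (intro tendsto_mult tendsto_const tendsto_neg_powr filterlim_real_sequentially) simp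
  then have "eventually (\<lambda>T. C * real T powr (- lam) < v) at_top"
    using v0 by (intro order_tendstoD(2)) auto
  then obtain T1 where "\<And>T. T \<ge> T1 \<Longrightarrow> C * real T powr (- lam) < v" by (auto simp: eventually_at_top_linorder)
  from this[of "max T1 q0"] bnd[of "max T1 q0"] show False by simp
qed

text \<open>The index \<open>I - 1\<close> is always in the set, with rank \<open>0\<close>, so that \<open>Zr I 0 = I - 1\<close>.\<close>

definition Zr :: "nat \<Rightarrow> nat \<Rightarrow> nat" where
  "Zr I r = Max {T. I - 1 \<le> T \<and> rk n n (seg I T) \<le> r}"

lemma Zr_props:
  assumes I: "I \<ge> T0" and r: "r \<le> n"
  shows Zr_ge: "I - 1 \<le> Zr I r"
    and Zr_rk_le: "rk n n (seg I (Zr I r)) \<le> r"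
    and Zr_max: "\<And>T. I - 1 \<le> T \<Longrightarrow> rk n n (seg I T) \<le> r \<Longrightarrow> T \<le> Zr I r"
proof -
  let ?A = "{T. I - 1 \<le> T \<and> rk n n (seg I T) \<le> r}"
  obtain q where q: "q \<ge> I" "W n n (seg I q) = {0}" using full_eventually[OF I] by blast
  have "T \<le> q" if "T \<in> ?A" for T
  proof (rule ccontr)
    assume "\<not> T \<le> q"
    then have "rk n n (seg I q) \<le> rk n n (seg I T)" by (intro rk_mono seg_mono) auto
    moreover have "rk n n (seg I q) = Suc n" using q(2) by (simp add: rk_def dm_zero)
    ultimately show False using that r by simp
  qed
  then have fin: "finite ?A" by (intro finite_subset[of ?A "{..q}"]) auto
  have "{I..I - 1} = {}" using I T0 by auto
  then have "rk n n (seg I (I - 1)) = 0" by (simp only: image_empty rk_empty)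
  then have ne: "I - 1 \<in> ?A" by simp
  have "Zr I r \<in> ?A" unfolding Zr_def using fin ne by (intro Max_in) auto
  then show "I - 1 \<le> Zr I r" "rk n n (seg I (Zr I r)) \<le> r" by auto
  show "\<And>T. I - 1 \<le> T \<Longrightarrow> rk n n (seg I T) \<le> r \<Longrightarrow> T \<le> Zr I r"
    unfolding Zr_def using fin by (intro Max_ge) auto
qed

lemma Zr_0:
  assumes I: "I \<ge> T0"
  shows "Zr I 0 = I - 1"
proof (rule ccontr)
  assume "Zr I 0 \<noteq> I - 1"
  then have "I \<le> Zr I 0" using Zr_ge[OF I, of 0] by linarith
  then have "rk n n {z I} \<le> rk n n (seg I (Zr I 0))" by (intro rk_mono) auto
  then show False using rk_single[OF I, of n] Zr_rk_le[OF I, of 0] by simp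
qed

lemma Zr_Suc_rk:
  assumes I: "I \<ge> T0" and r: "r \<le> n"
  shows "rk n n (seg I (Zr I r)) = r" "rk n n (seg I (Suc (Zr I r))) = Suc r"
    "seg I (Suc (Zr I r)) = insert (z (Suc (Zr I r))) (seg I (Zr I r))"
proof -
  have ge: "I - 1 \<le> Zr I r" using Zr_ge[OF I r] .
  then show s: "seg I (Suc (Zr I r)) = insert (z (Suc (Zr I r))) (seg I (Zr I r))"
    by (intro seg_Suc) simp
  have "\<not> rk n n (seg I (Suc (Zr I r))) \<le> r" using Zr_max[OF I r, of "Suc (Zr I r)"] ge by auto
  moreover have "rk n n (seg I (Suc (Zr I r))) \<le> Suc (rk n n (seg I (Zr I r)))"
    unfolding s by (rule rk_insert_le)
  ultimately show "rk n n (seg I (Zr I r)) = r" "rk n n (seg I (Suc (Zr I r))) = Suc r"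
    using Zr_rk_le[OF I r] by linarith+
qed

lemma Zr_strict:
  assumes I: "I \<ge> T0" and r: "r < r'" "r' \<le> n"
  shows "Zr I r < Zr I r'"
proof -
  have "rk n n (seg I (Suc (Zr I r))) \<le> r'" using Zr_Suc_rk(2)[OF I, of r] r by simp
  then have "Suc (Zr I r) \<le> Zr I r'" using Zr_max[OF I r(2), of "Suc (Zr I r)"] Zr_ge[OF I, of r] r by simp
  then show ?thesis by simp
qed

lemma Zr_mono: "I \<ge> T0 \<Longrightarrow> r \<le> r' \<Longrightarrow> r' \<le> n \<Longrightarrow> Zr I r \<le> Zr I r'"
  using Zr_strict[of I r r'] by (cases "r = r'") auto

lemma Zr_ge_I: "I \<ge> T0 \<Longrightarrow> 1 \<le> r \<Longrightarrow> r \<le> n \<Longrightarrow> I \<le> Zr I r"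
  using Zr_strict[of I 0 r] Zr_0[of I] by simp

lemma rk_step:
  assumes I: "I \<ge> T0" and u: "u \<le> n" and J: "I \<le> J" "J \<le> Suc (Zr I u)"
  shows "rk n n (seg J (Zr I u)) < rk n n (seg J (Suc (Zr I u)))"
proof -
  obtain P where P: "P \<in> W n n (seg I (Zr I u))" "pr P (z (Suc (Zr I u))) \<noteq> 0"
    using Zr_Suc_rk[OF I u] rk_insert_newD[of n "seg I (Zr I u)" "z (Suc (Zr I u))"] by auto
  have "P \<in> W n n (seg J (Zr I u))" using P(1) W_anti[OF seg_mono[OF J(1) order_refl]] by blast
  from rk_insert_new[OF this P(2)] show ?thesis unfolding seg_Suc[OF J(2)] .
qed

text \<open>The point with index \<open>Zr I t\<close> contributes 1. Each of those with index
  \<open>Suc (Zr I t)\<close>, ..., \<open>Suc (Zr I u)\<close> is independent even of all points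
  from \<open>I\<close> up to its predecessor, so it adds 1 more.\<close>

lemma chain_rk:
  assumes I: "I \<ge> T0" and t: "1 \<le> t" "t \<le> u" and u: "u \<le> n"
  shows "u - t + 2 \<le> rk n n (seg (Zr I t) (Suc (Zr I u)))"
  using t(2) u
proof (induction u rule: dec_induct)
  case base
  have J: "I \<le> Zr I t" using Zr_ge_I[OF I t(1)] base by simp
  then have "1 \<le> rk n n {z (Zr I t)}" using I by (intro rk_single) simp
  then show ?case using rk_step[OF I base J] by simp
next
  case (step u)
  have J: "I \<le> Zr I t" using Zr_ge_I[OF I t(1)] step t by simp
  have "Suc (Zr I u) \<le> Zr I (Suc u)" using Zr_strict[OF I, of u "Suc u"] step by simp
  then have "rk n n (seg (Zr I t) (Suc (Zr I u))) \<le> rk n n (seg (Zr I t) (Zr I (Suc u)))"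
    by (intro rk_mono seg_mono) auto
  moreover have "rk n n (seg (Zr I t) (Zr I (Suc u))) < rk n n (seg (Zr I t) (Suc (Zr I (Suc u))))"
  proof (rule rk_step[OF I _ J])
    show "Zr I t \<le> Suc (Zr I (Suc u))" using Zr_mono[OF I, of t "Suc u"] step by simp
  qed (use step in simp)
  ultimately show ?case using step by simp
qed

text \<open>Generically the last point supplies \<open>k + 1\<close> windows and each further
  dimension one more, from index \<open>Zr I (k + s - v)\<close> or later. About the remaining basis
  members only the index bound \<open>I\<close> is known.\<close>

definition Lb :: "nat \<Rightarrow> nat \<Rightarrow> nat \<Rightarrow> nat \<Rightarrow> real" where
  "Lb I k s v = (if v \<le> k then L (Suc (Zr I (s - 1))) else if v < k + s then L (Zr I (k + s - v)) else L I)"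

text \<open>The basis is chosen greedily from the top of the segment downwards, so that its \<open>v\<close>-th
  member is as good an approximation as the ranks of the final segments permit.\<close>

lemma basis_product:
  assumes I: "I \<ge> T0" and s: "1 \<le> s" "s \<le> n" and k: "k \<le> n"
    and low: "\<And>a. I \<le> a \<Longrightarrow> a \<le> Suc (Zr I (s - 1)) \<Longrightarrow>
       min (rk n (n - k) (seg I (Suc (Zr I (s - 1))))) (k + rk n n (seg a (Suc (Zr I (s - 1)))))
         \<le> rk n (n - k) (seg a (Suc (Zr I (s - 1))))"
  obtains ts where "indep (n - k) (map vec_of ts)"
    "annih (n - k) (vec_of ` set ts) = W n (n - k) (seg I (Suc (Zr I (s - 1))))"
    "length ts = rk n (n - k) (seg I (Suc (Zr I (s - 1))))" "length ts > 0"
    "fst (ts ! 0) = Suc (Zr I (s - 1))"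
    "\<And>T b. (T, b) \<in> set ts \<Longrightarrow> I \<le> T \<and> T \<le> Suc (Zr I (s - 1)) \<and> b \<le> k"
    "(\<Prod>v=1..<length ts. L (fst (ts ! v))) \<le> (\<Prod>v=1..<length ts. Lb I k s v)"
proof -
  define p where "p = Suc (Zr I (s - 1))"
  have Ip: "I \<le> p" using Zr_ge[OF I, of "s - 1"] s unfolding p_def by linarith
  have sn: "s - 1 \<le> n" using s by simp
  obtain ts where ts: "indep (n - k) (map vec_of ts)" "annih (n - k) (vec_of ` set ts) = W n (n - k) (seg I p)"
    "set ts \<subseteq> {I..p} \<times> {..n - (n - k)}" "length ts = rk n (n - k) (seg I p)"
    "\<And>T v. T \<in> {I..p} \<Longrightarrow> v < rk n (n - k) (seg T p) \<Longrightarrow> T \<le> fst (ts ! v)"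
    using tagged_basis[OF Ip, of "n - k" n z] by auto
  let ?g = "length ts"
  have mem: "I \<le> T \<and> T \<le> p \<and> b \<le> k" if "(T, b) \<in> set ts" for T b
    using ts(3) that k by auto
  have p1: "rk n (n - k) (seg p p) \<ge> 1" "rk n n (seg p p) \<ge> 1"
    using rk_single[of p] I Ip by simp_all
  have g0: "?g > 0"
  proof -
    have "rk n (n - k) (seg p p) \<le> ?g" unfolding ts(4) using Ip by (intro rk_mono seg_mono) auto
    then show ?thesis using p1 by linarith
  qed
  have le_p: "fst (ts ! v) \<le> p" "I \<le> fst (ts ! v)" if "v < ?g" for v
    using mem[of "fst (ts ! v)" "snd (ts ! v)"] nth_mem[OF that] by simp_all
  have "p \<le> fst (ts ! 0)" using ts(5)[of p 0] p1 Ip by simp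
  then have top: "fst (ts ! 0) = p" using le_p[OF g0] by simp
  have Lle: "L (fst (ts ! v)) \<le> Lb I k s v" if v: "v < ?g" for v
  proof -
    consider "v \<le> k" | "k < v" "v < k + s" | "k + s \<le> v" "k < v" by linarith
    then show ?thesis
    proof cases
      case 1
      have "min ?g (k + rk n n (seg p p)) \<le> rk n (n - k) (seg p p)"
        using low[of p] Ip by (simp add: ts(4) p_def)
      then have "v < rk n (n - k) (seg p p)" using 1 v p1 by linarith
      then have "p \<le> fst (ts ! v)" using ts(5)[of p v] Ip by simp
      then have "fst (ts ! v) = p" using le_p[OF v] by simp
      then show ?thesis using 1 by (simp add: Lb_def p_def)
    next
      case 2
      define t where "t = k + s - v"
      have t: "1 \<le> t" "t \<le> s - 1" using 2 by (auto simp: t_def)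
      have Zt: "I \<le> Zr I t" "Zr I t \<le> p"
        using Zr_ge_I[OF I t(1)] Zr_mono[OF I t(2) sn] t sn by (auto simp: p_def)
      have "min ?g (k + rk n n (seg (Zr I t) p)) \<le> rk n (n - k) (seg (Zr I t) p)"
        using low[of "Zr I t"] Zt by (simp add: ts(4) p_def)
      moreover have "s - 1 - t + 2 \<le> rk n n (seg (Zr I t) p)"
        using chain_rk[OF I t sn] by (simp add: p_def)
      moreover have "Suc v = k + (s - 1 - t + 2)" using 2 by (simp add: t_def)
      ultimately have "v < rk n (n - k) (seg (Zr I t) p)" using v by linarith
      then have "Zr I t \<le> fst (ts ! v)" using ts(5)[of "Zr I t" v] Zt by simp
      then have "L (fst (ts ! v)) \<le> L (Zr I t)" using Zt I by (intro L_antimono) auto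
      then show ?thesis using 2 by (simp add: Lb_def t_def)
    next
      case 3
      have "L (fst (ts ! v)) \<le> L I" using le_p[OF v] I by (intro L_antimono) auto
      then show ?thesis using 3 by (simp add: Lb_def)
    qed
  qed
  have prd: "(\<Prod>v=1..<?g. L (fst (ts ! v))) \<le> (\<Prod>v=1..<?g. Lb I k s v)"
    using Lle L_nonneg by (intro prod_mono) auto
  show ?thesis
    using that[of ts] ts(1,2,4) g0 top mem prd unfolding p_def[symmetric] by blast
qed

definition Gc :: real where "Gc = real (8 * (n + 2)) ^ Suc n * Mc"

text \<open>\<open>Suc (Zr I (r - 1))\<close> is the first and \<open>Zr I r\<close> the last index
  at which the run spans exactly \<open>r\<close> dimensions, so both segments have the same
  annihilator. A basis from the shorter one bounds the covolume that \<open>minkowski_core\<close>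
  compares with the last point.\<close>

lemma growth_raw:
  assumes I: "I \<ge> T0" and r: "1 \<le> r" "r \<le> n"
  shows "H0 (Zr I r) * L (Zr I r) ^ (r - 1) \<le> Gc * (H0 (Suc (Zr I (r - 1))) * (\<Prod>t=1..<r. L (Zr I t)))"
proof -
  let ?p = "Suc (Zr I (r - 1))" and ?q = "Zr I r"
  show ?thesis
  proof (rule basis_product[OF I r, of 0])
    fix ts
    assume ts: "indep (n - 0) (map vec_of ts)"
      "annih (n - 0) (vec_of ` set ts) = W n (n - 0) (seg I ?p)"
      "length ts = rk n (n - 0) (seg I ?p)" "length ts > 0"
      "fst (ts ! 0) = ?p"
      "\<And>T b. (T, b) \<in> set ts \<Longrightarrow> I \<le> T \<and> T \<le> ?p \<and> b \<le> 0"
      "(\<Prod>v=1..<length ts. L (fst (ts ! v))) \<le> (\<Prod>v=1..<length ts. Lb I 0 r v)"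
    have len: "length ts = r" using ts(3) Zr_Suc_rk(2)[OF I, of "r - 1"] r by simp
    have pq: "?p \<le> ?q" using Zr_strict[OF I, of "r - 1" r] r by simp
    have Iq: "I \<le> ?q" using Zr_ge_I[OF I r] .
    have W: "W n n (seg I ?p) = W n n (seg I ?q)"
      using ts(3) len Zr_rk_le[OF I r(2)] pq by (intro W_eqI seg_mono) auto
    have kill: "pr P (z ?q) = 0" if "P \<in> annih n (vec_of ` set ts)" for P
    proof -
      have "P \<in> W n n (seg I ?q)" using that ts(2) W by simp
      then show ?thesis using Iq by (auto simp: W_top annih_def)
    qed
    have qT: "?q \<ge> T0" using Iq I by simp
    have tag: "T0 \<le> T \<and> b = 0" if "(T, b) \<in> set ts" for T b using ts(6)[OF that] I by simp
    have tag': "T0 \<le> T \<and> T \<le> fst (ts ! 0) \<and> b \<le> n - n" if "(T, b) \<in> set ts" for T b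
      using ts(6)[OF that] I ts(5) by simp
    have ind: "indep n (map vec_of ts)" using ts(1) by simp
    obtain js where js: "length js = length ts" "set js \<subseteq> {..n}"
      "H0 ?q * L ?q ^ (length ts - 1) \<le> real (8 * (n + 2)) ^ length ts *
         real_of_int \<bar>Determinant.det (minor_mat (map vec_of ts) js)\<bar>"
      by (rule minkowski_core[OF ind ts(4) _ qT]) (erule tag, erule kill, rule that, assumption+)
    let ?PL = "\<Prod>v=1..<length ts. L (fst (ts ! v))"
    have lenn: "length ts \<le> Suc n" using len r by simp
    have mb: "real_of_int \<bar>Determinant.det (minor_mat (map vec_of ts) js)\<bar> \<le> Mc * (H0 (fst (ts ! 0)) * ?PL)"
      by (rule minor_bound[OF js(1) ts(4) lenn js(2) order_refl tag'])
    have "H0 ?q * L ?q ^ (r - 1) \<le> real (8 * (n + 2)) ^ r *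
         real_of_int \<bar>Determinant.det (minor_mat (map vec_of ts) js)\<bar>"
      using js(3) unfolding len .
    also have "\<dots> \<le> real (8 * (n + 2)) ^ r * (Mc * (H0 ?p * ?PL))"
      using mb unfolding ts(5) by (intro mult_left_mono zero_le_power of_nat_0_le_iff)
    also have "\<dots> \<le> real (8 * (n + 2)) ^ Suc n * (Mc * (H0 ?p * ?PL))"
      using r Mc_pos L_nonneg by (intro mult_right_mono power_increasing) (auto intro!: mult_nonneg_nonneg prod_nonneg)
    also have "\<dots> \<le> real (8 * (n + 2)) ^ Suc n * (Mc * (H0 ?p * (\<Prod>v=1..<r. Lb I 0 r v)))"
      using ts(7) len Mc_pos by (intro mult_left_mono) auto
    also have "(\<Prod>v=1..<r. Lb I 0 r v) = (\<Prod>t=1..<r. L (Zr I t))"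
      by (rule prod.reindex_bij_witness[of _ "\<lambda>t. r - t" "\<lambda>v. r - v"]) (auto simp: Lb_def)
    finally show ?thesis by (simp add: Gc_def mult.assoc)
  qed simp_all
qed

lemma Gc_pos: "Gc > 0"
  unfolding Gc_def using Mc_pos by simp

end

section \<open>Special segments\<close>

lemma dm_annih_card: "finite F \<Longrightarrow> Suc l \<le> dm (annih l F) + card F"
proof (induction F rule: finite_induct)
  case (insert u F)
  then show ?case using dm_annih_insert[of l F u] by simp
qed (simp add: dm_annih_empty)

lemma rk_single_le: "rk n l {x} \<le> Suc (n - l)"
proof -
  have w: "wins (n - l) {x} = (\<lambda>b. win x b) ` {..n - l}" unfolding wins_def by auto
  have "card (wins (n - l) {x}) \<le> Suc (n - l)"
    unfolding w using card_image_le[of "{..n - l}" "\<lambda>b. win x b"] by simp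
  then show ?thesis
    using dm_annih_card[of "wins (n - l) {x}" l] unfolding rk_def W_def w by simp
qed

lemma W_kills: "P \<in> W n l S \<Longrightarrow> x \<in> S \<Longrightarrow> pr P x = 0"
  unfolding W_iff using win_0 by (metis le0)

lemma W_nontrivial_iff: "W n l S \<noteq> {0} \<longleftrightarrow> rk n l S \<le> l"
proof
  assume "W n l S \<noteq> {0}"
  then have "dm (W n l S) > 0" by (rule dm_pos[OF saturated_W])
  then show "rk n l S \<le> l" using dm_W[of n l S] by linarith
next
  assume "rk n l S \<le> l"
  then have "dm (W n l S) \<noteq> 0" using dm_W[of n l S] by linarith
  then show "W n l S \<noteq> {0}" using dm_zero by metis
qed

context approx
begin

definition Dc :: int where
  "Dc = (SOME C. C > 0 \<and> (\<forall>G P H a. G dvd P \<longrightarrow> P \<noteq> 0 \<longrightarrow> degree P \<le> n \<longrightarrow>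
     (\<forall>a. \<bar>coeff P a\<bar> \<le> H) \<longrightarrow> \<bar>coeff G a\<bar> \<le> C * H))"

lemma Dc_pos: "Dc > 0"
  and Dc_bound: "\<And>G P H a. G dvd P \<Longrightarrow> P \<noteq> 0 \<Longrightarrow> degree P \<le> n \<Longrightarrow>
     (\<And>a. \<bar>coeff P a\<bar> \<le> H) \<Longrightarrow> \<bar>coeff G a\<bar> \<le> Dc * H"
proof -
  have ex: "\<exists>C::int. C > 0 \<and> (\<forall>G P H a. G dvd P \<longrightarrow> P \<noteq> 0 \<longrightarrow> degree P \<le> n \<longrightarrow>
     (\<forall>a. \<bar>coeff P a\<bar> \<le> H) \<longrightarrow> \<bar>coeff G a\<bar> \<le> C * H)"
  proof (rule dvd_coeff_bound[of n])
    fix C :: int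
    assume C: "C > 0" "\<And>G P H a. G dvd P \<Longrightarrow> P \<noteq> 0 \<Longrightarrow> degree P \<le> n \<Longrightarrow>
      (\<And>a. \<bar>coeff P a\<bar> \<le> H) \<Longrightarrow> \<bar>coeff G a\<bar> \<le> C * H"
    show ?thesis
    proof (intro exI[of _ C] conjI allI impI C(1))
      fix G P :: "int poly" and H a
      assume "G dvd P" "P \<noteq> 0" "degree P \<le> n" "\<forall>a. \<bar>coeff P a\<bar> \<le> H"
      then show "\<bar>coeff G a\<bar> \<le> C * H" by (intro C(2)) blast+
    qed
  qed
  note * = someI_ex[OF ex, folded Dc_def]
  from * show "Dc > 0" by (rule conjunct1)
  fix G P :: "int poly" and H a
  assume "G dvd P" "P \<noteq> 0" "degree P \<le> n" "\<And>a. \<bar>coeff P a\<bar> \<le> H"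
  then show "\<bar>coeff G a\<bar> \<le> Dc * H" using conjunct2[OF *] by metis
qed

definition Vc :: real where "Vc = Nc * real_of_int Dc"

lemma Vc_ge: "Nc \<le> Vc" and Vc_pos: "Vc > 0"
proof -
  have "1 \<le> real_of_int Dc" using Dc_pos by linarith
  then show "Nc \<le> Vc" unfolding Vc_def using Nc_pos mult_left_mono[of 1 "real_of_int Dc" Nc] by simp
  then show "Vc > 0" using Nc_pos by linarith
qed

text \<open>In a good segment, subsegments have windows of the rank expected in general position, capped at the
  rank \<open>g\<close> of the whole segment, and annihilators of the segment satisfy a lower bound since they do not
  annihilate the preceding point.\<close>

definition good :: "nat \<Rightarrow> nat \<Rightarrow> nat \<Rightarrow> nat \<Rightarrow> bool" where
  "good k I q g \<longleftrightarrow> T0 \<le> I - 1 \<and> I \<le> q \<and> rk n (n - k) (seg I q) = g \<and> g \<le> n - k \<and>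
     (\<forall>a b. I \<le> a \<longrightarrow> a \<le> b \<longrightarrow> b \<le> q \<longrightarrow> min g (k + rk n n (seg a b)) \<le> rk n (n - k) (seg a b)) \<and>
     (\<forall>P H. P \<in> W n (n - k) (seg I q) \<longrightarrow> P \<noteq> 0 \<longrightarrow> (\<forall>a. \<bar>coeff P a\<bar> \<le> int H) \<longrightarrow> 1 \<le> Vc * real H * L (I - 1))"

text \<open>By \<open>deficient_gen\<close> this includes every segment whose windows have less than
  the generic rank and a nonzero annihilator.\<close>

definition special :: "nat \<Rightarrow> nat \<Rightarrow> nat \<Rightarrow> bool" where
  "special k p q \<longleftrightarrow> (\<exists>G. gen n (n - k) (seg p q) G)"

lemma not_in_W_start:
  assumes "P \<in> W n l (seg I q)" "P \<notin> W n l (seg (I - 1) q)" "1 \<le> I" "I \<le> q"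
  obtains b where "b \<le> n - l" "pr P (win (z (I - 1)) b) \<noteq> 0"
proof -
  have "seg (I - 1) q = insert (z (I - 1)) (seg I q)"
    using assms(3,4) atLeastAtMost_insertL[of "I - 1" q] by (simp flip: image_insert)
  then show ?thesis using assms(1,2) that unfolding W_iff by auto
qed

text \<open>The generator \<open>G\<close> is pushed downwards: \<open>I\<close> is the least start
  from which it annihilates everything up to \<open>q\<close>. Since \<open>G\<close> lives at level
  \<open>g\<close>, no rank inside exceeds \<open>g\<close>, and a non-generic rank below
  \<open>g\<close> would produce a special segment of too small rank.\<close>

lemma good_of_special:
  assumes k: "k \<le> n" and Tb: "T0 \<le> Tb"
    "\<And>p q. Tb \<le> p \<Longrightarrow> p \<le> q \<Longrightarrow> special k p q \<Longrightarrow> g \<le> rk n (n - k) (seg p q)"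
    and T: "Tb \<le> T1" "W n n (seg T1 T2) = {0}" "T2 \<le> p" "T1 \<le> p"
    and pq: "p \<le> q" "special k p q" "rk n (n - k) (seg p q) = g"
  obtains I G where "T1 < I" "good k I q g" "G \<in> W n g (seg I q)" "G \<notin> W n g (seg (I - 1) q)"
proof -
  obtain G where "gen n (n - k) (seg p q) G" using pq(2) by (auto simp: special_def)
  then have G: "G \<noteq> 0" "g \<le> n - k" "G \<in> W n g (seg p q)" "\<And>P. P \<in> W n (n - k) (seg p q) \<Longrightarrow> G dvd P"
    using pq(3) by (auto simp: gen_def)
  define A where "A = {I. T1 \<le> I \<and> I \<le> p \<and> G \<in> W n g (seg I q)}"
  define I where "I = Min A"
  have fin: "finite A" unfolding A_def by (rule finite_subset[of _ "{..p}"]) auto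
  have pA: "p \<in> A" unfolding A_def using G(3) T(4) by simp
  have IA: "I \<in> A" unfolding I_def using fin pA by (intro Min_in) auto
  then have I: "T1 \<le> I" "I \<le> p" "G \<in> W n g (seg I q)" by (auto simp: A_def)
  \<comment> \<open>Starting at \<open>T1\<close>, the segment would contain the one up to
    \<open>T2\<close>, which has no nonzero annihilator.\<close>
  have "I \<noteq> T1"
  proof
    assume "I = T1"
    moreover have "W n g (seg T1 q) \<subseteq> W n g (seg T1 T2)" using T(3) pq(1) by (intro W_anti seg_mono) auto
    ultimately have "G \<in> W n g (seg T1 T2)" using I(3) by auto
    moreover have "W n g (seg T1 T2) \<subseteq> W n n (seg T1 T2)" using G(2) by (intro W_level) simp
    ultimately show False using T(2) G(1) by auto
  qed
  then have IT: "T1 < I" using I(1) by simp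
  have "I - 1 \<notin> A"
  proof
    assume "I - 1 \<in> A"
    then have "I \<le> I - 1" unfolding I_def using fin by (intro Min_le) auto
    then show False using IT by simp
  qed
  then have nin: "G \<notin> W n g (seg (I - 1) q)" using IT I(2) by (simp add: A_def)
  have Iq: "I \<le> q" using I(2) pq(1) by simp
  obtain b where b: "b \<le> n - g" "pr G (win (z (I - 1)) b) \<noteq> 0"
    using not_in_W_start[OF I(3) nin _ Iq] IT by auto
  have sub: "rk n (n - k) (seg a b) \<le> g" if "I \<le> a" "b \<le> q" for a b
  proof (rule rk_le_of_killed[OF _ G(1,2)])
    show "G \<in> W n g (seg a b)" using I(3) W_anti[OF seg_mono[OF that]] by blast
  qed simp
  have rkI: "rk n (n - k) (seg I q) = g"
  proof (rule antisym)
    show "g \<le> rk n (n - k) (seg I q)" unfolding pq(3)[symmetric] using I(2) by (intro rk_mono seg_mono) auto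
  qed (rule sub, auto)
  have "good k I q g"
    unfolding good_def
  proof (intro conjI allI impI)
    show "T0 \<le> I - 1" using IT T(1) Tb(1) by simp
    show "I \<le> q" "rk n (n - k) (seg I q) = g" "g \<le> n - k" by fact+
    fix a b assume ab: "I \<le> a" "a \<le> b" "b \<le> q"
    show "min g (k + rk n n (seg a b)) \<le> rk n (n - k) (seg a b)"
    proof (rule ccontr)
      assume "\<not> ?thesis"
      then have lt: "rk n (n - k) (seg a b) < g" "rk n (n - k) (seg a b) < k + rk n n (seg a b)" by auto
      have "W n (n - k) (seg a b) \<noteq> {0}" using lt(1) G(2) by (simp add: W_nontrivial_iff)
      then obtain G' where "gen n (n - k) (seg a b) G'"
        using deficient_gen[of "n - k" n "seg a b"] lt(2) k by auto
      then have "special k a b" by (auto simp: special_def)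
      then show False using Tb(2)[of a b] ab lt(1) IT T(1) by simp
    qed
  next
    \<comment> \<open>Nonvanishing before the segment is known for \<open>G\<close> only; the height
      of its multiple \<open>P\<close> controls that of \<open>G\<close> by
      \<open>Dc_bound\<close>.\<close>
    fix P H assume P: "P \<in> W n (n - k) (seg I q)" "P \<noteq> 0" "\<forall>a. \<bar>coeff P a\<bar> \<le> int H"
    have "P \<in> W n (n - k) (seg p q)" using P(1) W_anti[OF seg_mono[OF I(2) order_refl]] by blast
    then have "G dvd P" by (rule G(4))
    moreover have "degree P \<le> n" using P(1) unfolding W_iff by (meson diff_le_self le_trans)
    ultimately have GH: "\<bar>coeff G a\<bar> \<le> Dc * int H" for a using Dc_bound P(2,3) by blast
    have GH': "\<bar>real_of_int (coeff G a)\<bar> \<le> real_of_int Dc * real H" for a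
    proof -
      have "real_of_int \<bar>coeff G a\<bar> \<le> real_of_int (Dc * int H)" using GH[of a] by (simp only: of_int_le_iff)
      then show ?thesis by simp
    qed
    have "pr G (z I) = 0" using W_kills[OF I(3)] Iq by simp
    then have "1 \<le> Nc * (real_of_int Dc * real H) * L (I - 1)"
      using nonvanishing[OF _ _ GH', of g b I] b I(3) G(2) IT T(1) Tb(1) by (auto simp: W_iff)
    then show "1 \<le> Vc * real H * L (I - 1)" by (simp add: Vc_def mult.assoc)
  qed
  then show ?thesis by (rule that[OF IT _ I(3) nin])
qed

text \<open>Without late special segments, ranks are generic as long as there is an annihilator. So
  \<open>I\<close> is the least start with a nonzero annihilator up to \<open>T2\<close>, and none
  survives the step to \<open>I - 1\<close>. The condition \<open>2 * k < n\<close> makes the single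
  point \<open>T2\<close> a candidate.\<close>

lemma good_of_no_special:
  assumes k: "2 * k < n" and Tb: "T0 \<le> Tb" "\<And>p q. Tb \<le> p \<Longrightarrow> p \<le> q \<Longrightarrow> \<not> special k p q"
    and T1: "Tb \<le> T1"
  obtains I q g where "T1 < I" "good k I q g"
proof -
  obtain T2 where T2: "T2 \<ge> T1" "W n n (seg T1 T2) = {0}" by (rule full_eventually[OF order_trans[OF Tb(1) T1]])
  define A where "A = {I. T1 \<le> I \<and> I \<le> T2 \<and> W n (n - k) (seg I T2) \<noteq> {0}}"
  define I where "I = Min A"
  have fin: "finite A" unfolding A_def by (rule finite_subset[of _ "{..T2}"]) auto
  have "rk n (n - k) (seg T2 T2) \<le> n - k" using rk_single_le[of n "n - k" "z T2"] k by simp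
  then have T2A: "T2 \<in> A" unfolding A_def using T2(1) by (simp add: W_nontrivial_iff)
  have "I \<in> A" unfolding I_def using fin T2A by (intro Min_in) auto
  then have I: "T1 \<le> I" "I \<le> T2" "W n (n - k) (seg I T2) \<noteq> {0}" by (auto simp: A_def)
  have "I \<noteq> T1"
  proof
    assume "I = T1"
    have "W n (n - k) (seg T1 T2) \<subseteq> W n n (seg T1 T2)" by (intro W_level) simp
    then show False using I(3) T2(2) \<open>I = T1\<close> W_zero[of n "n - k" "seg T1 T2"] by auto
  qed
  then have IT: "T1 < I" using I(1) by simp
  have "I - 1 \<notin> A"
  proof
    assume "I - 1 \<in> A"
    then have "I \<le> I - 1" unfolding I_def using fin by (intro Min_le) auto
    then show False using IT by simp
  qed
  then have triv: "W n (n - k) (seg (I - 1) T2) = {0}" using IT I(2) by (simp add: A_def)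
  have "good k I T2 (rk n (n - k) (seg I T2))"
    unfolding good_def
  proof (intro conjI allI impI)
    show "T0 \<le> I - 1" using IT T1 Tb(1) by simp
    show "I \<le> T2" by fact
    show le: "rk n (n - k) (seg I T2) \<le> n - k" using I(3) by (simp add: W_nontrivial_iff)
    fix a b assume ab: "I \<le> a" "a \<le> b" "b \<le> T2"
    show "min (rk n (n - k) (seg I T2)) (k + rk n n (seg a b)) \<le> rk n (n - k) (seg a b)"
    proof (rule ccontr)
      assume "\<not> ?thesis"
      then have lt: "rk n (n - k) (seg a b) < rk n (n - k) (seg I T2)" "rk n (n - k) (seg a b) < k + rk n n (seg a b)" by auto
      have "W n (n - k) (seg a b) \<noteq> {0}" using lt(1) le by (simp add: W_nontrivial_iff)
      then obtain G' where "gen n (n - k) (seg a b) G'"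
        using deficient_gen[of "n - k" n "seg a b"] lt(2) k by auto
      then have "special k a b" by (auto simp: special_def)
      then show False using Tb(2)[of a b] ab IT T1 by simp
    qed
  next
    fix P H assume P: "P \<in> W n (n - k) (seg I T2)" "P \<noteq> 0" "\<forall>a. \<bar>coeff P a\<bar> \<le> int H"
    have "P \<notin> W n (n - k) (seg (I - 1) T2)" using P(2) triv by simp
    then obtain b where b: "b \<le> n - (n - k)" "pr P (win (z (I - 1)) b) \<noteq> 0"
      using not_in_W_start[OF P(1) _ _ I(2)] IT by auto
    have PH: "\<bar>real_of_int (coeff P a)\<bar> \<le> real H" for a
      using P(3)[rule_format, of a] by linarith
    have "pr P (z I) = 0" using W_kills[OF P(1)] I(2) by simp
    then have "1 \<le> Nc * real H * L (I - 1)"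
      using nonvanishing[OF _ _ PH, of "n - k" b I] b P(1) IT T1 Tb(1) k by (auto simp: W_iff)
    also have "\<dots> \<le> Vc * real H * L (I - 1)"
      using Vc_ge L_nonneg by (intro mult_right_mono) auto
    finally show "1 \<le> Vc * real H * L (I - 1)" .
  qed simp
  then show ?thesis using that IT by blast
qed

definition frequent :: "nat \<Rightarrow> nat \<Rightarrow> bool" where
  "frequent k g \<longleftrightarrow> (\<forall>T. \<exists>p q. T \<le> p \<and> p \<le> q \<and> special k p q \<and> rk n (n - k) (seg p q) = g)"

lemma not_frequent_bound:
  assumes "\<And>g. g < G \<Longrightarrow> \<not> frequent k g"
  obtains Tb where "T0 \<le> Tb" "\<And>p q. Tb \<le> p \<Longrightarrow> p \<le> q \<Longrightarrow> special k p q \<Longrightarrow> G \<le> rk n (n - k) (seg p q)"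
proof -
  have "\<exists>Tb\<ge>T0. \<forall>p q. Tb \<le> p \<longrightarrow> p \<le> q \<longrightarrow> special k p q \<longrightarrow> G \<le> rk n (n - k) (seg p q)"
    using assms
  proof (induction G)
    case 0
    then show ?case by auto
  next
    case (Suc G)
    then obtain Tb where Tb: "Tb \<ge> T0" "\<And>p q. Tb \<le> p \<Longrightarrow> p \<le> q \<Longrightarrow> special k p q \<Longrightarrow> G \<le> rk n (n - k) (seg p q)"
      by (meson less_SucI)
    have "\<not> frequent k G" using Suc.prems by simp
    then obtain T where T: "\<And>p q. T \<le> p \<Longrightarrow> p \<le> q \<Longrightarrow> special k p q \<Longrightarrow> rk n (n - k) (seg p q) \<noteq> G"
      unfolding frequent_def by blast
    show ?case
    proof (rule exI[of _ "max Tb T"], intro conjI allI impI)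
      fix p q assume "max Tb T \<le> p" "p \<le> q" "special k p q"
      then show "Suc G \<le> rk n (n - k) (seg p q)" using Tb(2)[of p q] T[of p q] by fastforce
    qed (use Tb in simp)
  qed
  then show ?thesis using that by blast
qed

text \<open>With \<open>g\<close> the least frequent rank, late special segments have rank at least
  \<open>g\<close>, as \<open>good_of_special\<close> needs. The last conclusion exports the
  minimality and the generator, which the later exclusion of small frequent ranks exploits.\<close>

lemma exists_good:
  assumes k: "2 * k < n"
  obtains I q g where "T1 < I" "good k I q g"
    "\<And>g0. frequent k g0 \<Longrightarrow> g \<le> g0 \<and> (\<exists>G. G \<in> W n g (seg I q) \<and> G \<notin> W n g (seg (I - 1) q))"
proof (cases "\<exists>g. frequent k g")
  case True
  define g where "g = (LEAST g. frequent k g)"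
  have g: "frequent k g" unfolding g_def using True by (rule LeastI_ex)
  have gle: "g \<le> g0" if "frequent k g0" for g0 unfolding g_def using that by (rule Least_le)
  have nf: "\<not> frequent k g'" if "g' < g" for g' using gle[of g'] that by auto
  obtain Tb where Tb: "T0 \<le> Tb" "\<And>p q. Tb \<le> p \<Longrightarrow> p \<le> q \<Longrightarrow> special k p q \<Longrightarrow> g \<le> rk n (n - k) (seg p q)"
    by (rule not_frequent_bound[OF nf]) (assumption, rule that, assumption+)
  define T1' where "T1' = max T1 Tb"
  have T1'0: "T1' \<ge> T0" using Tb(1) by (simp add: T1'_def)
  obtain T2 where T2: "T2 \<ge> T1'" "W n n (seg T1' T2) = {0}" by (rule full_eventually[OF T1'0])
  obtain p q where pq: "T2 \<le> p" "p \<le> q" "special k p q" "rk n (n - k) (seg p q) = g"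
    using g unfolding frequent_def by blast
  have b: "k \<le> n" "Tb \<le> T1'" "T1' \<le> p" using k T2(1) pq(1) by (simp_all add: T1'_def)
  obtain I G where "T1' < I" "good k I q g" "G \<in> W n g (seg I q)" "G \<notin> W n g (seg (I - 1) q)"
    by (rule good_of_special[OF b(1) Tb b(2) T2(2) pq(1) b(3) pq(2-4)])
  then show ?thesis using that[of I q g] gle by (auto simp: T1'_def)
next
  case False
  then obtain Tb where Tb: "T0 \<le> Tb" "\<And>p q. Tb \<le> p \<Longrightarrow> p \<le> q \<Longrightarrow> special k p q \<Longrightarrow> Suc (n - k) \<le> rk n (n - k) (seg p q)"
    using not_frequent_bound[of "Suc (n - k)" k] by blast
  have nosp: "\<not> special k p q" if "Tb \<le> p" "p \<le> q" for p q
  proof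
    assume sp: "special k p q"
    then obtain G where "gen n (n - k) (seg p q) G" by (auto simp: special_def)
    then have "rk n (n - k) (seg p q) \<le> n - k" by (simp add: gen_def)
    then show False using Tb(2)[OF that sp] by simp
  qed
  obtain I q g where "max T1 Tb < I" "good k I q g"
    by (rule good_of_no_special[OF k Tb(1) nosp max.cobounded2])
  then show ?thesis using that[of I q g] False by auto
qed

section \<open>The two logarithmic inequalities\<close>

definition E :: "nat \<Rightarrow> nat \<Rightarrow> real" where "E I r = ln (real (Zr I r))"

definition Kf :: real where "Kf = ln (max 1 Vc ^ Suc n * Sc * 2)"

lemma L_exp: "T \<ge> T0 \<Longrightarrow> L T \<le> exp (- lam * ln (real T))"
  using z_err[of T] T0 by (simp add: powr_def)

text \<open>The segment is cut at the first index \<open>p\<close> of rank \<open>s\<close>, where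
  the annihilator is already that of the whole segment. A basis of \<open>g\<close> windows bounds
  \<open>H ^ c\<close> by one height and \<open>g - 1\<close> errors, and nonvanishing contributes
  \<open>c\<close> factors \<open>L (I - 1)\<close>. Eliminating \<open>H\<close> leaves
  \<open>g - 1 + c = n - k\<close> errors against one height.\<close>

lemma main_inequality:
  assumes G: "good k I q g" and k: "2 * k < n"
  obtains s where "1 \<le> s" "s \<le> n - 2 * k" "s \<le> max 1 (g - k)"
    "lam * (real k * E I (s - 1) + (\<Sum>t=1..<s. E I t) + real (n - 2 * k + 1 - s) * E I 0) \<le> E I (s - 1) + Kf"
proof -
  have good: "T0 \<le> I - 1" "I \<le> q" "rk n (n - k) (seg I q) = g" "g \<le> n - k"
    "\<And>a b. I \<le> a \<Longrightarrow> a \<le> b \<Longrightarrow> b \<le> q \<Longrightarrow> min g (k + rk n n (seg a b)) \<le> rk n (n - k) (seg a b)"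
    "\<And>P H. P \<in> W n (n - k) (seg I q) \<Longrightarrow> P \<noteq> 0 \<Longrightarrow> (\<And>a. \<bar>coeff P a\<bar> \<le> int H) \<Longrightarrow> 1 \<le> Vc * real H * L (I - 1)"
    using G unfolding good_def by blast+
  have I: "I \<ge> T0" using good(1) by simp
  \<comment> \<open>Dimensions beyond \<open>g - k\<close> no longer raise the capped rank. The
    \<open>max 1\<close> covers \<open>g \<le> k\<close>, where the first point alone reaches rank
    \<open>g\<close>.\<close>
  define s where "s = max 1 (min (g - k) (rk n n (seg I q)))"
  define p where "p = Suc (Zr I (s - 1))"
  have s1: "1 \<le> s" and sn: "s \<le> n - 2 * k" and geo_sum: "s \<le> max 1 (g - k)"
    using good(4) k by (auto simp: s_def)
  have sn': "s \<le> n" "s - 1 \<le> n" using sn by simp_all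
  have Ip: "I \<le> p" using Zr_ge[OF I sn'(2)] by (simp add: p_def)
  have pq: "p \<le> q"
  proof (cases "s = 1")
    case True
    then show ?thesis using good(2) Zr_0[OF I] I T0 by (simp add: p_def)
  next
    case False
    then have "s \<le> rk n n (seg I q)" using s1 by (simp add: s_def)
    then have "\<not> q \<le> Zr I (s - 1)"
      using Zr_rk_le[OF I sn'(2)] rk_mono[OF seg_mono[of I I q "Zr I (s - 1)"], of n n] s1 by fastforce
    then show ?thesis by (simp add: p_def)
  qed
  have rkp: "rk n n (seg I p) = s" using Zr_Suc_rk(2)[OF I sn'(2)] s1 by (simp add: p_def)
  have "rk n (n - k) (seg I p) \<le> g" unfolding good(3)[symmetric] using pq by (intro rk_mono seg_mono) auto
  moreover have "g \<le> rk n (n - k) (seg I p)"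
  proof (cases "g \<le> k + s")
    case True
    then show ?thesis using good(5)[of I p] Ip pq rkp by simp
  next
    case False
    then have "s = max 1 (rk n n (seg I q))" unfolding s_def by linarith
    moreover have "rk n n (seg I q) \<ge> 1"
      using rk_single[OF I, of n] rk_mono[of "{z I}" "seg I q" n n] good(2) by fastforce
    ultimately have "rk n n (seg I q) = s" by simp
    then have "W n n (seg I p) = W n n (seg I q)" using rkp pq by (intro W_eqI seg_mono) auto
    then show ?thesis using rk_top_determines[of "n - k" n "seg I p" "seg I q"] good(3) by simp
  qed
  ultimately have rg: "rk n (n - k) (seg I p) = g" by simp
  have kn: "k \<le> n" using k by simp
  have low: "min (rk n (n - k) (seg I p)) (k + rk n n (seg a p)) \<le> rk n (n - k) (seg a p)"
    if "I \<le> a" "a \<le> p" for a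
    using good(5)[OF that pq] by (simp add: rg)
  obtain ts where ts: "indep (n - k) (map vec_of ts)"
    "annih (n - k) (vec_of ` set ts) = W n (n - k) (seg I p)"
    "length ts = rk n (n - k) (seg I p)" "length ts > 0"
    "fst (ts ! 0) = p"
    "\<And>T b. (T, b) \<in> set ts \<Longrightarrow> I \<le> T \<and> T \<le> p \<and> b \<le> k"
    "(\<Prod>v=1..<length ts. L (fst (ts ! v))) \<le> (\<Prod>v=1..<length ts. Lb I k s v)"
    by (rule basis_product[OF I s1 sn'(1) kn low[unfolded p_def], folded p_def]) (assumption | rule that)+
  have lg: "length ts = g" using ts(3) rg by simp
  define c where "c = Suc (n - k) - g"
  have c: "c \<ge> 1" "c \<le> Suc n" using good(4) by (auto simp: c_def)
  have tags: "T0 \<le> T \<and> T \<le> fst (ts ! 0) \<and> b \<le> n - (n - k)" if "(T, b) \<in> set ts" for T b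
    using ts(6)[OF that] ts(5) I k by simp
  obtain P H where P: "P \<in> annih (n - k) (vec_of ` set ts)" "P \<noteq> 0" "\<And>a. \<bar>coeff P a\<bar> \<le> int H"
    "real H ^ (Suc (n - k) - length ts) \<le> Sc * (H0 (fst (ts ! 0)) * (\<Prod>v=1..<length ts. L (fst (ts ! v))))"
    by (rule siegel_seg[OF ts(1,4) _ _ tags]) (use lg good(4) in simp, simp, assumption, rule that, assumption+)
  have "W n (n - k) (seg I p) = W n (n - k) (seg I q)"
    using rg good(3) pq by (intro W_eqI seg_mono) auto
  then have PW: "P \<in> W n (n - k) (seg I q)" using P(1) ts(2) by simp
  define e where "e v = (if v \<le> k then E I (s - 1) else if v < k + s then E I (k + s - v) else E I 0)" for v
  have Zge: "T0 \<le> Zr I r" if "r \<le> n" for r using Zr_ge[OF I that] good(1) by simp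
  have LZ: "L (Zr I r) \<le> exp (- lam * E I r)" if "r \<le> n" for r
    unfolding E_def by (rule L_exp[OF Zge[OF that]])
  have L0: "L (I - 1) \<le> exp (- lam * E I 0)" using LZ[of 0] Zr_0[OF I] by simp
  have LI: "L I \<le> exp (- lam * E I 0)" using L_antimono[OF good(1), of I] L0 by simp
  have Lbe: "Lb I k s v \<le> exp (- lam * e v)" if "v < g" for v
  proof -
    have "L (Suc (Zr I (s - 1))) \<le> L (Zr I (s - 1))" using Zge[OF sn'(2)] by (intro L_antimono) auto
    then show ?thesis
      using LZ[OF sn'(2)] LZ[of "k + s - v"] LI sn' unfolding Lb_def e_def by auto
  qed
  have Lb0: "0 \<le> Lb I k s v" for v by (simp add: Lb_def L_nonneg)
  have prodLb: "(\<Prod>v=1..<g. Lb I k s v) \<le> exp (- lam * (\<Sum>v=1..<g. e v))"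
  proof -
    have "(\<Prod>v=1..<g. Lb I k s v) \<le> (\<Prod>v=1..<g. exp (- lam * e v))"
      using Lbe Lb0 by (intro prod_mono) auto
    also have "\<dots> = exp (- lam * (\<Sum>v=1..<g. e v))" by (simp add: sum_distrib_left sum_negf flip: exp_sum)
    finally show ?thesis .
  qed
  have Zpos: "real (Zr I r) > 0" if "r \<le> n" for r using Zge[OF that] T0 by simp
  have H0p: "H0 p \<le> 2 * exp (E I (s - 1))"
  proof -
    have "H0 p \<le> real p" using z_size[of p] Ip I by linarith
    also have "\<dots> \<le> 2 * real (Zr I (s - 1))" using Zpos[OF sn'(2)] by (simp add: p_def)
    finally show ?thesis using Zpos[OF sn'(2)] by (simp add: E_def)
  qed
  have "1 \<le> Vc * real H * L (I - 1)" by (rule good(6)[OF PW P(2,3)])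
  then have "1 \<le> (Vc * real H * L (I - 1)) ^ c" by (rule one_le_power)
  also have "\<dots> = Vc ^ c * (real H ^ c * L (I - 1) ^ c)" by (simp add: power_mult_distrib)
  also have "\<dots> \<le> max 1 Vc ^ Suc n * ((Sc * (2 * exp (E I (s - 1)) * exp (- lam * (\<Sum>v=1..<g. e v)))) * exp (- lam * E I 0) ^ c)"
  proof (rule mult_mono)
    have "Vc ^ c \<le> max 1 Vc ^ c" using Vc_pos by (intro power_mono) auto
    also have "\<dots> \<le> max 1 Vc ^ Suc n" using c by (intro power_increasing) auto
    finally show "Vc ^ c \<le> max 1 Vc ^ Suc n" .
    show "real H ^ c * L (I - 1) ^ c \<le> (Sc * (2 * exp (E I (s - 1)) * exp (- lam * (\<Sum>v=1..<g. e v)))) * exp (- lam * E I 0) ^ c"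
    proof (rule mult_mono)
      have "real H ^ c \<le> Sc * (H0 p * (\<Prod>v=1..<g. L (fst (ts ! v))))"
        using P(4) lg ts(5) by (simp add: c_def)
      also have "\<dots> \<le> Sc * (2 * exp (E I (s - 1)) * exp (- lam * (\<Sum>v=1..<g. e v)))"
      proof (intro mult_left_mono mult_mono)
        show "(\<Prod>v=1..<g. L (fst (ts ! v))) \<le> exp (- lam * (\<Sum>v=1..<g. e v))"
          using ts(7) prodLb lg by simp
        show "0 \<le> (\<Prod>v=1..<g. L (fst (ts ! v)))" by (intro prod_nonneg ballI L_nonneg)
      qed (use H0p Sc_pos in auto)
      finally show "real H ^ c \<le> Sc * (2 * exp (E I (s - 1)) * exp (- lam * (\<Sum>v=1..<g. e v)))" .
      show "L (I - 1) ^ c \<le> exp (- lam * E I 0) ^ c" by (rule power_mono[OF L0 L_nonneg])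
    qed (use Sc_pos L_nonneg in auto)
  qed (use L_nonneg in auto)
  also have "\<dots> = (max 1 Vc ^ Suc n * Sc * 2) * exp (E I (s - 1) - lam * ((\<Sum>v=1..<g. e v) + real c * E I 0))"
  proof -
    have 1: "exp (- lam * E I 0) ^ c = exp (- lam * (real c * E I 0))"
      by (simp add: exp_of_nat_mult[symmetric] mult_ac)
    have 2: "E I (s - 1) - lam * ((\<Sum>v=1..<g. e v) + real c * E I 0) =
        E I (s - 1) + (- lam * (\<Sum>v=1..<g. e v) + - lam * (real c * E I 0))" by (simp add: algebra_simps)
    show ?thesis unfolding 1 2 exp_add by (simp only: mult_ac)
  qed
  finally have "0 \<le> ln ((max 1 Vc ^ Suc n * Sc * 2) * exp (E I (s - 1) - lam * ((\<Sum>v=1..<g. e v) + real c * E I 0)))"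
    by (rule ln_ge_zero)
  moreover have "max 1 Vc ^ Suc n * Sc * 2 > 0" using Sc_pos by (intro mult_pos_pos zero_less_power) auto
  moreover have "ln (x * exp y) = ln x + y" if "x > 0" for x y :: real using that by (simp add: ln_mult)
  ultimately have ineq: "lam * ((\<Sum>v=1..<g. e v) + real c * E I 0) \<le> E I (s - 1) + Kf"
    unfolding Kf_def by fastforce
  have "(\<Sum>v=1..<g. e v) + real c * E I 0 =
      real k * E I (s - 1) + (\<Sum>t=1..<s. E I t) + real (n - 2 * k + 1 - s) * E I 0"
  proof (cases "g \<le> k")
    case True
    then have s: "s = 1" by (simp add: s_def)
    have g1: "g \<ge> 1" using ts(4) lg by simp
    have "(\<Sum>v=1..<g. e v) = (\<Sum>v=1..<g. E I 0)" using True s by (intro sum.cong) (auto simp: e_def)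
    then show ?thesis using s True g1 k by (simp add: c_def of_nat_diff algebra_simps)
  next
    case False
    then have gs: "k + s \<le> g" by (auto simp: s_def)
    have "(\<Sum>v=1..<g. e v) = (\<Sum>v=1..<Suc k. e v) + ((\<Sum>v=Suc k..<k + s. e v) + (\<Sum>v=k + s..<g. e v))"
      using sum.atLeastLessThan_concat[of 1 "Suc k" g e] sum.atLeastLessThan_concat[of "Suc k" "k + s" g e] gs s1 by simp
    moreover have "(\<Sum>v=1..<Suc k. e v) = (\<Sum>v=1..<Suc k. E I (s - 1))" by (intro sum.cong) (auto simp: e_def)
    moreover have "(\<Sum>v=k + s..<g. e v) = (\<Sum>v=k + s..<g. E I 0)" using s1 by (intro sum.cong) (auto simp: e_def)
    moreover have "(\<Sum>v=Suc k..<k + s. e v) = (\<Sum>t=1..<s. E I t)"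
      by (rule sum.reindex_bij_witness[of _ "\<lambda>t. k + s - t" "\<lambda>v. k + s - v"]) (auto simp: e_def)
    ultimately have "(\<Sum>v=1..<g. e v) = real k * E I (s - 1) + (\<Sum>t=1..<s. E I t) + real (g - (k + s)) * E I 0"
      by simp
    moreover have "real (g - (k + s)) + real c = real (n - 2 * k + 1 - s)"
      using gs good(4) sn k by (simp add: c_def of_nat_diff)
    ultimately show ?thesis by (metis (no_types, lifting) add.assoc distrib_right)
  qed
  then show ?thesis using that[OF s1 sn geo_sum] ineq by simp
qed

text \<open>\<open>growth_raw\<close> bounds the height of the last point times the power
  \<open>r - 1\<close> of its error. The hypothesis on \<open>M\<close> trades this height for a
  power of the error, which leaves the exponent \<open>M - (r - 1)\<close>.\<close>

lemma growth_inequality: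
  assumes I: "T0 \<le> I - 1" and r: "1 \<le> r" "r \<le> n"
    and M: "M * (- ln (L (Zr I r))) \<le> ln (H0 (Zr I r)) + K" "real (r - 1) \<le> M"
  shows "(M - real (r - 1)) * (lam * E I r) \<le> E I (r - 1) - lam * (\<Sum>t=1..<r. E I t) + (K + ln (2 * Gc))"
proof -
  let ?q = "Zr I r"
  have I': "I \<ge> T0" using I by simp
  have Zge: "T0 \<le> Zr I t" if "t \<le> n" for t using Zr_ge[OF I' that] I by simp
  have Zpos: "real (Zr I t) > 0" if "t \<le> n" for t using Zge[OF that] T0 by simp
  have LZ: "L (Zr I t) \<le> exp (- lam * E I t)" if "t \<le> n" for t
    unfolding E_def by (rule L_exp[OF Zge[OF that]])
  have Lq: "L ?q > 0" by (rule L_pos[OF Zge[OF r(2)]])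
  have Hq: "H0 ?q \<ge> 1" by (rule H0_ge1[OF Zge[OF r(2)]])
  have r1: "r - 1 \<le> n" using r by simp
  have "H0 ?q * L ?q ^ (r - 1) \<le> Gc * (H0 (Suc (Zr I (r - 1))) * (\<Prod>t=1..<r. L (Zr I t)))"
    by (rule growth_raw[OF I' r])
  also have "\<dots> \<le> Gc * ((2 * exp (E I (r - 1))) * exp (- lam * (\<Sum>t=1..<r. E I t)))"
  proof (intro mult_left_mono mult_mono)
    have "H0 (Suc (Zr I (r - 1))) \<le> real (Suc (Zr I (r - 1)))"
      using z_size[of "Suc (Zr I (r - 1))"] Zge[OF r1] by linarith
    also have "\<dots> \<le> 2 * real (Zr I (r - 1))" using Zpos[OF r1] by simp
    finally show "H0 (Suc (Zr I (r - 1))) \<le> 2 * exp (E I (r - 1))" using Zpos[OF r1] by (simp add: E_def)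
    have "(\<Prod>t=1..<r. L (Zr I t)) \<le> (\<Prod>t=1..<r. exp (- lam * E I t))"
      using LZ L_nonneg r by (intro prod_mono) auto
    also have "\<dots> = exp (- lam * (\<Sum>t=1..<r. E I t))" by (simp add: sum_distrib_left sum_negf flip: exp_sum)
    finally show "(\<Prod>t=1..<r. L (Zr I t)) \<le> exp (- lam * (\<Sum>t=1..<r. E I t))" .
    show "0 \<le> (\<Prod>t=1..<r. L (Zr I t))" by (intro prod_nonneg ballI L_nonneg)
  qed (use Gc_pos in auto)
  also have "\<dots> = (2 * Gc) * exp (E I (r - 1) - lam * (\<Sum>t=1..<r. E I t))"
    by (simp add: exp_diff exp_minus field_simps)
  finally have "ln (H0 ?q * L ?q ^ (r - 1)) \<le> ln ((2 * Gc) * exp (E I (r - 1) - lam * (\<Sum>t=1..<r. E I t)))"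
    using Lq Hq Gc_pos by (subst ln_le_cancel_iff) (auto intro!: mult_pos_pos)
  also have "\<dots> = ln (2 * Gc) + (E I (r - 1) - lam * (\<Sum>t=1..<r. E I t))"
    using Gc_pos by (subst ln_mult) auto
  also have "ln (H0 ?q * L ?q ^ (r - 1)) = ln (H0 ?q) + real (r - 1) * ln (L ?q)"
    using Lq Hq by (subst ln_mult) (auto simp: ln_realpow)
  finally have "ln (H0 ?q) + real (r - 1) * ln (L ?q) \<le> ln (2 * Gc) + (E I (r - 1) - lam * (\<Sum>t=1..<r. E I t))" .
  then have 1: "(M - real (r - 1)) * (- ln (L ?q)) \<le> E I (r - 1) - lam * (\<Sum>t=1..<r. E I t) + (K + ln (2 * Gc))"
    using M(1) by (simp add: algebra_simps)
  have "ln (L ?q) \<le> - lam * E I r"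
    using LZ[OF r(2)] Lq by (metis exp_gt_zero ln_exp ln_le_cancel_iff)
  then have "lam * E I r \<le> - ln (L ?q)" by simp
  then have "(M - real (r - 1)) * (lam * E I r) \<le> (M - real (r - 1)) * (- ln (L ?q))"
    using M(2) by (intro mult_left_mono) auto
  with 1 show ?thesis by linarith
qed

end

section \<open>The criterion\<close>

definition geo_sum :: "real \<Rightarrow> nat \<Rightarrow> real" where
  "geo_sum h q = (\<Sum>i<q. (1 - h) ^ i)"

lemma geo_sum_Suc_shift: "geo_sum h (Suc q) = 1 + (1 - h) * geo_sum h q"
  unfolding geo_sum_def sum.lessThan_Suc_shift by (simp add: sum_distrib_left)

lemma geo_sum_le: "0 \<le> h \<Longrightarrow> h \<le> 1 \<Longrightarrow> geo_sum h q \<le> real q"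
  unfolding geo_sum_def using sum_bounded_above[of "{..<q}" "\<lambda>i. (1 - h) ^ i" 1] by (simp add: power_le_one)

lemma chain_lower:
  fixes e :: "nat \<Rightarrow> real"
  assumes h: "0 < h" "h < 1" and e: "\<And>t. 1 \<le> t \<Longrightarrow> t \<le> u \<Longrightarrow> (1 - h) * e t \<le> e (t - 1)"
  shows "i \<le> u \<Longrightarrow> (1 - h) ^ i * e u \<le> e (u - i)"
proof (induction i)
  case (Suc i)
  have "(1 - h) * ((1 - h) ^ i * e u) \<le> (1 - h) * e (u - i)"
    using Suc h by (intro mult_left_mono) auto
  also have "\<dots> \<le> e (u - Suc i)" using e[of "u - i"] Suc.prems by simp
  finally show ?case by (simp add: mult.assoc)
qed simp

lemma chain_sum_lower:
  fixes e :: "nat \<Rightarrow> real"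
  assumes h: "0 < h" "h < 1" and e: "\<And>t. 1 \<le> t \<Longrightarrow> t \<le> u \<Longrightarrow> (1 - h) * e t \<le> e (t - 1)"
  shows "geo_sum h u * e u \<le> (\<Sum>t=1..<Suc u. e t)"
proof -
  have "geo_sum h u * e u = (\<Sum>i<u. (1 - h) ^ i * e u)" by (simp add: geo_sum_def sum_distrib_right)
  also have "\<dots> \<le> (\<Sum>i<u. e (u - i))" by (intro sum_mono chain_lower[where e = e and u = u, OF h e]) auto
  also have "\<dots> = (\<Sum>t=1..<Suc u. e t)"
    by (rule sum.reindex_bij_witness[of _ "\<lambda>t. u - t" "\<lambda>i. u - i"]) auto
  finally show ?thesis .
qed

text \<open>The inequalities \<open>G\<close> force consecutive \<open>e t\<close> to be within the factor \<open>1 - h\<close> of each other,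
  so \<open>F\<close> becomes a comparison of a geometric sum with \<open>N\<close>.\<close>

lemma chain_contradiction:
  fixes e :: "nat \<Rightarrow> real" and h lam M N K Kf :: real
  assumes h: "0 < h" "h < 1" and lam: "lam > 0" "1 < lam * N"
    and small: "\<And>r. 1 \<le> r \<Longrightarrow> r < j \<Longrightarrow> lam * geo_sum h (r - 1) \<le> 1"
    and mono: "\<And>r. r < j \<Longrightarrow> e 0 \<le> e r" "0 \<le> e 0"
    and G: "\<And>r. 1 \<le> r \<Longrightarrow> r < j \<Longrightarrow>
      (M - real (r - 1)) * (lam * e r) \<le> e (r - 1) - lam * (\<Sum>t=1..<r. e t) + K"
    and R: "\<And>r. 1 \<le> r \<Longrightarrow> r < j \<Longrightarrow> real r - geo_sum h r \<le> M - (1 - h) * N"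
    and s: "1 \<le> s" "s \<le> j"
    and F: "lam * (real k * e (s - 1) + (\<Sum>t=1..<s. e t) + real (j + 1 - s) * e 0) \<le> e (s - 1) + Kf"
    and Fin: "N \<le> real k + geo_sum h j"
    and big: "K < (1 - h) * (lam * N - 1) * e 0" "Kf < (lam * N - 1) * e 0"
  shows False
proof -
  have step: "(1 - h) * e r \<le> e (r - 1)" if "1 \<le> r" "r < j" for r
    using that
  proof (induction r rule: less_induct)
    case (less r)
    obtain q where q: "r = Suc q" using less.prems by (cases r) auto
    have S: "geo_sum h q * e q \<le> (\<Sum>t=1..<r. e t)"
      unfolding q using less q by (intro chain_sum_lower[where e = e and u = q, OF h]) auto
    define c where "c = 1 - lam * geo_sum h q"
    define d where "d = lam * N - 1"
    have c: "c \<ge> 0" using small[OF less.prems] by (simp add: c_def q)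
    have d: "d > 0" using lam by (simp add: d_def)
    have er: "e r \<ge> e 0" "e r \<ge> 0" using mono less.prems by fastforce+
    have Mr: "(1 - h) * N - (1 - h) * geo_sum h q \<le> M - real (r - 1)"
      using R[OF less.prems] geo_sum_Suc_shift[of h q] by (simp add: q)
    have "(1 - h) * (c + d) * e r = ((1 - h) * N - (1 - h) * geo_sum h q) * (lam * e r)"
      by (simp add: c_def d_def algebra_simps)
    also have "\<dots> \<le> (M - real (r - 1)) * (lam * e r)"
      using Mr er lam by (intro mult_right_mono) auto
    also have "\<dots> \<le> e q - lam * (\<Sum>t=1..<r. e t) + K" using G[OF less.prems] by (simp add: q)
    also have "\<dots> \<le> e q - lam * (geo_sum h q * e q) + K" using S lam by (simp add: mult_left_mono)
    also have "\<dots> = c * e q + K" by (simp add: c_def algebra_simps)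
    finally have 1: "(1 - h) * (c + d) * e r \<le> c * e q + K" .
    have "(1 - h) * d * e 0 \<le> (1 - h) * d * e r" using er(1) h d by (intro mult_left_mono) auto
    then have "K < (1 - h) * d * e r" using big(1) unfolding d_def by linarith
    with 1 have 2: "c * ((1 - h) * e r) < c * e q" by (simp add: algebra_simps)
    then have "(1 - h) * e r < e q" using c by (simp add: mult_less_cancel_left)
    then show ?case by (simp add: q)
  qed
  let ?u = "s - 1"
  have st: "(1 - h) * e t \<le> e (t - 1)" if "1 \<le> t" "t \<le> ?u" for t using step[of t] that s by simp
  have eu: "e ?u \<ge> e 0" "e ?u \<ge> 0" using mono(1)[of ?u] mono(2) s by linarith+
  have a: "geo_sum h ?u * e ?u \<le> (\<Sum>t=1..<s. e t)" using chain_sum_lower[where e = e and u = ?u, OF h st] s by simp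
  have b: "(1 - h) ^ ?u * e ?u \<le> e 0" using chain_lower[where e = e and u = ?u, OF h st, of ?u] by simp
  \<comment> \<open>The terms from index \<open>s - 1\<close> on are at most
    \<open>(1 - h) ^ (s - 1)\<close> each, so the condition \<open>Fin\<close> for \<open>j\<close>
    covers every smaller \<open>s\<close>.\<close>
  have "geo_sum h j = geo_sum h ?u + (\<Sum>i=?u..<j. (1 - h) ^ i)"
    unfolding geo_sum_def lessThan_atLeast0 using s by (subst sum.atLeastLessThan_concat) auto
  also have "(\<Sum>i=?u..<j. (1 - h) ^ i) \<le> (\<Sum>i=?u..<j. (1 - h) ^ ?u)"
    using h by (intro sum_mono power_decreasing) auto
  also have "\<dots> = real (j + 1 - s) * (1 - h) ^ ?u" using s by simp
  finally have sgj: "geo_sum h j \<le> geo_sum h ?u + real (j + 1 - s) * (1 - h) ^ ?u" by simp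
  have "N * e ?u \<le> (real k + geo_sum h ?u + real (j + 1 - s) * (1 - h) ^ ?u) * e ?u"
    using Fin sgj eu by (intro mult_right_mono) auto
  also have "\<dots> = real k * e ?u + geo_sum h ?u * e ?u + real (j + 1 - s) * ((1 - h) ^ ?u * e ?u)"
    by (simp add: algebra_simps)
  also have "\<dots> \<le> real k * e ?u + (\<Sum>t=1..<s. e t) + real (j + 1 - s) * e 0"
    using a b by (intro add_mono mult_left_mono) auto
  finally have "lam * (N * e ?u) \<le> e ?u + Kf" using F lam by (meson mult_left_mono less_imp_le order_trans)
  then have "(lam * N - 1) * e ?u \<le> Kf" by (simp add: algebra_simps)
  moreover have "(lam * N - 1) * e 0 \<le> (lam * N - 1) * e ?u" using eu lam by (intro mult_left_mono) auto
  ultimately show False using big(2) by linarith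
qed

section \<open>Lower bounds for the error of a single point\<close>

context approx
begin

text \<open>A nonzero minor is at least 1. The last point supplies \<open>m + 1\<close> rows, of
  which \<open>m\<close> enter with their error \<open>L T\<close>; if earlier points add a
  dimension, one more row has error at most \<open>L J\<close>.\<close>

lemma basis_lower_bound:
  assumes J: "T0 \<le> J" "J \<le> T" and m: "m \<le> n" and rk: "Suc m \<le> rk n (n - m) {z T}"
  shows "1 \<le> Mc * (H0 T * (L T ^ m * (if Suc (Suc m) \<le> rk n (n - m) (seg J T) then L J else 1)))"
proof -
  obtain ts where ts: "indep (n - m) (map vec_of ts)" "set ts \<subseteq> {J..T} \<times> {..n - (n - m)}"
    "length ts = rk n (n - m) (seg J T)"
    "\<And>U v. U \<in> {J..T} \<Longrightarrow> v < rk n (n - m) (seg U T) \<Longrightarrow> U \<le> fst (ts ! v)"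
    using tagged_basis[OF J(2), of "n - m" n z] by auto
  let ?g = "length ts"
  have "rk n (n - m) {z T} \<le> ?g" unfolding ts(3) using J by (intro rk_mono) auto
  then have g: "Suc m \<le> ?g" using rk by linarith
  have tag: "J \<le> fst (ts ! v)" "fst (ts ! v) \<le> T" if "v < ?g" for v
  proof -
    have "ts ! v \<in> {J..T} \<times> {..n - (n - m)}" using nth_mem[OF that] ts(2) by blast
    then show "J \<le> fst (ts ! v)" "fst (ts ! v) \<le> T" by (simp_all add: mem_Times_iff)
  qed
  have top: "fst (ts ! v) = T" if "v < Suc m" for v
  proof (rule antisym)
    show "fst (ts ! v) \<le> T" using tag(2)[of v] that g by simp
    show "T \<le> fst (ts ! v)" using ts(4)[of T v] that rk J by simp
  qed
  have top0: "fst (ts ! 0) = T" by (rule top) simp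
  have mem: "T0 \<le> T' \<and> T' \<le> fst (ts ! 0) \<and> b \<le> n - (n - m)" if "(T', b) \<in> set ts" for T' b
    using that ts(2) J top0 by fastforce
  have g0: "0 < ?g" using g by linarith
  have 1: "1 \<le> Mc * (H0 T * (\<Prod>v=1..<?g. L (fst (ts ! v))))"
    using nonzero_minor_ge1[OF ts(1) g0 diff_le_self mem] unfolding top0 by simp
  have Lv: "0 \<le> L (fst (ts ! v))" "L (fst (ts ! v)) \<le> L J" "L (fst (ts ! v)) \<le> 1" if "v < ?g" for v
    using L_nonneg L_antimono[OF J(1) tag(1)[OF that]] L_le_half[OF J(1)] by auto
  have "(\<Prod>v=1..<?g. L (fst (ts ! v))) = (\<Prod>v=1..<Suc m. L (fst (ts ! v))) * (\<Prod>v=Suc m..<?g. L (fst (ts ! v)))"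
    using g by (subst prod.atLeastLessThan_concat) auto
  also have "(\<Prod>v=1..<Suc m. L (fst (ts ! v))) = (\<Prod>v=1..<Suc m. L T)"
    by (intro prod.cong refl) (simp add: top)
  also have "\<dots> = L T ^ m" by simp
  finally have 2: "(\<Prod>v=1..<?g. L (fst (ts ! v))) = L T ^ m * (\<Prod>v=Suc m..<?g. L (fst (ts ! v)))" .
  have 3: "(\<Prod>v=Suc m..<?g. L (fst (ts ! v))) \<le> (if Suc (Suc m) \<le> ?g then L J else 1)"
  proof (cases "Suc (Suc m) \<le> ?g")
    case True
    then have "(\<Prod>v=Suc m..<?g. L (fst (ts ! v))) = L (fst (ts ! Suc m)) * (\<Prod>v=Suc (Suc m)..<?g. L (fst (ts ! v)))"
      by (intro prod.atLeast_Suc_lessThan) simp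
    also have "\<dots> \<le> L J * 1"
    proof (rule mult_mono)
      show "(\<Prod>v=Suc (Suc m)..<?g. L (fst (ts ! v))) \<le> 1" using Lv by (intro prod_le_1) auto
      show "0 \<le> (\<Prod>v=Suc (Suc m)..<?g. L (fst (ts ! v)))" by (intro prod_nonneg ballI L_nonneg)
    qed (use Lv[of "Suc m"] True L_nonneg in auto)
    finally show ?thesis using True by simp
  next
    case False
    then have "{Suc m..<?g} = {}" by auto
    then show ?thesis using False by (simp only: prod.empty) simp
  qed
  have "H0 T \<ge> 1" using H0_ge1[of T] J by simp
  then have 4: "Mc * (H0 T * (L T ^ m * (\<Prod>v=Suc m..<?g. L (fst (ts ! v))))) \<le>
      Mc * (H0 T * (L T ^ m * (if Suc (Suc m) \<le> ?g then L J else 1)))"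
    using 3 Mc_pos L_nonneg by (intro mult_left_mono) auto
  show ?thesis using order_trans[OF 1[unfolded 2] 4] unfolding ts(3) .
qed

lemma plain_inequality:
  assumes T: "T0 \<le> T" and m: "m \<le> n" "Suc m \<le> rk n (n - m) {z T}"
  shows "real m * (- ln (L T)) \<le> ln (H0 T) + ln Mc"
proof -
  have Lp: "L T > 0" by (rule L_pos[OF T])
  have Hp: "H0 T \<ge> 1" by (rule H0_ge1[OF T])
  have "\<not> Suc (Suc m) \<le> rk n (n - m) (seg T T)"
    using rk_single_le[of n "n - m" "z T"] m(1) by simp
  then have "1 \<le> Mc * (H0 T * L T ^ m)" using basis_lower_bound[OF T order_refl m] by simp
  then have "ln 1 \<le> ln (Mc * (H0 T * L T ^ m))"
    using Lp Hp Mc_pos by (subst ln_le_cancel_iff) (auto intro!: mult_pos_pos)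
  also have "\<dots> = ln Mc + (ln (H0 T) + real m * ln (L T))"
    using Lp Hp Mc_pos by (simp add: ln_mult ln_realpow)
  finally show ?thesis by simp
qed

lemma run_W:
  assumes "T0 \<le> I" "I \<le> T" "rk n n (seg I T) \<le> 1" "l \<le> n" "U \<in> {I..T}"
  shows "W n l {z U} = W n l (seg I T)"
proof -
  have "W n n {z U} = W n n (seg I T)"
    using rk_single[of U n] assms by (intro W_eqI) auto
  then show ?thesis by (rule W_top_determines[OF assms(4)])
qed

text \<open>All points of the run are proportional, so error and height scale together; a larger
  height would mean a larger error, against minimality. Hence the height stays at most that of
  \<open>z I\<close>.\<close>

lemma run_size:
  assumes I: "T0 \<le> I" "I \<le> T" "rk n n (seg I T) \<le> 1"
  shows "H0 T \<le> real I"
proof -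
  have W: "W n n {z I} = W n n {z T}"
    using run_W[OF I order_refl, of I] run_W[OF I order_refl, of T] I(2) by simp
  have prp: "z I 0 * z T j = z I j * z T 0" if "j \<le> n" for j
  proof -
    define P where "P = monom (z I 0) j - monom (z I j) 0"
    have "degree P \<le> n" unfolding P_def using that
      by (intro degree_diff_le order_trans[OF degree_monom_le]) auto
    then have "P \<in> W n n {z I}" by (simp add: W_iff P_def pr_diff pr_monom)
    then have "P \<in> W n n {z T}" using W by simp
    then show ?thesis by (simp add: W_iff P_def pr_diff pr_monom)
  qed
  have "L I \<in> (\<lambda>k. \<bar>real_of_int (z I 0) * \<xi> ^ k - real_of_int (z I k)\<bar>) ` {1..n}"
    unfolding lerr_def using n1 by (intro Max_in) auto
  then obtain k where k: "1 \<le> k" "k \<le> n" "L I = \<bar>real_of_int (z I 0) * \<xi> ^ k - real_of_int (z I k)\<bar>" by auto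
  have "real_of_int (z T 0) * (real_of_int (z I 0) * \<xi> ^ k - real_of_int (z I k)) =
      real_of_int (z I 0) * (real_of_int (z T 0) * \<xi> ^ k - real_of_int (z T k))"
    using arg_cong[OF prp[OF k(2)], of real_of_int] by (simp add: algebra_simps)
  then have "\<bar>real_of_int (z T 0) * (real_of_int (z I 0) * \<xi> ^ k - real_of_int (z I k))\<bar> =
      \<bar>real_of_int (z I 0) * (real_of_int (z T 0) * \<xi> ^ k - real_of_int (z T k))\<bar>" by simp
  then have "H0 T * L I = H0 I * \<bar>real_of_int (z T 0) * \<xi> ^ k - real_of_int (z T k)\<bar>"
    by (simp add: abs_mult k(3))
  also have "\<dots> \<le> H0 I * L T" using k by (intro mult_left_mono lerr_ge) auto
  also have "\<dots> \<le> H0 I * L I" using L_antimono[OF I(1,2)] by (intro mult_left_mono) auto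
  finally have "H0 T \<le> H0 I" using L_pos[OF I(1)] by simp
  also have "\<dots> \<le> real I" using z_size[OF I(1)] by linarith
  finally show ?thesis .
qed

definition Kb :: real where "Kb = (ln Mc + lam * ln 2) / (1 - lam)"

text \<open>Compared with \<open>plain_inequality\<close>, the minor has one more row, of error at
  most \<open>L (I - 1)\<close>. By \<open>run_size\<close> the height of \<open>z T\<close> is at
  most of order \<open>I - 1\<close>, so this error is at most of order
  \<open>H0 T powr (- lam)\<close>, which improves \<open>m\<close> to
  \<open>m / (1 - lam)\<close>.\<close>

lemma boot_inequality:
  assumes I: "T0 \<le> I - 1" "I \<le> T" "rk n n (seg I T) \<le> 1"
    and m: "m \<le> n" "Suc m \<le> rk n (n - m) {z T}" "Suc (Suc m) \<le> rk n (n - m) (seg (I - 1) T)"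
    and l1: "lam < 1"
  shows "real m / (1 - lam) * (- ln (L T)) \<le> ln (H0 T) + Kb"
proof -
  have I': "T0 \<le> I" "I - 1 \<le> T" "T0 \<le> T" using I by simp_all
  have Lp: "L T > 0" by (rule L_pos[OF I'(3)])
  have Hp: "H0 T \<ge> 1" by (rule H0_ge1[OF I'(3)])
  have Lp': "L (I - 1) > 0" by (rule L_pos[OF I(1)])
  have Ip: "real (I - 1) > 0" using I(1) T0 by simp
  have "1 \<le> Mc * (H0 T * (L T ^ m * L (I - 1)))"
    using basis_lower_bound[OF I(1) I'(2) m(1,2)] m(3) by simp
  then have "ln 1 \<le> ln (Mc * (H0 T * (L T ^ m * L (I - 1))))"
    using Lp Lp' Hp Mc_pos by (subst ln_le_cancel_iff) (auto intro!: mult_pos_pos)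
  also have "\<dots> = ln Mc + (ln (H0 T) + (real m * ln (L T) + ln (L (I - 1))))"
    using Lp Lp' Hp Mc_pos by (simp add: ln_mult ln_realpow)
  finally have 1: "real m * (- ln (L T)) \<le> ln Mc + ln (H0 T) + ln (L (I - 1))" by simp
  have "ln (L (I - 1)) \<le> ln (exp (- lam * ln (real (I - 1))))"
    using L_exp[OF I(1)] Lp' by (subst ln_le_cancel_iff) auto
  then have 2: "ln (L (I - 1)) \<le> - lam * ln (real (I - 1))" by simp
  have "H0 T \<le> 2 * real (I - 1)" using run_size[OF I'(1) I(2,3)] I(1) T0 by linarith
  then have "ln (H0 T) \<le> ln (2 * real (I - 1))" using Hp Ip by (subst ln_le_cancel_iff) auto
  also have "\<dots> = ln 2 + ln (real (I - 1))" by (rule ln_mult_pos) (use Ip in auto)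
  finally have "lam * (ln (H0 T) - ln 2) \<le> lam * ln (real (I - 1))" using lam by (intro mult_left_mono) auto
  with 1 2 have "real m * (- ln (L T)) \<le> (1 - lam) * ln (H0 T) + (ln Mc + lam * ln 2)"
    by (simp add: algebra_simps)
  then have "real m * (- ln (L T)) / (1 - lam) \<le> ((1 - lam) * ln (H0 T) + (ln Mc + lam * ln 2)) / (1 - lam)"
    using l1 by (intro divide_right_mono) auto
  also have "\<dots> = ln (H0 T) + Kb" using l1 by (simp add: Kb_def add_divide_distrib)
  finally show ?thesis by simp
qed

text \<open>One level up, the rank either does not drop, and \<open>structured_gen\<close> applies,
  or it drops below the generic value, and \<open>deficient_gen\<close> applies.\<close>

lemma special_of_deficient:
  assumes m: "1 \<le> m" "m \<le> n" and rk: "rk n (n - m) (seg p q) \<le> n - m"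
    "rk n (n - m) (seg p q) \<le> m - 1 + rk n n (seg p q)"
  shows "special (m - 1) p q" "rk n (n - (m - 1)) (seg p q) \<le> rk n (n - m) (seg p q)"
proof -
  let ?S = "seg p q"
  have nm: "n - (m - 1) = Suc (n - m)" using m by simp
  have Wn: "W n (n - m) ?S \<noteq> {0}" using rk(1) by (simp add: W_nontrivial_iff)
  show le: "rk n (n - (m - 1)) ?S \<le> rk n (n - m) ?S"
    unfolding nm using m Wn by (intro rk_antimono) auto
  have Wn': "W n (Suc (n - m)) ?S \<noteq> {0}" using le[unfolded nm] rk(1) by (simp add: W_nontrivial_iff)
  show "special (m - 1) p q"
  proof (cases "rk n (n - m) ?S \<le> rk n (Suc (n - m)) ?S")
    case True
    have "Suc (n - m) \<le> n" using m by simp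
    then show ?thesis
      using structured_gen[OF _ Wn True] Wn' unfolding special_def nm by (metis order_refl)
  next
    case False
    then have "rk n (Suc (n - m)) ?S < n - Suc (n - m) + rk n n ?S" using rk(2) m by linarith
    then show ?thesis using deficient_gen[of "Suc (n - m)" n ?S] Wn' m unfolding special_def nm
      by (metis Suc_diff_le diff_le_self nm)
  qed
qed

lemma frequentI:
  assumes "\<And>T. \<exists>p q. T \<le> p \<and> p \<le> q \<and> special k p q \<and> rk n (n - k) (seg p q) \<le> g0"
  obtains g where "g \<le> g0" "frequent k g"
proof (rule ccontr)
  assume neg: "\<not> thesis"
  have nf: "g < Suc g0 \<Longrightarrow> \<not> frequent k g" for g using neg that[of g] by auto
  obtain Tb where Tb: "T0 \<le> Tb" "\<And>p q. Tb \<le> p \<Longrightarrow> p \<le> q \<Longrightarrow> special k p q \<Longrightarrow> Suc g0 \<le> rk n (n - k) (seg p q)"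
    by (rule not_frequent_bound[OF nf]) (assumption | rule that)+
  obtain p q where "Tb \<le> p" "p \<le> q" "special k p q" "rk n (n - k) (seg p q) \<le> g0"
    using assms[of Tb] by blast
  then show False using Tb(2)[of p q] by simp
qed

lemma E0_large:
  obtains T1 where "T0 \<le> T1" "\<And>I. T1 < I \<Longrightarrow> C < E I 0"
proof
  define T1 where "T1 = T0 + nat \<lceil>exp C\<rceil> + 1"
  show "T0 \<le> T1" by (simp add: T1_def)
  fix I assume I: "T1 < I"
  have "exp C \<le> real (nat \<lceil>exp C\<rceil>)" by (rule real_nat_ceiling_ge)
  also have "\<dots> < real (I - 1)" using I by (simp add: T1_def)
  finally have "exp C < real (I - 1)" .
  then have "C < ln (real (I - 1))" by (metis exp_gt_zero ln_exp ln_less_cancel_iff order_less_trans)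
  moreover have "Zr I 0 = I - 1" using I by (intro Zr_0) (simp add: T1_def)
  ultimately show "C < E I 0" by (simp add: E_def)
qed

lemma first_step_false:
  assumes "lam * real (n - k) > 1" "E I 0 > Kf / (lam * real (n - k) - 1)" "2 * k < n"
    "lam * (real k * E I 0 + (\<Sum>t=1..<1. E I t) + real (n - 2 * k + 1 - 1) * E I 0) \<le> E I 0 + Kf"
  shows False
proof -
  have "real k + real (n - 2 * k) = real (n - k)" using assms(3) by (simp add: of_nat_diff)
  then have "real k * E I 0 + real (n - 2 * k) * E I 0 = real (n - k) * E I 0" by (metis distrib_right)
  then have "lam * (real (n - k) * E I 0) \<le> E I 0 + Kf" using assms(4) by simp
  moreover define c where "c = lam * real (n - k) - 1"
  ultimately have "c * E I 0 \<le> Kf" by (simp add: left_diff_distrib mult.assoc)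
  moreover have "c > 0" "Kf / c < E I 0" using assms(1,2) unfolding c_def by linarith+
  ultimately show False by (simp add: pos_divide_less_eq mult.commute)
qed

text \<open>A good segment for \<open>k = m - 1\<close> would have rank at most \<open>m\<close>.
  This forces \<open>s = 1\<close> in \<open>main_inequality\<close>, where only
  \<open>E I 0\<close> is left.\<close>

lemma no_special_1:
  assumes m: "1 \<le> m" "2 * m \<le> n" and lm: "lam * real (n - (m - 1)) > 1"
    and fr: "frequent (m - 1) g" "g \<le> m"
  shows False
proof -
  obtain T1 where T1: "T0 \<le> T1" "\<And>I. T1 < I \<Longrightarrow> Kf / (lam * real (n - (m - 1)) - 1) < E I 0"
    using E0_large by blast
  have k: "2 * (m - 1) < n" using m by simp
  obtain I q g' where I: "T1 < I" "good (m - 1) I q g'"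
    "\<And>g0. frequent (m - 1) g0 \<Longrightarrow> g' \<le> g0 \<and> (\<exists>G. G \<in> W n g' (seg I q) \<and> G \<notin> W n g' (seg (I - 1) q))"
    by (rule exists_good[OF k, of T1]) (assumption | rule that)+
  have g': "g' \<le> m" using I(3)[OF fr(1)] fr(2) by simp
  obtain s where s: "1 \<le> s" "s \<le> n - 2 * (m - 1)" "s \<le> max 1 (g' - (m - 1))"
    "lam * (real (m - 1) * E I (s - 1) + (\<Sum>t=1..<s. E I t) + real (n - 2 * (m - 1) + 1 - s) * E I 0) \<le> E I (s - 1) + Kf"
    by (rule main_inequality[OF I(2) k])
  have "s = 1" using s(1,3) g' by linarith
  then show False using first_step_false[OF lm T1(2)[OF I(1)] k] s(4) by simp
qed

text \<open>A late point with fewer than \<open>m + 1\<close> independent windows is itself a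
  special segment one level up; if this happened arbitrarily late, \<open>no_special_1\<close> would
  apply.\<close>

lemma rank_eventually:
  assumes m: "1 \<le> m" "2 * m \<le> n" and lm: "lam * real (n - (m - 1)) > 1"
  obtains Tb where "T0 \<le> Tb" "\<And>T. Tb \<le> T \<Longrightarrow> Suc m \<le> rk n (n - m) {z T}"
proof (rule ccontr)
  assume neg: "\<not> thesis"
  have "\<exists>p q. T \<le> p \<and> p \<le> q \<and> special (m - 1) p q \<and> rk n (n - (m - 1)) (seg p q) \<le> m" for T
  proof -
    have "\<exists>p. max T T0 \<le> p \<and> \<not> Suc m \<le> rk n (n - m) {z p}"
    proof (rule ccontr)
      assume "\<not> ?thesis"
      then have "\<And>p. max T T0 \<le> p \<Longrightarrow> Suc m \<le> rk n (n - m) {z p}" by blast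
      then show False using that[of "max T T0"] neg by simp
    qed
    then obtain p where p: "max T T0 \<le> p" "\<not> Suc m \<le> rk n (n - m) {z p}" by blast
    have r: "rk n (n - m) (seg p p) \<le> m" using p(2) by simp
    have "rk n (n - m) (seg p p) \<le> n - m" using r m by simp
    moreover have "rk n (n - m) (seg p p) \<le> m - 1 + rk n n (seg p p)"
      using r rk_single[of p n] p(1) m by simp
    ultimately have "special (m - 1) p p" "rk n (n - (m - 1)) (seg p p) \<le> m"
      using special_of_deficient[of m p p] m r by auto
    then show ?thesis using p(1) by (intro exI[of _ p]) auto
  qed
  then obtain g where "g \<le> m" "frequent (m - 1) g" by (rule frequentI)
  then show False using no_special_1[OF m lm] by blast
qed

text \<open>Rank \<open>m + 1\<close> also allows \<open>s = 2\<close>, so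
  \<open>main_inequality\<close> bounds \<open>E I 1\<close> from below in terms of
  \<open>E I 0\<close>. The bootstrap at the end of the first run bounds it from above, and
  \<open>gap\<close> makes the two incompatible.\<close>

lemma no_special_2:
  assumes m: "1 \<le> m" "2 * m < n" and lm: "lam * real (n - (m - 1)) > 1" and ln2: "lam * real n < 2"
    and gap: "(1 - lam * real m) * (1 - lam) < lam * real m * (lam * real (n - 2 * m + 1))"
    and fr: "frequent (m - 1) g" "g \<le> Suc m"
  shows False
proof -
  have l1: "lam < 1" and lm1: "lam * real m \<le> 1"
  proof -
    have "2 \<le> real n" "2 * real m \<le> real n" using m by simp_all
    then have "lam * 2 \<le> lam * real n" "lam * (2 * real m) \<le> lam * real n"
      using lam by (auto intro!: mult_left_mono)
    then show "lam < 1" "lam * real m \<le> 1" using ln2 by simp_all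
  qed
  have m2: "2 * m \<le> n" and k: "2 * (m - 1) < n" and mn: "m \<le> n" "1 \<le> n" using m by simp_all
  obtain Tb where Tb: "T0 \<le> Tb" "\<And>T. Tb \<le> T \<Longrightarrow> Suc m \<le> rk n (n - m) {z T}"
    using rank_eventually[OF m(1) m2 lm] by blast
  define \<delta> where "\<delta> = lam * real m * (lam * real (n - 2 * m + 1)) - (1 - lam * real m) * (1 - lam)"
  have \<delta>: "\<delta> > 0" using gap by (simp add: \<delta>_def)
  define K where "K = Kb + ln (2 * Gc)"
  define B where "B = (1 - lam * real m) * (1 - lam) * K + lam * real m * Kf"
  obtain T1 where T1: "T0 \<le> T1" "\<And>I. T1 < I \<Longrightarrow> max (Kf / (lam * real (n - (m - 1)) - 1)) (B / \<delta>) < E I 0"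
    using E0_large by blast
  obtain I q g' where I: "max T1 Tb < I" "good (m - 1) I q g'"
    "\<And>g0. frequent (m - 1) g0 \<Longrightarrow> g' \<le> g0 \<and> (\<exists>G. G \<in> W n g' (seg I q) \<and> G \<notin> W n g' (seg (I - 1) q))"
    by (rule exists_good[OF k, of "max T1 Tb"]) (assumption | rule that)+
  have g': "g' \<le> Suc m" using I(3)[OF fr(1)] fr(2) by simp
  obtain G where G: "G \<in> W n g' (seg I q)" "G \<notin> W n g' (seg (I - 1) q)" using I(3)[OF fr(1)] by blast
  have E0: "Kf / (lam * real (n - (m - 1)) - 1) < E I 0" "B / \<delta> < E I 0" using T1(2)[of I] I(1) by simp_all
  have I0: "T0 \<le> I - 1" "T0 \<le> I" "Tb \<le> I" "1 \<le> I" using I(1) Tb(1) by linarith+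
  have Iq: "I \<le> q" using I(2) by (simp add: good_def)
  obtain s where s: "1 \<le> s" "s \<le> n - 2 * (m - 1)" "s \<le> max 1 (g' - (m - 1))"
    "lam * (real (m - 1) * E I (s - 1) + (\<Sum>t=1..<s. E I t) + real (n - 2 * (m - 1) + 1 - s) * E I 0) \<le> E I (s - 1) + Kf"
    by (rule main_inequality[OF I(2) k])
  have "s \<noteq> 1"
  proof
    assume "s = 1"
    then show False using first_step_false[OF lm E0(1) k] s(4) by simp
  qed
  then have s2: "s = 2" using s(1,3) g' m(1) by linarith
  have F: "lam * (real m * E I 1 + real (n - 2 * m + 1) * E I 0) \<le> E I 1 + Kf"
  proof -
    have "n - 2 * (m - 1) + 1 - 2 = n - 2 * m + 1" using m by simp
    moreover have "real (m - 1) * E I 1 + E I 1 = real m * E I 1"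
      using m(1) by (simp add: of_nat_diff algebra_simps)
    moreover have "(\<Sum>t=1..<2. E I t) = E I 1" by (simp add: numeral_2_eq_2)
    ultimately show ?thesis using s(4) unfolding s2 by simp
  qed
  define T where "T = Zr I 1"
  have IT: "I \<le> T" unfolding T_def using Zr_ge_I[OF I0(2)] mn by simp
  have rT: "rk n n (seg I T) \<le> 1" unfolding T_def using Zr_rk_le[OF I0(2)] mn by simp
  have rI: "Suc m \<le> rk n (n - m) {z I}" using Tb(2)[OF I0(3)] .
  have rT': "Suc m \<le> rk n (n - m) {z T}" using Tb(2)[of T] I0(3) IT by simp
  have "Suc (Suc m) \<le> rk n (n - m) (seg (I - 1) T)"
  proof (rule ccontr)
    assume neg: "\<not> ?thesis"
    \<comment> \<open>Without a gain in rank, the windows of \<open>z (I - 1)\<close> impose no new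
      condition on annihilators of those of \<open>z I\<close>. A shift of \<open>G\<close> is such
      an annihilator, yet \<open>G\<close> fails at \<open>z (I - 1)\<close>.\<close>
    have WI: "W n (n - m) {z I} = W n (n - m) (seg (I - 1) T)"
      using neg rI IT by (intro W_eqI) auto
    have dG: "degree G \<le> g'" using G(1) by (simp add: W_iff)
    have GI: "G \<in> W n g' {z I}" using G(1) Iq W_anti[of "{z I}" "seg I q"] by auto
    have gm: "g' \<le> n - m" using g' m by simp
    obtain b where b: "b \<le> n - g'" "pr G (win (z (I - 1)) b) \<noteq> 0"
      using not_in_W_start[OF G I0(4) Iq] by blast
    define t where "t = min b (n - m - g')"
    have t: "t \<le> n - m - g'" "t \<le> b" "b - t \<le> m" using b(1) gm by (auto simp: t_def)
    have "monom 1 t * G \<in> W n (n - m) {z I}"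
      using t gm by (intro W_multiples[OF GI]) auto
    then have "monom 1 t * G \<in> W n (n - m) (seg (I - 1) T)" using WI by simp
    moreover have "z (I - 1) \<in> seg (I - 1) T" using IT by auto
    moreover have "b - t \<le> n - (n - m)" using t(3) mn by simp
    ultimately have "pr (monom 1 t * G) (win (z (I - 1)) (b - t)) = 0" unfolding W_iff by blast
    then show False using b(2) t(2) by (simp add: pr_monom_mult win_win)
  qed
  note boot = boot_inequality[OF I0(1) IT rT mn(1) rT' this l1]
  have "(real m / (1 - lam) - real (1 - 1)) * (lam * E I 1) \<le> E I (1 - 1) - lam * (\<Sum>t=1..<1. E I t) + (Kb + ln (2 * Gc))"
    using boot l1 mn by (intro growth_inequality[OF I0(1)]) (auto simp: T_def)
  then have "real m / (1 - lam) * (lam * E I 1) \<le> E I 0 + K" by (simp add: K_def)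
  then have "(1 - lam) * (real m / (1 - lam) * (lam * E I 1)) \<le> (1 - lam) * (E I 0 + K)"
    using l1 by (intro mult_left_mono) auto
  then have g1: "lam * real m * E I 1 \<le> (1 - lam) * (E I 0 + K)" using l1 by (simp add: mult_ac)
  have "lam * real (n - 2 * m + 1) * E I 0 \<le> (1 - lam * real m) * E I 1 + Kf"
    using F by (simp add: algebra_simps)
  then have "lam * real m * (lam * real (n - 2 * m + 1) * E I 0) \<le> lam * real m * ((1 - lam * real m) * E I 1 + Kf)"
    using lam by (intro mult_left_mono) auto
  also have "\<dots> = (1 - lam * real m) * (lam * real m * E I 1) + lam * real m * Kf" by (simp add: algebra_simps)
  also have "\<dots> \<le> (1 - lam * real m) * ((1 - lam) * (E I 0 + K)) + lam * real m * Kf"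
    using g1 lm1 by (intro add_right_mono mult_left_mono) auto
  finally have "\<delta> * E I 0 \<le> B" by (simp add: \<delta>_def B_def algebra_simps)
  then show False using E0(2) \<delta> by (simp add: field_simps)
qed

text \<open>For late \<open>T\<close> let \<open>I\<close> start the run of points proportional to
  \<open>z T\<close>. Stepping back to \<open>I - 1\<close> must raise the window rank: otherwise
  this segment would be special of rank at most \<open>m + 1\<close>, which
  \<open>no_special_2\<close> excludes for late segments.\<close>

lemma boot_eventually:
  assumes m: "1 \<le> m" "2 * m < n" and lm: "lam * real (n - (m - 1)) > 1" and ln2: "lam * real n < 2"
    and gap: "(1 - lam * real m) * (1 - lam) < lam * real m * (lam * real (n - 2 * m + 1))"
  obtains Tb where "T0 \<le> Tb" "\<And>T. Tb \<le> T \<Longrightarrow> real m / (1 - lam) * (- ln (L T)) \<le> ln (H0 T) + Kb"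
proof -
  have l1: "lam < 1"
  proof -
    have "lam * 2 \<le> lam * real n" using lam m by (intro mult_left_mono) auto
    then show "lam < 1" using ln2 by simp
  qed
  have m2: "2 * m \<le> n" and mn: "m \<le> n" using m by simp_all
  obtain Tb1 where Tb1: "T0 \<le> Tb1" "\<And>T. Tb1 \<le> T \<Longrightarrow> Suc m \<le> rk n (n - m) {z T}"
    using rank_eventually[OF m(1) m2 lm] by blast
  have nf: "\<not> frequent (m - 1) g" if "g < Suc (Suc m)" for g
    using no_special_2[OF m lm ln2 gap, of g] that by auto
  obtain Tb2 where Tb2: "T0 \<le> Tb2"
    "\<And>p q. Tb2 \<le> p \<Longrightarrow> p \<le> q \<Longrightarrow> special (m - 1) p q \<Longrightarrow> Suc (Suc m) \<le> rk n (n - (m - 1)) (seg p q)"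
    by (rule not_frequent_bound[OF nf]) (assumption | rule that)+
  define T1 where "T1 = max Tb1 Tb2"
  have T1: "T0 \<le> T1" using Tb1 by (simp add: T1_def)
  obtain q where q: "q \<ge> T1" "W n n (seg T1 q) = {0}" by (rule full_eventually[OF T1])
  show ?thesis
  proof (rule that[of q])
    show "T0 \<le> q" using T1 q(1) by simp
    fix T assume T: "q \<le> T"
    let ?Q = "\<lambda>I. T1 \<le> I \<and> I \<le> T \<and> rk n n (seg I T) \<le> 1"
    define I where "I = (LEAST I. ?Q I)"
    have "?Q T" using rk_single_le[of n n "z T"] T q(1) by simp
    then have I: "?Q I" unfolding I_def by (rule LeastI)
    have rq: "rk n n (seg T1 q) = Suc n" using q(2) by (simp add: rk_def dm_zero)
    have "I \<noteq> T1"
    proof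
      assume "I = T1"
      then have "rk n n (seg T1 q) \<le> rk n n (seg I T)" using T by (intro rk_mono seg_mono) auto
      then show False using I rq m by simp
    qed
    then have IT: "T1 < I" using I by simp
    have "\<not> ?Q (I - 1)"
      using not_less_Least[of "I - 1" ?Q] IT unfolding I_def[symmetric] by simp
    then have r2: "2 \<le> rk n n (seg (I - 1) T)" using IT I by auto
    have rT: "Suc m \<le> rk n (n - m) {z T}" using Tb1(2)[of T] T q(1) by (simp add: T1_def)
    have "Suc (Suc m) \<le> rk n (n - m) (seg (I - 1) T)"
    proof (rule ccontr)
      assume neg: "\<not> ?thesis"
      have "rk n (n - m) (seg (I - 1) T) \<le> n - m" using neg m by simp
      moreover have "rk n (n - m) (seg (I - 1) T) \<le> m - 1 + rk n n (seg (I - 1) T)" using neg r2 m by simp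
      ultimately have sp: "special (m - 1) (I - 1) T"
        "rk n (n - (m - 1)) (seg (I - 1) T) \<le> rk n (n - m) (seg (I - 1) T)"
        by (rule special_of_deficient[OF m(1) mn])+
      have "Tb2 \<le> I - 1" "I - 1 \<le> T" using IT I by (auto simp: T1_def)
      then have "Suc (Suc m) \<le> rk n (n - (m - 1)) (seg (I - 1) T)" using Tb2(2) sp(1) by blast
      then show False using sp(2) neg by simp
    qed
    then show "real m / (1 - lam) * (- ln (L T)) \<le> ln (H0 T) + Kb"
      using I IT T1 by (intro boot_inequality[OF _ _ _ mn rT _ l1]) auto
  qed
qed

theorem criterion:
  assumes N: "1 < lam * N" and ln2: "lam * real n < 2" and h: "0 < h" "h < 1"
    and j: "n = 2 * k + j" "1 \<le> j" "2 * j \<le> n + 4"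
    and M: "T0 \<le> Tb" "\<And>T. Tb \<le> T \<Longrightarrow> M * (- ln (L T)) \<le> ln (H0 T) + K"
    and R: "\<And>r. 1 \<le> r \<Longrightarrow> r < j \<Longrightarrow> real r - geo_sum h r \<le> M - (1 - h) * N"
    and Fin: "N \<le> real k + geo_sum h j"
  shows False
proof -
  define K' where "K' = K + ln (2 * Gc)"
  define d where "d = lam * N - 1"
  have d: "d > 0" using N by (simp add: d_def)
  have k: "2 * k < n" using j by simp
  obtain T1 where T1: "T0 \<le> T1" "\<And>I. T1 < I \<Longrightarrow> max 0 (max (K' / ((1 - h) * d)) (Kf / d)) < E I 0"
    using E0_large by blast
  obtain I q g where I: "max T1 Tb < I" "good k I q g"
    "\<And>g0. frequent k g0 \<Longrightarrow> g \<le> g0 \<and> (\<exists>G. G \<in> W n g (seg I q) \<and> G \<notin> W n g (seg (I - 1) q))"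
    by (rule exists_good[OF k, of "max T1 Tb"]) (assumption | rule that)+
  have I0: "T0 \<le> I - 1" "T0 \<le> I" "Tb \<le> I" using I(1) M(1) by linarith+
  obtain s where s: "1 \<le> s" "s \<le> n - 2 * k" "s \<le> max 1 (g - k)"
    "lam * (real k * E I (s - 1) + (\<Sum>t=1..<s. E I t) + real (n - 2 * k + 1 - s) * E I 0) \<le> E I (s - 1) + Kf"
    by (rule main_inequality[OF I(2) k])
  have nk: "n - 2 * k = j" using j by simp
  have E0: "0 < E I 0" "K' / ((1 - h) * d) < E I 0" "Kf / d < E I 0" using T1(2)[of I] I(1) by simp_all
  have sgn: "lam * geo_sum h (r - 1) \<le> 1" if "1 \<le> r" "r < j" for r
  proof -
    have "geo_sum h (r - 1) \<le> real (r - 1)" using h by (intro geo_sum_le) auto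
    \<comment> \<open>From \<open>r < j\<close> and \<open>2 * j \<le> n + 4\<close> follows
      \<open>r - 1 \<le> j - 2 \<le> n / 2\<close>; this is the origin of that bound on
      \<open>j\<close>.\<close>
    also have "\<dots> \<le> real n / 2" using that j(3) by (simp add: of_nat_diff)
    finally have "lam * geo_sum h (r - 1) \<le> lam * (real n / 2)" using lam by (intro mult_left_mono) auto
    then show ?thesis using ln2 by simp
  qed
  show False
  proof (rule chain_contradiction[OF h lam N, where e = "E I" and j = j and M = M and K = K' and Kf = Kf and k = k])
    fix r assume "r < j"
    then have "Zr I 0 \<le> Zr I r" using j I0 by (intro Zr_mono) auto
    moreover have "0 < Zr I 0" using Zr_0[OF I0(2)] I0(1) T0 by simp
    ultimately show "E I 0 \<le> E I r" unfolding E_def by (subst ln_le_cancel_iff) auto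
  next
    fix r assume r: "1 \<le> r" "r < j"
    have rn: "r \<le> n" using r j by simp
    have "I \<le> Zr I r" using Zr_ge_I[OF I0(2) r(1) rn] .
    then have Mr: "M * (- ln (L (Zr I r))) \<le> ln (H0 (Zr I r)) + K" using M(2) I0(3) by simp
    have "real (r - 1) \<le> M"
    proof -
      have "geo_sum h r = 1 + (1 - h) * geo_sum h (r - 1)" using geo_sum_Suc_shift[of h "r - 1"] r by simp
      moreover have "(1 - h) * geo_sum h (r - 1) \<le> (1 - h) * N"
      proof (rule mult_left_mono)
        have "lam * geo_sum h (r - 1) \<le> lam * N" using sgn[OF r] N by simp
        then show "geo_sum h (r - 1) \<le> N" using lam by simp
      qed (use h in simp)
      ultimately show ?thesis using R[OF r] r by (simp add: of_nat_diff)
    qed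
    from growth_inequality[OF I0(1) r(1) rn Mr this]
    show "(M - real (r - 1)) * (lam * E I r) \<le> E I (r - 1) - lam * (\<Sum>t=1..<r. E I t) + K'"
      by (simp add: K'_def)
  next
    show "s \<le> j" using s(2) nk by simp
    show "lam * (real k * E I (s - 1) + (\<Sum>t=1..<s. E I t) + real (j + 1 - s) * E I 0) \<le> E I (s - 1) + Kf"
      using s(4) unfolding nk .
    have hd: "(1 - h) * d > 0" using h d by simp
    show "K' < (1 - h) * (lam * N - 1) * E I 0"
      using E0(2) hd unfolding d_def[symmetric] by (simp add: field_simps)
    show "Kf < (lam * N - 1) * E I 0"
      using E0(3) d unfolding d_def[symmetric] by (simp add: field_simps)
  qed (use sgn R Fin s E0 in auto)
qed

end

section \<open>Choice of parameters\<close>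

text \<open>The two alternatives for \<open>M\<close> correspond to \<open>plain_inequality\<close> and \<open>boot_inequality\<close>.\<close>

definition feasible :: "nat \<Rightarrow> real \<Rightarrow> bool" where
  "feasible n N \<longleftrightarrow> (\<exists>h M j k m. 0 < h \<and> h < 1 \<and> n = 2 * k + j \<and> 1 \<le> j \<and> 2 * j \<le> n + 4 \<and>
     (\<forall>r. 1 \<le> r \<longrightarrow> r < j \<longrightarrow> real r - geo_sum h r \<le> M - (1 - h) * N) \<and> N \<le> real k + geo_sum h j \<and>
     1 \<le> m \<and> 2 * m \<le> n \<and> N \<le> real (n - (m - 1)) \<and>
     (M = real m \<or> 2 * m < n \<and> (N - real m) * (N - 1) \<le> real m * real (n - 2 * m + 1) \<and>
        M = real m * N / (N - 1)))"

text \<open>The excess of the claimed denominator over \<open>n / 2\<close>.\<close>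

definition tval :: "nat \<Rightarrow> real" where
  "tval n = (1 - ln 2) / 2 * sqrt (real n) + 1 / 3"

definition geo_closed :: "real \<Rightarrow> nat \<Rightarrow> real" where
  "geo_closed h j = (1 - (1 - h) ^ j) / h"

lemma geo_sum_geo_closed: "h \<noteq> 0 \<Longrightarrow> geo_sum h j = geo_closed h j"
  unfolding geo_sum_def geo_closed_def by (subst sum_gp_strict) auto

text \<open>The terms of the geometric sum are at most 1. So the condition on all
  \<open>r < j\<close> in \<open>feasible\<close> needs checking only at
  \<open>r = j - 1\<close>.\<close>

lemma defect_mono:
  assumes "0 \<le> h" "h \<le> 1" "r \<le> r'"
  shows "real r - geo_sum h r \<le> real r' - geo_sum h r'"
  using assms(3)
proof (induction r' rule: dec_induct)
  case (step r')
  have "(1 - h) ^ r' \<le> 1" using assms by (intro power_le_one) auto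
  then show ?case using step by (simp add: geo_sum_def)
qed simp

text \<open>The slope is 0.15342...; the upper value enters all numerical steps, while the cruder
  lower one only has to keep \<open>tval\<close> away from 0.\<close>

lemma slope_bounds: "15/100 \<le> (1 - ln 2) / (2::real)" "(1 - ln 2) / 2 \<le> (15344/100000 :: real)"
proof -
  have "(\<Sum>k<4. 2 * ((2 - 1) / (2 + 1)) ^ (2 * k + 1) / real (2 * k + 1)) \<le> ln (2::real)"
    using ln_approx_bounds[of 2 4] by auto
  then have "(69313/100000 :: real) \<le> ln 2" by (simp add: eval_nat_numeral)
  then show "(1 - ln 2) / 2 \<le> (15344/100000 :: real)" by simp
  show "15/100 \<le> (1 - ln 2) / (2::real)" using ln2_le_25_over_36 by simp
qed

lemma tval_le: "real n \<le> s ^ 2 \<Longrightarrow> 0 \<le> s \<Longrightarrow> tval n \<le> 15344/100000 * s + 1/3"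
  unfolding tval_def using slope_bounds real_le_lsqrt[of s "real n"]
  by (intro add_mono mult_mono) (auto simp: real_sqrt_le_iff)

lemma tval_ge_half: "2 \<le> n \<Longrightarrow> 1/2 \<le> tval n"
proof -
  assume n: "2 \<le> n"
  have "14/10 \<le> sqrt (real n)" using n by (intro real_le_rsqrt) (simp add: power2_eq_square)
  then have "15/100 * (14/10) \<le> (1 - ln 2) / 2 * sqrt (real n)"
    using slope_bounds by (intro mult_mono) auto
  then show ?thesis by (simp add: tval_def)
qed

lemma half_diff:
  fixes a b :: nat
  assumes "a mod 2 = b mod 2" "b \<le> a"
  shows "2 * ((a - b) div 2) = a - b" "real ((a - b) div 2) = real a / 2 - real b / 2"
proof -
  show *: "2 * ((a - b) div 2) = a - b" using assms by presburger
  then have "2 * real ((a - b) div 2) = real (a - b)" by (metis of_nat_mult of_nat_numeral)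
  then show "real ((a - b) div 2) = real a / 2 - real b / 2" using assms(2) by (simp add: of_nat_diff field_simps)
qed

text \<open>With \<open>d = N - 1\<close> and \<open>y = m\<close> this displays the gain
  \<open>1 - x / d\<close> of the bootstrapped \<open>M\<close> over the plain one.\<close>

lemma mult_Suc_divide:
  fixes d :: real
  assumes "0 < d" "x + y = d"
  shows "y * (d + 1) / d = y + 1 - x / d"
proof -
  have "y / d = 1 - x / d" using assms by (simp add: field_simps)
  moreover have "y * (d + 1) / d = y + y / d" using assms(1) by (simp add: distrib_left add_divide_distrib)
  ultimately show ?thesis by simp
qed

lemma complement_frac_mono:
  fixes d d' :: real
  assumes "0 < d" "0 < d'" "x + y = d" "x' + y' = d'" "y' * d \<le> y * d'"
  shows "x / d \<le> x' / d'"
proof -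
  have "x / d = 1 - y / d" "x' / d' = 1 - y' / d'" using assms by (simp_all add: field_simps)
  moreover have "y' / d' \<le> y / d" using assms(1,2,5) by (simp add: divide_le_eq pos_le_divide_eq)
  ultimately show ?thesis by simp
qed

text \<open>Here \<open>n = 2 * k + j = 2 * m + i\<close>, so \<open>i\<close> and \<open>j\<close>
  have the parity of \<open>n\<close>. With \<open>N = n/2 + t\<close> the conditions on
  \<open>N\<close> turn into \<open>t \<le> i/2 + 1\<close> and
  \<open>t \<le> geo_closed h j - j/2\<close>, free of \<open>n\<close>; only the conditions on
  \<open>M\<close> still involve it.\<close>

lemma feasible_aux:
  assumes n: "n mod 2 = j mod 2" "j mod 2 = i mod 2" "n1 \<le> n" "2 * j \<le> n1 + 4" "i + 2 \<le> n1" "1 \<le> j"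
    and ji: "j \<le> n1"
    and h: "0 < h" "h < 1" and t: "1/2 \<le> t" "t \<le> t2" "t2 \<le> real i / 2 + 1" "t2 \<le> geo_closed h j - real j / 2"
    and M: "real (j - 1) - geo_closed h (j - 1) \<le> M - (1 - h) * (real n / 2 + t)"
    and kind: "M = real ((n - i) div 2) \<or> 1 \<le> i \<and> M = real ((n - i) div 2) * (real n / 2 + t) / (real n / 2 + t - 1) \<and>
      (t + real i / 2) * (real n / 2 + t - 1) \<le> (real n / 2 - real i / 2) * (real i + 1)"
  shows "feasible n (real n / 2 + t)"
  unfolding feasible_def
proof (intro exI conjI allI impI)
  have jn: "j \<le> n" "i + 2 \<le> n" using ji n by simp_all
  have p: "n mod 2 = j mod 2" "n mod 2 = i mod 2" "i \<le> n" using n(1,2) jn(2) by simp_all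
  note e = half_diff(1)[OF p(1) jn(1)] half_diff(1)[OF p(2,3)]
  note ek = half_diff(2)[OF p(1) jn(1)] half_diff(2)[OF p(2,3)]
  define q where "q = (n - i) div 2"
  have q: "2 * q = n - i" "real q = (real n / 2 - real i / 2)" using e(2) ek(2) by (simp_all only: q_def)
  define k where "k = (n - j) div 2"
  have k': "2 * k = n - j" "real k = real n / 2 - real j / 2" using e(1) ek(1) by (simp_all only: k_def)
  have q1: "1 \<le> q" "2 * q \<le> n" "n - 2 * q + 1 = i + 1" "1 \<le> i \<Longrightarrow> 2 * q < n" using q(1) jn(2) by linarith+
  show "0 < h" "h < 1" by fact+
  show "n = 2 * k + j" using k'(1) jn(1) by linarith
  show "1 \<le> j" "2 * j \<le> n + 4" using n(3,4,6) by linarith+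
  show "real r - geo_sum h r \<le> M - (1 - h) * (real n / 2 + t)" if "1 \<le> r" "r < j" for r
  proof -
    have "real r - geo_sum h r \<le> real (j - 1) - geo_sum h (j - 1)" using that h by (intro defect_mono) auto
    then show ?thesis using M h by (simp add: geo_sum_geo_closed)
  qed
  have "geo_sum h j = geo_closed h j" using h by (simp add: geo_sum_geo_closed)
  then show "real n / 2 + t \<le> real k + geo_sum h j" using t(2,4) k'(2) by linarith
  show "1 \<le> q" "2 * q \<le> n" by fact+
  have "real (n - (q - 1)) = real n - (real q - 1)" using q1(1,2) by (simp add: of_nat_diff)
  then show "real n / 2 + t \<le> real (n - (q - 1))" using t(2,3) q(2) by linarith
  have k: "M = real q \<or> 1 \<le> i \<and> M = real q * (real n / 2 + t) / (real n / 2 + t - 1) \<and>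
      (t + real i / 2) * (real n / 2 + t - 1) \<le> (real n / 2 - real i / 2) * (real i + 1)"
    using kind unfolding q_def .
  have a: "real n / 2 + t - real q = t + real i / 2" using q(2) by linarith
  have b: "real (n - 2 * q + 1) = real i + 1" unfolding q1(3) by simp
  show "M = real q \<or> 2 * q < n \<and>
     (real n / 2 + t - real q) * (real n / 2 + t - 1) \<le> real q * real (n - 2 * q + 1) \<and>
     M = real q * (real n / 2 + t) / (real n / 2 + t - 1)"
    unfolding a b
  proof (rule disj_forward[OF k])
    assume c: "1 \<le> i \<and> M = real q * (real n / 2 + t) / (real n / 2 + t - 1) \<and>
      (t + real i / 2) * (real n / 2 + t - 1) \<le> (real n / 2 - real i / 2) * (real i + 1)"
    then have "2 * q < n" by (intro q1(4)) simp
    with c show "2 * q < n \<and> (t + real i / 2) * (real n / 2 + t - 1) \<le> real q * (real i + 1) \<and>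
      M = real q * (real n / 2 + t) / (real n / 2 + t - 1)"
      unfolding q(2)[symmetric] by (intro conjI) (elim conjE; assumption)+
  qed
qed

text \<open>Cumulative, so that each step treats one more range, and split by parity because one
  pair \<open>i\<close>, \<open>j\<close> serves only one residue class.\<close>

definition covered :: "nat \<Rightarrow> nat \<Rightarrow> bool" where
  "covered p u \<longleftrightarrow> (\<forall>n. n mod 2 = p \<longrightarrow> 2 \<le> n \<longrightarrow> n < u \<longrightarrow> feasible n (real n / 2 + tval n))"

text \<open>Every estimate is monotone over the range: \<open>tval n\<close> is bounded through
  \<open>s\<close> at the upper end \<open>n2 - 2\<close>, and \<open>h * n / 2\<close> at the lower
  end \<open>n1\<close>. So rational checks at the ends settle the whole range.\<close>

lemma plain_step:
  fixes s h :: real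
  assumes c: "covered p n1" and par: "p = j mod 2" "j mod 2 = i mod 2"
    and n: "2 * j \<le> n1 + 4" "i + 2 \<le> n1" "1 \<le> j" "j \<le> n1"
    and h: "0 < h" "h < 1" and s: "real n2 - 2 \<le> s ^ 2" "0 \<le> s" and n2: "n2 mod 2 = p"
    and t: "15344/100000 * s + 1/3 \<le> real i / 2 + 1" "15344/100000 * s + 1/3 \<le> geo_closed h j - real j / 2"
    and R: "real (j - 1) - geo_closed h (j - 1) \<le> h * (real n1 / 2) - real i / 2 - (1 - h) * (15344/100000 * s + 1/3)"
  shows "covered p n2"
  unfolding covered_def
proof (intro allI impI)
  fix n assume n': "n mod 2 = p" "2 \<le> n" "n < n2"
  have "n \<noteq> n2 - 1" using n'(1,3) n2 by presburger
  then have nn2: "real n \<le> real n2 - 2" using n'(3) by linarith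
  show "feasible n (real n / 2 + tval n)"
  proof (cases "n < n1")
    case True
    then show ?thesis using c n' by (simp add: covered_def)
  next
    case False
    have tn: "tval n \<le> 15344/100000 * s + 1/3" using nn2 s by (intro tval_le) auto
    have "h * (real n1 / 2) \<le> h * (real n / 2)" using False h by (intro mult_left_mono) auto
    moreover have "(1 - h) * tval n \<le> (1 - h) * (15344/100000 * s + 1/3)" using tn h by (intro mult_left_mono) auto
    moreover have "real ((n - i) div 2) = (real n / 2 - real i / 2)"
      using n'(1) par n(2) False by (intro half_diff(2)) auto
    moreover have "(real n / 2 - real i / 2) - (1 - h) * (real n / 2 + tval n) = h * (real n / 2) - real i / 2 - (1 - h) * tval n"
      by (simp add: algebra_simps)
    ultimately have R': "real (j - 1) - geo_closed h (j - 1) \<le> real ((n - i) div 2) - (1 - h) * (real n / 2 + tval n)"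
      using R by linarith
    have th: "1/2 \<le> tval n" by (rule tval_ge_half[OF n'(2)])
    have nj: "n mod 2 = j mod 2" using n'(1) par(1) by simp
    have "n1 \<le> n" using False by simp
    from feasible_aux[OF nj par(2) this n h th tn t R'] show ?thesis by simp
  qed
qed

text \<open>As in \<open>plain_step\<close>, with the gain of the bootstrapped \<open>M\<close>
  estimated at the ends too. The bootstrap condition spreads from \<open>n1\<close> upwards: per
  unit of \<open>n / 2\<close> its left side grows by \<open>t2 + i/2\<close>, the right side by
  \<open>i + 1\<close>, which is no less as \<open>t2 \<le> i/2 + 1\<close>.\<close>

lemma boot_step:
  fixes s h :: real
  assumes c: "covered p n1" and par: "p = j mod 2" "j mod 2 = i mod 2"
    and n: "2 * j \<le> n1 + 4" "i + 2 \<le> n1" "1 \<le> j" "j \<le> n1" "1 \<le> i"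
    and h: "0 < h" "h < 1" and s: "real n2 - 2 \<le> s ^ 2" "0 \<le> s" and n2: "n2 mod 2 = p"
    and t: "15344/100000 * s + 1/3 \<le> real i / 2 + 1" "15344/100000 * s + 1/3 \<le> geo_closed h j - real j / 2"
    and B: "(15344/100000 * s + 1/3 + real i / 2) * (real n1 / 2 + (15344/100000 * s + 1/3) - 1) \<le>
      (real n1 / 2 - real i / 2) * (real i + 1)"
    and R: "real (j - 1) - geo_closed h (j - 1) \<le> h * (real n1 / 2) - real i / 2 - (1 - h) * (15344/100000 * s + 1/3) +
      1 - (15344/100000 * s + 1/3 - 1 + real i / 2) / (real n1 / 2 + (15344/100000 * s + 1/3) - 1)"
  shows "covered p n2"
  unfolding covered_def
proof (intro allI impI)
  fix n assume n': "n mod 2 = p" "2 \<le> n" "n < n2"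
  have "n \<noteq> n2 - 1" using n'(1,3) n2 by presburger
  then have nn2: "real n \<le> real n2 - 2" using n'(3) by linarith
  define t2 where "t2 = 15344/100000 * s + 1/3"
  define t where "t = tval n"
  show "feasible n (real n / 2 + tval n)"
  proof (cases "n < n1")
    case True
    then show ?thesis using c n' by (simp add: covered_def)
  next
    case False
    have tn: "t \<le> t2" unfolding t_def t2_def using nn2 s by (intro tval_le) auto
    have th: "1/2 \<le> t" unfolding t_def by (rule tval_ge_half[OF n'(2)])
    have nn: "real n1 \<le> real n" "real i \<ge> 1" "real i + 2 \<le> real n1" using False n by simp_all
    have m: "real ((n - i) div 2) = (real n / 2 - real i / 2)"
      using n'(1) par n(2) False by (intro half_diff(2)) auto
    have d: "0 < real n / 2 + t - 1" "0 < real n1 / 2 + t2 - 1" using nn th tn by linarith+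
    have "h * (real n1 / 2) \<le> h * (real n / 2)" using nn h by (intro mult_left_mono) auto
    moreover have "(1 - h) * t \<le> (1 - h) * t2" using tn h by (intro mult_left_mono) auto
    moreover have "(t - 1 + real i / 2) / (real n / 2 + t - 1) \<le> (t2 - 1 + real i / 2) / (real n1 / 2 + t2 - 1)"
    proof (rule complement_frac_mono[OF d])
      have "(real n1 / 2 - real i / 2) * (real n / 2 + t - 1) \<le> (real n1 / 2 - real i / 2) * (real n / 2 + t2 - 1)"
        using nn tn by (intro mult_left_mono) auto
      moreover have "0 \<le> (real n / 2 - real n1 / 2) * (t2 - 1 + real i / 2)"
        using nn tn th by (intro mult_nonneg_nonneg) auto
      moreover have "(real n / 2 - real i / 2) * (real n1 / 2 + t2 - 1) =
          (real n1 / 2 - real i / 2) * (real n / 2 + t2 - 1) + (real n / 2 - real n1 / 2) * (t2 - 1 + real i / 2)"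
        by (simp add: algebra_simps)
      ultimately show "(real n1 / 2 - real i / 2) * (real n / 2 + t - 1) \<le> (real n / 2 - real i / 2) * (real n1 / 2 + t2 - 1)"
        by linarith
    qed simp_all
    moreover have "real ((n - i) div 2) * (real n / 2 + t) / (real n / 2 + t - 1) =
        (real n / 2 - real i / 2) + 1 - (t - 1 + real i / 2) / (real n / 2 + t - 1)"
      using mult_Suc_divide[OF d(1), of "t - 1 + real i / 2" "real n / 2 - real i / 2"] by (simp add: m)
    moreover have "(real n / 2 - real i / 2) - (1 - h) * (real n / 2 + t) = h * (real n / 2) - real i / 2 - (1 - h) * t"
      by (simp add: algebra_simps)
    ultimately have R': "real (j - 1) - geo_closed h (j - 1) \<le>
        real ((n - i) div 2) * (real n / 2 + t) / (real n / 2 + t - 1) - (1 - h) * (real n / 2 + t)"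
      using R unfolding t2_def[symmetric] by linarith
    have "(t + real i / 2) * (real n / 2 + t - 1) \<le> (t2 + real i / 2) * (real n / 2 + t2 - 1)"
      using nn tn th by (intro mult_mono) auto
    also have "\<dots> = (t2 + real i / 2) * (real n1 / 2 + t2 - 1) + (t2 + real i / 2) * (real n / 2 - real n1 / 2)"
      by (simp add: algebra_simps)
    also have "\<dots> \<le> (real n1 / 2 - real i / 2) * (real i + 1) + (real i + 1) * (real n / 2 - real n1 / 2)"
      by (rule add_mono[OF B[folded t2_def] mult_right_mono]) (use t(1)[folded t2_def] nn in linarith)+
    also have "\<dots> = (real n / 2 - real i / 2) * (real i + 1)" by (simp add: algebra_simps)
    finally have B': "(t + real i / 2) * (real n / 2 + t - 1) \<le> (real n / 2 - real i / 2) * (real i + 1)" .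
    have nj: "n mod 2 = j mod 2" using n'(1) par(1) by simp
    have "n1 \<le> n" using False by simp
    from feasible_aux[OF nj par(2) this n(1-4) h th tn t[folded t2_def] R'] show ?thesis
      unfolding t_def[symmetric] using n(5) B' by simp
  qed
qed

text \<open>The parameters of the following steps were found by a numerical search; \<open>s\<close> bounds the square roots of
  the \<open>n\<close> covered by the step.\<close>

lemma covered_even: "covered 0 7954"
proof -
  have "covered 0 2" by (auto simp: covered_def)
  then have "covered 0 4"
    by (rule plain_step[where i=0 and j=2 and h="56/125" and s="71/50"]) (simp_all add: geo_closed_def power_divide)
  then have "covered 0 8"
    by (rule plain_step[where i=0 and j=2 and h="29/100" and s="49/20"]) (simp_all add: geo_closed_def power_divide)
  then have "covered 0 12"
    by (rule plain_step[where i=0 and j=2 and h="9/50" and s="317/100"]) (simp_all add: geo_closed_def power_divide)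
  then have "covered 0 14"
    by (rule plain_step[where i=0 and j=2 and h="67/500" and s="347/100"]) (simp_all add: geo_closed_def power_divide)
  then have "covered 0 20"
    by (rule plain_step[where i=0 and j=4 and h="24/125" and s="17/4"]) (simp_all add: geo_closed_def power_divide)
  then have "covered 0 30"
    by (rule boot_step[where i=2 and j=4 and h="79/500" and s="53/10"]) (simp_all add: geo_closed_def power_divide)
  then have "covered 0 48"
    by (rule boot_step[where i=2 and j=4 and h="14/125" and s="679/100"]) (simp_all add: geo_closed_def power_divide)
  then have "covered 0 74"
    by (rule boot_step[where i=2 and j=6 and h="13/125" and s="849/100"]) (simp_all add: geo_closed_def power_divide)
  then have "covered 0 100"
    by (rule boot_step[where i=2 and j=6 and h="17/200" and s="99/10"]) (simp_all add: geo_closed_def power_divide)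
  then have "covered 0 122"
    by (rule boot_step[where i=4 and j=6 and h="9/125" and s="274/25"]) (simp_all add: geo_closed_def power_divide)
  then have "covered 0 150"
    by (rule boot_step[where i=4 and j=8 and h="37/500" and s="1217/100"]) (simp_all add: geo_closed_def power_divide)
  then have "covered 0 198"
    by (rule boot_step[where i=4 and j=8 and h="61/1000" and s="14"]) (simp_all add: geo_closed_def power_divide)
  then have "covered 0 262"
    by (rule boot_step[where i=4 and j=10 and h="7/125" and s="1613/100"]) (simp_all add: geo_closed_def power_divide)
  then have "covered 0 308"
    by (rule boot_step[where i=6 and j=10 and h="1/20" and s="35/2"]) (simp_all add: geo_closed_def power_divide)
  then have "covered 0 368"
    by (rule boot_step[where i=6 and j=10 and h="43/1000" and s="957/50"]) (simp_all add: geo_closed_def power_divide)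
  then have "covered 0 462"
    by (rule boot_step[where i=6 and j=12 and h="41/1000" and s="429/20"]) (simp_all add: geo_closed_def power_divide)
  then have "covered 0 522"
    by (rule plain_step[where i=6 and j=12 and h="37/1000" and s="2281/100"]) (simp_all add: geo_closed_def power_divide)
  then have "covered 0 598"
    by (rule boot_step[where i=8 and j=14 and h="37/1000" and s="1221/50"]) (simp_all add: geo_closed_def power_divide)
  then have "covered 0 714"
    by (rule boot_step[where i=8 and j=14 and h="4/125" and s="2669/100"]) (simp_all add: geo_closed_def power_divide)
  then have "covered 0 850"
    by (rule boot_step[where i=8 and j=16 and h="3/100" and s="2913/100"]) (simp_all add: geo_closed_def power_divide)
  then have "covered 0 952"
    by (rule boot_step[where i=10 and j=18 and h="3/100" and s="3083/100"]) (simp_all add: geo_closed_def power_divide)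
  then have "covered 0 1094"
    by (rule boot_step[where i=10 and j=18 and h="27/1000" and s="661/20"]) (simp_all add: geo_closed_def power_divide)
  then have "covered 0 1272"
    by (rule boot_step[where i=10 and j=18 and h="23/1000" and s="891/25"]) (simp_all add: geo_closed_def power_divide)
  then have "covered 0 1452"
    by (rule boot_step[where i=12 and j=20 and h="23/1000" and s="952/25"]) (simp_all add: geo_closed_def power_divide)
  then have "covered 0 1672"
    by (rule boot_step[where i=12 and j=24 and h="23/1000" and s="4087/100"]) (simp_all add: geo_closed_def power_divide)
  then have "covered 0 1892"
    by (rule boot_step[where i=14 and j=24 and h="21/1000" and s="1087/25"]) (simp_all add: geo_closed_def power_divide)
  then have "covered 0 2140"
    by (rule boot_step[where i=14 and j=26 and h="1/50" and s="1156/25"]) (simp_all add: geo_closed_def power_divide)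
  then have "covered 0 2374"
    by (rule boot_step[where i=14 and j=24 and h="17/1000" and s="4871/100"]) (simp_all add: geo_closed_def power_divide)
  then have "covered 0 2662"
    by (rule boot_step[where i=16 and j=30 and h="9/500" and s="2579/50"]) (simp_all add: geo_closed_def power_divide)
  then have "covered 0 3044"
    by (rule boot_step[where i=16 and j=32 and h="17/1000" and s="1379/25"]) (simp_all add: geo_closed_def power_divide)
  then have "covered 0 3418"
    by (rule boot_step[where i=18 and j=30 and h="3/200" and s="1169/20"]) (simp_all add: geo_closed_def power_divide)
  then have "covered 0 3810"
    by (rule boot_step[where i=18 and j=32 and h="7/500" and s="6171/100"]) (simp_all add: geo_closed_def power_divide)
  then have "covered 0 4332"
    by (rule boot_step[where i=20 and j=36 and h="7/500" and s="6581/100"]) (simp_all add: geo_closed_def power_divide)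
  then have "covered 0 4740"
    by (rule plain_step[where i=20 and j=36 and h="13/1000" and s="1721/25"]) (simp_all add: geo_closed_def power_divide)
  then have "covered 0 5384"
    by (rule boot_step[where i=22 and j=38 and h="3/250" and s="7337/100"]) (simp_all add: geo_closed_def power_divide)
  then have "covered 0 5978"
    by (rule boot_step[where i=24 and j=38 and h="11/1000" and s="7731/100"]) (simp_all add: geo_closed_def power_divide)
  then have "covered 0 6602"
    by (rule boot_step[where i=24 and j=44 and h="11/1000" and s="325/4"]) (simp_all add: geo_closed_def power_divide)
  then have "covered 0 7290"
    by (rule boot_step[where i=26 and j=42 and h="1/100" and s="8537/100"]) (simp_all add: geo_closed_def power_divide)
  then have "covered 0 7954"
    by (rule boot_step[where i=28 and j=46 and h="1/100" and s="4459/50"]) (simp_all add: geo_closed_def power_divide)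
  then show ?thesis .
qed

lemma covered_odd: "covered 1 7465"
proof -
  have "covered 1 3" by (auto simp: covered_def dest!: le_neq_implies_less)
  then have "covered 1 7"
    by (rule boot_step[where i=1 and j=3 and h="61/200" and s="56/25"]) (simp_all add: geo_closed_def power_divide)
  then have "covered 1 19"
    by (rule boot_step[where i=1 and j=3 and h="189/1000" and s="413/100"]) (simp_all add: geo_closed_def power_divide)
  then have "covered 1 37"
    by (rule boot_step[where i=1 and j=3 and h="11/125" and s="148/25"]) (simp_all add: geo_closed_def power_divide)
  then have "covered 1 49"
    by (rule boot_step[where i=1 and j=5 and h="63/500" and s="343/50"]) (simp_all add: geo_closed_def power_divide)
  then have "covered 1 65"
    by (rule boot_step[where i=3 and j=5 and h="21/200" and s="397/50"]) (simp_all add: geo_closed_def power_divide)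
  then have "covered 1 85"
    by (rule boot_step[where i=3 and j=5 and h="83/1000" and s="228/25"]) (simp_all add: geo_closed_def power_divide)
  then have "covered 1 117"
    by (rule boot_step[where i=3 and j=7 and h="41/500" and s="1073/100"]) (simp_all add: geo_closed_def power_divide)
  then have "covered 1 167"
    by (rule boot_step[where i=3 and j=7 and h="63/1000" and s="257/20"]) (simp_all add: geo_closed_def power_divide)
  then have "covered 1 197"
    by (rule plain_step[where i=3 and j=9 and h="13/200" and s="1397/100"]) (simp_all add: geo_closed_def power_divide)
  then have "covered 1 243"
    by (rule boot_step[where i=5 and j=9 and h="7/125" and s="1553/100"]) (simp_all add: geo_closed_def power_divide)
  then have "covered 1 305"
    by (rule boot_step[where i=5 and j=9 and h="23/500" and s="1741/100"]) (simp_all add: geo_closed_def power_divide)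
  then have "covered 1 379"
    by (rule boot_step[where i=5 and j=11 and h="9/200" and s="971/50"]) (simp_all add: geo_closed_def power_divide)
  then have "covered 1 439"
    by (rule boot_step[where i=7 and j=11 and h="1/25" and s="2091/100"]) (simp_all add: geo_closed_def power_divide)
  then have "covered 1 527"
    by (rule boot_step[where i=7 and j=13 and h="39/1000" and s="573/25"]) (simp_all add: geo_closed_def power_divide)
  then have "covered 1 653"
    by (rule boot_step[where i=7 and j=15 and h="9/250" and s="638/25"]) (simp_all add: geo_closed_def power_divide)
  then have "covered 1 739"
    by (rule plain_step[where i=7 and j=15 and h="4/125" and s="543/20"]) (simp_all add: geo_closed_def power_divide)
  then have "covered 1 867"
    by (rule boot_step[where i=9 and j=17 and h="31/1000" and s="1471/50"]) (simp_all add: geo_closed_def power_divide)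
  then have "covered 1 1039"
    by (rule boot_step[where i=9 and j=17 and h="27/1000" and s="3221/100"]) (simp_all add: geo_closed_def power_divide)
  then have "covered 1 1199"
    by (rule boot_step[where i=11 and j=19 and h="13/500" and s="173/5"]) (simp_all add: geo_closed_def power_divide)
  then have "covered 1 1389"
    by (rule boot_step[where i=11 and j=21 and h="3/125" and s="149/4"]) (simp_all add: geo_closed_def power_divide)
  then have "covered 1 1531"
    by (rule plain_step[where i=11 and j=23 and h="3/125" and s="3911/100"]) (simp_all add: geo_closed_def power_divide)
  then have "covered 1 1725"
    by (rule boot_step[where i=13 and j=23 and h="11/500" and s="4151/100"]) (simp_all add: geo_closed_def power_divide)
  then have "covered 1 1961"
    by (rule boot_step[where i=13 and j=23 and h="19/1000" and s="4427/100"]) (simp_all add: geo_closed_def power_divide)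
  then have "covered 1 2213"
    by (rule boot_step[where i=15 and j=25 and h="19/1000" and s="4703/100"]) (simp_all add: geo_closed_def power_divide)
  then have "covered 1 2521"
    by (rule boot_step[where i=15 and j=27 and h="9/500" and s="5019/100"]) (simp_all add: geo_closed_def power_divide)
  then have "covered 1 2833"
    by (rule plain_step[where i=15 and j=29 and h="17/1000" and s="5321/100"]) (simp_all add: geo_closed_def power_divide)
  then have "covered 1 3259"
    by (rule boot_step[where i=17 and j=31 and h="2/125" and s="1427/25"]) (simp_all add: geo_closed_def power_divide)
  then have "covered 1 3679"
    by (rule boot_step[where i=19 and j=33 and h="3/200" and s="1516/25"]) (simp_all add: geo_closed_def power_divide)
  then have "covered 1 4217"
    by (rule boot_step[where i=19 and j=35 and h="7/500" and s="6493/100"]) (simp_all add: geo_closed_def power_divide)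
  then have "covered 1 4779"
    by (rule boot_step[where i=21 and j=37 and h="13/1000" and s="1728/25"]) (simp_all add: geo_closed_def power_divide)
  then have "covered 1 5317"
    by (rule boot_step[where i=23 and j=37 and h="3/250" and s="7291/100"]) (simp_all add: geo_closed_def power_divide)
  then have "covered 1 6027"
    by (rule boot_step[where i=23 and j=43 and h="3/250" and s="7763/100"]) (simp_all add: geo_closed_def power_divide)
  then have "covered 1 6717"
    by (rule boot_step[where i=25 and j=43 and h="11/1000" and s="1639/20"]) (simp_all add: geo_closed_def power_divide)
  then have "covered 1 7465"
    by (rule boot_step[where i=27 and j=43 and h="1/100" and s="8639/100"]) (simp_all add: geo_closed_def power_divide)
  then show ?thesis .
qed

lemma parity_choice:
  fixes x :: real
  assumes "0 \<le> x"
  obtains i :: nat where "i mod 2 = n mod 2" "x \<le> real i" "real i \<le> x + 2"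
proof -
  define c where "c = nat \<lceil>x\<rceil>"
  have c: "x \<le> real c" "real c \<le> x + 1" using assms unfolding c_def by linarith+
  show ?thesis
  proof (cases "c mod 2 = n mod 2")
    case True
    then show ?thesis using c by (intro that[of c]) auto
  next
    case False
    then have "Suc c mod 2 = n mod 2" by presburger
    then show ?thesis using c by (intro that[of "Suc c"]) auto
  qed
qed

text \<open>Plain choice of \<open>M\<close> with \<open>h * j = 1/2\<close>. As exp (-1/2) <
  0.6067, \<open>geo_closed h j\<close> is at least 2 (1 - 0.6067) j = 0.7866 j. This gives 0.2866 =
  0.7866 - 1/2 in the choice of \<open>j\<close>, and 0.2134 = 1 - 0.7866 in the defect.\<close>

lemma feasible_large:
  assumes n: "7400 \<le> n"
  shows "feasible n (real n / 2 + tval n)"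
proof -
  define s where "s = sqrt (real n)"
  define t where "t = tval n"
  have s2: "s * s = real n" by (simp add: s_def)
  have s86: "86 \<le> s" unfolding s_def using n by (intro real_le_rsqrt) (simp add: power2_eq_square)
  have t_le: "t \<le> 15344/100000 * s + 1/3" unfolding t_def by (rule tval_le) (simp_all add: s_def)
  have t_ge: "15/100 * s + 1/3 \<le> t"
    unfolding t_def tval_def s_def using slope_bounds by (intro add_mono mult_right_mono) auto
  have t10: "10 \<le> t" using t_ge s86 by linarith
  obtain i :: nat where i: "i mod 2 = n mod 2" "2 * t - 2 \<le> real i" "real i \<le> 2 * t"
    using parity_choice[of "2 * t - 2" n] t10 by auto
  obtain j :: nat where j: "j mod 2 = n mod 2" "t / (2866/10000) \<le> real j" "real j \<le> t / (2866/10000) + 2"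
    using parity_choice[of "t / (2866/10000)" n] t10 by auto
  have "0 < t / (2866/10000)" using t10 by simp
  then have "0 < real j" using j(2) by linarith
  then have j0: "1 \<le> j" by simp
  \<comment> \<open>0.15344 / 0.2866 < 0.5354 and (1/3) / 0.2866 + 2 < 3.1632.\<close>
  have js: "real j \<le> 5354/10000 * s + 31632/10000" using j(3) t_le by simp
  have ns: "86 * s \<le> real n" using mult_right_mono[OF s86, of s] s86 s2 by simp
  have jn: "2 * j \<le> n" "j \<le> n" using js ns s86 by linarith+
  have inn: "i + 2 \<le> n"
  proof -
    have "real i + 2 \<le> real n" using i(3) t_le ns s86 by linarith
    then show ?thesis by linarith
  qed
  define h where "h = 1 / (2 * real j)"
  have h: "0 < h" "h < 1" using j0 by (auto simp: h_def)
  have "(1 - h) ^ j \<le> exp (- h) ^ j"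
    using h exp_ge_add_one_self[of "- h"] by (intro power_mono) auto
  also have "\<dots> = exp (- (1/2))" using j0 by (simp add: h_def exp_of_nat_mult[symmetric])
  also have "\<dots> \<le> 6067/10000"
  proof -
    obtain u where "exp (1/2 :: real) = (\<Sum>k<5. (1/2) ^ k / fact k) + exp u / fact 5 * (1/2) ^ 5"
      using Maclaurin_exp_le[of "1/2 :: real" 5] by blast
    then have "(\<Sum>k<5. (1/2 :: real) ^ k / fact k) \<le> exp (1/2)" by simp
    then have "(10000/6067 :: real) \<le> exp (1/2)" by (simp add: eval_nat_numeral)
    then show ?thesis by (simp add: exp_minus field_simps)
  qed
  finally have pw: "(1 - h) ^ j \<le> 6067/10000" .
  have g: "7866/10000 * real j \<le> geo_closed h j"
    using pw j0 by (simp add: geo_closed_def h_def field_simps)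
  have gm: "real (j - 1) - geo_closed h (j - 1) \<le> real j - geo_closed h j"
    using defect_mono[of h "j - 1" j] h by (simp add: geo_sum_geo_closed)
  \<comment> \<open>Since \<open>h * n / 2 = n / (4 * j)\<close>, this is the condition
    \<open>R\<close> multiplied by \<open>j\<close>. Its leading coefficient, about 0.2255, is below
    1/4, and the other terms are absorbed from \<open>s = 86\<close> on; hence the threshold 7400,
    just above the square of 86.\<close>
  have quad: "(2134/10000 * real j + 2 * t) * real j \<le> real n / 4"
  proof -
    have "(2134/10000 * real j + 2 * t) * real j \<le>
        (2134/10000 * (5354/10000 * s + 31632/10000) + 2 * (15344/100000 * s + 1/3)) * (5354/10000 * s + 31632/10000)"
      using js t_le t10 s86 by (intro mult_mono add_mono mult_left_mono) auto
    also have "\<dots> = 28184417043/125000000000 * (s * s) + 48058006229/23437500000 * s + 8289150443/1953125000" by (simp add: algebra_simps)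
    also have "\<dots> \<le> s * s / 4"
    proof -
      have "86 * s \<le> s * s" by (rule mult_right_mono[OF s86]) (use s86 in simp)
      then show ?thesis using s86 by linarith
    qed
    finally show ?thesis by (simp add: s2)
  qed
  have R: "real (j - 1) - geo_closed h (j - 1) \<le> real ((n - i) div 2) - (1 - h) * (real n / 2 + t)"
  proof -
    have "2134/10000 * real j + 2 * t \<le> real n / 4 / real j"
      using quad j0 by (simp add: pos_le_divide_eq)
    also have "\<dots> = h * (real n / 2)" by (simp add: h_def)
    finally have 1: "2134/10000 * real j + 2 * t \<le> h * (real n / 2)" .
    have "real ((n - i) div 2) = (real n / 2 - real i / 2)"
      using i(1) inn by (intro half_diff(2)) auto
    moreover have "0 \<le> h * t" using h t10 by simp
    moreover have "(real n / 2 - real i / 2) - (1 - h) * (real n / 2 + t) = h * (real n / 2) - real i / 2 - t + h * t"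
      by (simp add: algebra_simps)
    ultimately show ?thesis using 1 g gm i(3) by linarith
  qed
  have ji: "n mod 2 = j mod 2" "j mod 2 = i mod 2" using i(1) j(1) by simp_all
  have jb: "2 * j \<le> n + 4" using jn(1) by simp
  have tt: "1/2 \<le> t" "t \<le> real i / 2 + 1" "t \<le> geo_closed h j - real j / 2"
  proof -
    have "t \<le> 2866/10000 * real j" using j(2) by (simp add: field_simps)
    then show "t \<le> geo_closed h j - real j / 2" using g by linarith
  qed (use t10 i(2) in linarith)+
  from feasible_aux[OF ji order_refl jb inn j0 jn(2) h tt(1) order_refl tt(2,3) R disjI1[OF refl]]
  show ?thesis by (simp add: t_def)
qed

theorem feasible_all: "2 \<le> n \<Longrightarrow> feasible n (real n / 2 + tval n)"
proof (cases "7400 \<le> n")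
  case False
  assume n: "2 \<le> n"
  have "n mod 2 = 0 \<or> n mod 2 = 1" by presburger
  then show ?thesis using covered_even covered_odd False n by (auto simp: covered_def)
qed (rule feasible_large)

section \<open>The theorem\<close>

lemma real_ring_simps:
  "carrier real_ring = UNIV" "mult real_ring = (*)" "one real_ring = 1" "zero real_ring = 0" "add real_ring = (+)"
  by (simp_all add: ring_of_type_algebra_def)

lemma field_real_ring: "field real_ring"
  by (rule field_from_type_algebra)

lemma subfield_Rats: "subfield \<rat> real_ring"
proof -
  interpret field real_ring by (rule field_real_ring)
  have "subring \<rat> real_ring"
  proof (rule subringI)
    show "\<ominus>\<^bsub>real_ring\<^esub> x \<in> \<rat>" if "x \<in> \<rat>" for x
    proof -
      have "\<ominus>\<^bsub>real_ring\<^esub> x = - x" by (rule minus_equality) (simp_all add: real_ring_simps)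
      then show ?thesis using that by simp
    qed
  qed (auto simp: real_ring_simps)
  then show ?thesis
  proof (rule subfieldI')
    fix x assume x: "x \<in> \<rat> - {\<zero>\<^bsub>real_ring\<^esub>}"
    have "inv\<^bsub>real_ring\<^esub> x = inverse x"
      by (rule comm_inv_char) (use x in \<open>auto simp: real_ring_simps\<close>)
    then show "inv\<^bsub>real_ring\<^esub> x \<in> \<rat>" using x by simp
  qed
qed

text \<open>The polynomials of \<open>HOL-Algebra\<close> list the leading coefficient first, hence
  the \<open>rev\<close>.\<close>

lemma eval_coeffs: "ring.eval real_ring (rev (coeffs Q)) x = poly Q x"
proof -
  interpret field real_ring by (rule field_real_ring)
  show ?thesis
  proof (induction Q rule: pCons_induct)
    case (pCons a Q)
    have "rev (coeffs (pCons a Q)) = rev (coeffs Q) @ [a]"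
      using pCons.hyps by (auto simp: coeffs_pCons_eq_cCons cCons_def)
    moreover have "eval (rev (coeffs Q) @ [a]) x = eval (rev (coeffs Q)) x * x + a"
      using eval_append_aux[of "rev (coeffs Q)" a x] by (simp add: real_ring_simps)
    ultimately show ?case using pCons.IH by simp
  qed (simp add: real_ring_simps)
qed

text \<open>A root would make \<open>\<xi>\<close> algebraic with a minimal polynomial of degree at
  most \<open>n\<close>. Then \<open>rat_adjoin \<xi>\<close> would be the simple extension, whose
  dimension is that degree.\<close>

lemma no_small_root:
  fixes P :: "int poly"
  assumes deg: "extension_degree real_ring \<rat> (rat_adjoin \<xi>) > enat n"
    and P: "degree P \<le> n" "P \<noteq> 0"
  shows "poly (map_poly real_of_int P) \<xi> \<noteq> 0"
proof
  define Q where "Q = map_poly real_of_int P"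
  define p where "p = rev (coeffs Q)"
  assume "poly (map_poly real_of_int P) \<xi> = 0"
  then have Q\<xi>: "poly Q \<xi> = 0" by (simp add: Q_def)
  have Q0: "Q \<noteq> 0" using P(2) unfolding Q_def by (subst map_poly_eq_0_iff) auto
  have dQ: "degree Q = degree P" unfolding Q_def by (intro degree_map_poly) simp
  have p0: "p \<noteq> []" using Q0 by (simp add: p_def)
  have len: "length p - 1 \<le> n" using Q0 P(1) by (simp add: p_def length_coeffs dQ)
  have "coeff Q i \<in> \<rat>" for i unfolding Q_def by (simp add: coeff_map_poly)
  then have sub: "set p \<subseteq> \<rat>" unfolding p_def set_rev coeffs_def by (auto split: if_splits)
  have hd: "hd p \<noteq> 0" using Q0 unfolding p_def by (simp add: hd_rev last_coeffs_eq_coeff_degree)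
  interpret field real_ring by (rule field_real_ring)
  have ev: "eval p \<xi> = \<zero>\<^bsub>real_ring\<^esub>" using Q\<xi> by (simp add: p_def eval_coeffs real_ring_simps)
  have pc: "p \<in> carrier (\<rat>[X]\<^bsub>real_ring\<^esub>)"
    unfolding univ_poly_carrier[symmetric] polynomial_def using sub hd by (simp add: real_ring_simps)
  have xc: "\<xi> \<in> carrier real_ring" by (simp add: real_ring_simps)
  have alg: "(algebraic over \<rat>) \<xi>" by (rule algebraicI[OF pc p0 ev])
  have SE: "subfield (simple_extension \<rat> \<xi>) real_ring"
    using simple_extension_is_subfield[OF subfield_Rats xc] alg by simp
  have "rat_adjoin \<xi> \<subseteq> simple_extension \<rat> \<xi>"
    unfolding rat_adjoin_def
  proof (rule generate_field_min_subfield1[OF _ SE])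
    show "insert \<xi> \<rat> \<subseteq> carrier real_ring" by (simp add: real_ring_simps)
    show "insert \<xi> \<rat> \<subseteq> simple_extension \<rat> \<xi>"
      using simple_extension_incl[of \<rat> \<xi>] simple_extension_mem[OF subfieldE(1)[OF subfield_Rats] xc]
      by (simp add: real_ring_simps)
  qed
  moreover have "simple_extension \<rat> \<xi> \<subseteq> rat_adjoin \<xi>"
    unfolding rat_adjoin_def
  proof (rule simple_extension_subring_incl)
    show "subring (generate_field real_ring (insert \<xi> \<rat>)) real_ring"
      by (intro subfieldE(1) generate_field_is_subfield) (simp add: real_ring_simps)
  qed (auto intro: generate_field.incl)
  ultimately have eq: "rat_adjoin \<xi> = simple_extension \<rat> \<xi>" by blast
  have fd: "finite_dimension \<rat> (rat_adjoin \<xi>)"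
    unfolding eq using finite_dimension_simple_extension[OF subfield_Rats xc] alg by simp
  have "dim \<rat> (rat_adjoin \<xi>) = length (Irr \<rat> \<xi>) - 1"
    unfolding eq using simple_extension_dim[OF subfield_Rats xc alg] by (simp add: over_def)
  also have "\<dots> \<le> length p - 1"
    by (rule pdivides_imp_degree_le[OF subfieldE(1)[OF subfield_Rats] IrrE(1)[OF subfield_Rats xc alg] pc p0
          Irr_minimal[OF subfield_Rats xc alg pc ev]])
  also have "\<dots> \<le> n" by (rule len)
  finally have "extension_degree real_ring \<rat> (rat_adjoin \<xi>) \<le> enat n"
    using fd by (simp add: extension_degree_def)
  then show False using deg by simp
qed

section \<open>Existence of best approximations\<close>

definition rounded :: "nat \<Rightarrow> real \<Rightarrow> int \<Rightarrow> nat \<Rightarrow> int" where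
  "rounded n \<xi> a = (\<lambda>k. round (real_of_int a * \<xi> ^ k))"

lemma rounded_0 [simp]: "rounded n \<xi> a 0 = a"
  by (simp add: rounded_def)

lemma lerr_rounded_le:
  assumes "n \<ge> 1" "x 0 = a"
  shows "lerr n \<xi> (rounded n \<xi> a) \<le> lerr n \<xi> x"
proof -
  have "\<bar>real_of_int a * \<xi> ^ k - real_of_int (rounded n \<xi> a k)\<bar> \<le> lerr n \<xi> x" if "k \<in> {1..n}" for k
  proof -
    have "\<bar>real_of_int a * \<xi> ^ k - real_of_int (rounded n \<xi> a k)\<bar> \<le> \<bar>real_of_int a * \<xi> ^ k - real_of_int (x k)\<bar>"
      unfolding rounded_def by (rule round_diff_minimal)
    also have "\<dots> \<le> lerr n \<xi> x" using lerr_ge[of k n x \<xi>] that assms(2) by simp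
    finally show ?thesis .
  qed
  then show ?thesis unfolding lerr_def[of n \<xi> "rounded n \<xi> a"] using assms(1) by (subst Max_le_iff) auto
qed

lemma lerr_rounded_half:
  assumes "n \<ge> 1"
  shows "lerr n \<xi> (rounded n \<xi> a) \<le> 1 / 2"
proof -
  have "\<bar>real_of_int a * \<xi> ^ k - real_of_int (rounded n \<xi> a k)\<bar> \<le> 1 / 2" for k
    unfolding rounded_def using of_int_round_abs_le[of "real_of_int a * \<xi> ^ k"] by linarith
  then show ?thesis unfolding lerr_def using assms by (subst Max_le_iff) auto
qed

lemma lerr_ge_1:
  assumes "x 0 = 0" "k \<le> n" "x k \<noteq> 0"
  shows "1 \<le> lerr n \<xi> x"
proof -
  have "1 \<le> k" using assms by (cases k) auto
  then have "\<bar>real_of_int (x k)\<bar> \<le> lerr n \<xi> x" using lerr_ge[of k n x \<xi>] assms by simp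
  moreover have "1 \<le> \<bar>real_of_int (x k)\<bar>" using assms(3) by linarith
  ultimately show ?thesis by linarith
qed

text \<open>The second minimisation, of the absolute value among all minimisers, makes the heights
  of the best approximations monotone.\<close>

lemma exists_least_minimizer:
  fixes f :: "int \<Rightarrow> real"
  assumes "1 \<le> T"
  shows "\<exists>a. a \<noteq> 0 \<and> \<bar>a\<bar> \<le> int T \<and> (\<forall>b. b \<noteq> 0 \<longrightarrow> \<bar>b\<bar> \<le> int T \<longrightarrow> f a \<le> f b \<and> (f b \<le> f a \<longrightarrow> \<bar>a\<bar> \<le> \<bar>b\<bar>))"
proof -
  let ?S = "{- int T..int T} - {0}"
  have fin: "finite ?S" "?S \<noteq> {}" using assms by auto
  obtain c where c: "c \<in> ?S" "\<And>b. b \<in> ?S \<Longrightarrow> f c \<le> f b"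
    using arg_min_if_finite[OF fin, of f] by (metis not_le)
  obtain a where a: "a \<in> ?S \<and> f a \<le> f c" "\<And>b. b \<in> ?S \<and> f b \<le> f c \<Longrightarrow> nat \<bar>a\<bar> \<le> nat \<bar>b\<bar>"
    using ex_has_least_nat[of "\<lambda>b. b \<in> ?S \<and> f b \<le> f c" c "\<lambda>b. nat \<bar>b\<bar>"] c(1) by blast
  show ?thesis
  proof (intro exI[of _ a] conjI allI impI)
    show "a \<noteq> 0" "\<bar>a\<bar> \<le> int T" using a(1) by auto
    fix b :: int assume b: "b \<noteq> 0" "\<bar>b\<bar> \<le> int T"
    then have bS: "b \<in> ?S" by auto
    show "f a \<le> f b" using a(1) c(2)[OF bS] by linarith
    assume "f b \<le> f a"
    then have "nat \<bar>a\<bar> \<le> nat \<bar>b\<bar>" using a(2)[of b] bS a(1) by force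
    then show "\<bar>a\<bar> \<le> \<bar>b\<bar>" by linarith
  qed
qed

text \<open>For given \<open>x 0\<close> the nearest integers are optimal, which leaves a finite
  choice of nonzero \<open>x 0\<close>. A nonzero point with \<open>x 0 = 0\<close> has error at
  least 1 and loses against rounding, whose error is at most 1/2.\<close>

lemma approx_exists:
  fixes lam :: real
  assumes n: "n \<ge> 1"
    and nonroot: "\<And>P :: int poly. degree P \<le> n \<Longrightarrow> P \<noteq> 0 \<Longrightarrow> poly (map_poly real_of_int P) \<xi> \<noteq> 0"
    and lam: "lam > 0" and adm: "admissible_exponent n \<xi> lam"
  obtains z T0 where "approx n \<xi> lam z T0"
proof -
  let ?f = "\<lambda>a. lerr n \<xi> (rounded n \<xi> a)"
  have "\<forall>T. \<exists>a. 1 \<le> T \<longrightarrow> a \<noteq> 0 \<and> \<bar>a\<bar> \<le> int T \<and>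
      (\<forall>b. b \<noteq> 0 \<longrightarrow> \<bar>b\<bar> \<le> int T \<longrightarrow> ?f a \<le> ?f b \<and> (?f b \<le> ?f a \<longrightarrow> \<bar>a\<bar> \<le> \<bar>b\<bar>))"
    using exists_least_minimizer[of _ ?f] by blast
  then obtain A where A: "\<And>T. 1 \<le> T \<Longrightarrow> A T \<noteq> 0 \<and> \<bar>A T\<bar> \<le> int T \<and>
      (\<forall>b. b \<noteq> 0 \<longrightarrow> \<bar>b\<bar> \<le> int T \<longrightarrow> ?f (A T) \<le> ?f b \<and> (?f b \<le> ?f (A T) \<longrightarrow> \<bar>A T\<bar> \<le> \<bar>b\<bar>))"
    by metis
  define z where "z T = rounded n \<xi> (A T)" for T
  have zmin: "lerr n \<xi> (z T) \<le> lerr n \<xi> x" if T: "1 \<le> T" and x: "\<exists>k\<le>n. x k \<noteq> 0" "\<bar>x 0\<bar> \<le> int T" for T x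
  proof (cases "x 0 = 0")
    case True
    then have "1 \<le> lerr n \<xi> x" using x(1) lerr_ge_1 by blast
    then show ?thesis using lerr_rounded_half[OF n, of \<xi> "A T"] by (simp add: z_def)
  next
    case False
    have "lerr n \<xi> (z T) \<le> ?f (x 0)" unfolding z_def using A[OF T] False x(2) by blast
    also have "\<dots> \<le> lerr n \<xi> x" by (rule lerr_rounded_le[OF n]) simp
    finally show ?thesis .
  qed
  have "\<xi> \<noteq> 0"
  proof
    assume "\<xi> = 0"
    then have "poly (map_poly real_of_int [:0, 1:]) \<xi> = 0" by (simp add: map_poly_pCons)
    then show False using nonroot[of "[:0, 1:]"] n by simp
  qed
  then have pos: "min 1 \<bar>\<xi>\<bar> ^ n / 2 > 0" by simp
  obtain T1 :: real where T1: "\<And>T. T \<ge> T1 \<Longrightarrow> \<exists>x :: nat \<Rightarrow> int. (\<exists>k\<in>{0..n}. x k \<noteq> 0) \<and>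
      \<bar>real_of_int (x 0)\<bar> \<le> T \<and> (MAX k\<in>{1..n}. \<bar>real_of_int (x 0) * \<xi> ^ k - real_of_int (x k)\<bar>) \<le> T powr (- lam)"
    using adm unfolding admissible_exponent_def eventually_at_top_linorder by blast
  have "((\<lambda>T. real T powr (- lam)) \<longlongrightarrow> 0) at_top"
    using lam by (intro tendsto_neg_powr filterlim_real_sequentially) simp
  then have "eventually (\<lambda>T. real T powr (- lam) < min 1 \<bar>\<xi>\<bar> ^ n / 2) at_top"
    using pos by (intro order_tendstoD(2)) auto
  then obtain T2 where T2: "\<And>T. T \<ge> T2 \<Longrightarrow> real T powr (- lam) < min 1 \<bar>\<xi>\<bar> ^ n / 2"
    by (auto simp: eventually_at_top_linorder)
  define T0 where "T0 = 2 + nat \<lceil>T1\<rceil> + T2"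
  have zerr: "lerr n \<xi> (z T) \<le> real T powr (- lam)" if T: "T0 \<le> T" for T
  proof -
    have "T1 \<le> real T" using T unfolding T0_def by linarith
    from T1[OF this] obtain x :: "nat \<Rightarrow> int" where x: "\<exists>k\<in>{0..n}. x k \<noteq> 0" "\<bar>real_of_int (x 0)\<bar> \<le> real T"
      "lerr n \<xi> x \<le> real T powr (- lam)" unfolding lerr_def by blast
    have "\<bar>x 0\<bar> \<le> int T" using x(2) by linarith
    then have "lerr n \<xi> (z T) \<le> lerr n \<xi> x" using x(1) T by (intro zmin) (auto simp: T0_def)
    then show ?thesis using x(3) by linarith
  qed
  have "approx n \<xi> lam z T0"
  proof
    show "T0 \<ge> 2" by (simp add: T0_def)
    fix T assume T: "T0 \<le> T"
    then have T1: "1 \<le> T" by (simp add: T0_def)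
    show "\<bar>z T 0\<bar> \<le> int T" "z T 0 \<noteq> 0" using A[OF T1] by (simp_all add: z_def)
    show "lerr n \<xi> (z T) \<le> real T powr (- lam)" by (rule zerr[OF T])
    then show "lerr n \<xi> (z T) \<le> min 1 \<bar>\<xi>\<bar> ^ n / 2" using T2[of T] T by (simp add: T0_def)
    show "lerr n \<xi> (z T) \<le> lerr n \<xi> x" if "\<exists>k\<le>n. x k \<noteq> 0" "\<bar>x 0\<bar> \<le> int T" for x
      using zmin[OF T1 that] .
    fix T' assume T': "T \<le> T'"
    show "\<bar>z T 0\<bar> \<le> \<bar>z T' 0\<bar>"
    proof (rule ccontr)
      assume "\<not> ?thesis"
      then have lt: "\<bar>A T'\<bar> < \<bar>A T\<bar>" by (simp add: z_def)
      have T1': "1 \<le> T'" using T1 T' by simp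
      have "A T' \<noteq> 0" "\<bar>A T'\<bar> \<le> int T" "A T \<noteq> 0" "\<bar>A T\<bar> \<le> int T'"
        using A[OF T1] A[OF T1'] lt T' by auto
      then have "?f (A T') \<le> ?f (A T)" "?f (A T') \<le> ?f (A T) \<longrightarrow> \<bar>A T\<bar> \<le> \<bar>A T'\<bar>"
        using A[OF T1] A[OF T1'] by blast+
      then show False using lt by simp
    qed
  qed (use n nonroot lam in auto)
  then show ?thesis by (rule that)
qed

lemma admissible_mono:
  assumes "admissible_exponent n \<xi> lam'" "lam \<le> lam'"
  shows "admissible_exponent n \<xi> lam"
  using assms(1) unfolding admissible_exponent_def
proof (rule eventually_elim2[OF _ eventually_ge_at_top[of 1]], goal_cases)
  case (1 T)
  have "T powr (- lam') \<le> T powr (- lam)" using 1(2) assms(2) by (intro powr_mono) auto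
  then show ?case using 1(1) by (meson order_trans)
qed

text \<open>\<open>feasible\<close> speaks of \<open>N\<close> alone. As \<open>lam\<close> exceeds
  \<open>1 / N\<close>, its bootstrap condition implies \<open>gap\<close>, and
  \<open>m * N / (N - 1)\<close> is at most the true exponent \<open>m / (1 - lam)\<close>.\<close>

lemma (in approx) not_feasible:
  assumes N: "1 < lam * N" and ln2: "lam * real n < 2" and n2: "2 \<le> n" and adm: "feasible n N"
  shows False
proof -
  obtain h M j k m where a: "0 < h" "h < 1" "n = 2 * k + j" "1 \<le> j" "2 * j \<le> n + 4"
    "\<And>r. 1 \<le> r \<Longrightarrow> r < j \<Longrightarrow> real r - geo_sum h r \<le> M - (1 - h) * N" "N \<le> real k + geo_sum h j"
    "1 \<le> m" "2 * m \<le> n" "N \<le> real (n - (m - 1))"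
    "M = real m \<or> 2 * m < n \<and> (N - real m) * (N - 1) \<le> real m * real (n - 2 * m + 1) \<and> M = real m * N / (N - 1)"
    using adm unfolding feasible_def by blast
  have lm: "1 < lam * real (n - (m - 1))"
    using N mult_left_mono[OF a(10), of lam] lam by linarith
  have l1: "lam < 1" and lm1: "lam * real m \<le> 1"
  proof -
    have "2 \<le> real n" "2 * real m \<le> real n" using n2 a(9) by simp_all
    then have "lam * 2 \<le> lam * real n" "lam * (2 * real m) \<le> lam * real n"
      using lam by (auto intro!: mult_left_mono)
    then show "lam < 1" "lam * real m \<le> 1" using ln2 by simp_all
  qed
  show False
  proof (cases "M = real m")
    case True
    obtain Tb where Tb: "T0 \<le> Tb" "\<And>T. Tb \<le> T \<Longrightarrow> Suc m \<le> rk n (n - m) {z T}"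
      using rank_eventually[OF a(8,9) lm] by blast
    have "M * (- ln (L T)) \<le> ln (H0 T) + ln Mc" if "Tb \<le> T" for T
      unfolding True using plain_inequality[of T m] Tb that a(9) by simp
    then show False by (rule criterion[OF N ln2 a(1-5) Tb(1) _ a(6,7)])
  next
    case False
    then have b: "2 * m < n" "(N - real m) * (N - 1) \<le> real m * real (n - 2 * m + 1)" "M = real m * N / (N - 1)"
      using a(11) by auto
    have e: "1 - lam * real m < lam * (N - real m)" "1 - lam < lam * (N - 1)" using N by (simp_all add: algebra_simps)
    have "(1 - lam * real m) * (1 - lam) \<le> lam * (N - real m) * (1 - lam)"
      using e l1 by (intro mult_right_mono) auto
    also have "\<dots> < lam * (N - real m) * (lam * (N - 1))"
      using e lm1 by (intro mult_strict_left_mono) linarith+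
    also have "\<dots> = lam * lam * ((N - real m) * (N - 1))" by (simp add: algebra_simps)
    also have "\<dots> \<le> lam * lam * (real m * real (n - 2 * m + 1))" using b(2) lam by (intro mult_left_mono) auto
    also have "\<dots> = lam * real m * (lam * real (n - 2 * m + 1))" by (simp add: algebra_simps)
    finally have gap: "(1 - lam * real m) * (1 - lam) < lam * real m * (lam * real (n - 2 * m + 1))" .
    obtain Tb where Tb: "T0 \<le> Tb" "\<And>T. Tb \<le> T \<Longrightarrow> real m / (1 - lam) * (- ln (L T)) \<le> ln (H0 T) + Kb"
      using boot_eventually[OF a(8) b(1) lm ln2 gap] by blast
    have N1: "N > 1"
    proof -
      have "0 < lam * (N - 1)" using e(2) l1 by linarith
      then show ?thesis using lam by (simp add: zero_less_mult_iff)
    qed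
    have "M \<le> real m / (1 - lam)"
    proof -
      have "real m * (N * (1 - lam)) \<le> real m * (N - 1)" using N by (intro mult_left_mono) (auto simp: algebra_simps)
      then show ?thesis using N1 l1 by (simp add: b(3) divide_le_eq pos_le_divide_eq mult_ac)
    qed
    then have R: "real r - geo_sum h r \<le> real m / (1 - lam) - (1 - h) * N" if "1 \<le> r" "r < j" for r
      using a(6)[OF that] by linarith
    from Tb(2) show False by (rule criterion[OF N ln2 a(1-5) Tb(1) _ R a(7)])
  qed
qed

theorem theorem1p1:
  fixes n :: nat and \<xi> a :: real
  assumes "n \<ge> 2"
    and "extension_degree real_ring \<rat> (rat_adjoin \<xi>) > enat n"
    and "a = (1 - ln 2) / 2"
  shows "uniform_exponent n \<xi> \<le> ereal (1 / (real n / 2 + a * sqrt (real n) + 1 / 3))"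
proof (rule ccontr)
  define N where "N = real n / 2 + tval n"
  have N: "real n / 2 + a * sqrt (real n) + 1 / 3 = N" by (simp add: N_def tval_def assms(3))
  assume "\<not> ?thesis"
  then have "ereal (1 / N) < Sup (ereal ` {lam. 0 \<le> lam \<and> admissible_exponent n \<xi> lam})"
    by (simp add: N uniform_exponent_def not_le)
  then obtain lam' where lam': "admissible_exponent n \<xi> lam'" "1 / N < lam'"
    unfolding less_Sup_iff by auto
  have Nn: "real n / 2 < N" using tval_ge_half[OF assms(1)] by (simp add: N_def)
  have Npos: "N > 0" "real n > 0" using Nn assms(1) by simp_all
  \<comment> \<open>Admissibility passes to smaller exponents, so \<open>lam\<close> may be moved
    strictly between \<open>1 / N\<close> and \<open>2 / n\<close>, an interval that is nonempty
    since \<open>N > n / 2\<close>. The bound \<open>lam * n < 2\<close> gives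
    \<open>lam < 1\<close> and \<open>lam * m \<le> 1\<close>.\<close>
  define lam where "lam = min lam' ((1 / N + 2 / real n) / 2)"
  have "1 / N < 2 / real n" using Nn Npos by (simp add: field_simps)
  moreover have "u < (u + v) / 2 \<and> (u + v) / 2 < v" if "u < v" for u v :: real using that by simp
  ultimately have mid: "1 / N < (1 / N + 2 / real n) / 2" "(1 / N + 2 / real n) / 2 < 2 / real n" by blast+
  have lam: "1 / N < lam" "lam < 2 / real n" "lam \<le> lam'"
    unfolding lam_def using lam'(2) mid(1) le_less_trans[OF min.cobounded2 mid(2)] by (simp_all only: min_less_iff_conj min.cobounded1)
  have lam0: "lam > 0" using lam(1) Npos by (meson less_trans zero_less_divide_1_iff)
  have n1: "n \<ge> 1" using assms(1) by simp
  obtain z T0 where "approx n \<xi> lam z T0"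
    by (rule approx_exists[OF n1 no_small_root[OF assms(2)] lam0 admissible_mono[OF lam'(1) lam(3)]])
  then show False
  proof (rule approx.not_feasible)
    show "1 < lam * N" "lam * real n < 2" using lam Npos by (simp_all add: field_simps)
    show "2 \<le> n" by fact
    show "feasible n N" unfolding N_def by (rule feasible_all[OF assms(1)])
  qed
qed

end
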